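(* Let $\alpha\in(0,2)$, $\beta=\alpha+d$, and $M_\beta(v)=\frac{m}{1+|v|^\beta}$ on $\mathbb{R}^d$ with $m>0$ such that $\langle M_\beta\rangle=1$ (anomalous diffusion scaling). Consider the scheme defined for all $k$ and all time indices $0\le n\le N$ such that $N\Delta t=T$ by \[ \hat\rho^{n+1}(k)=\frac{ \displaystyle\hat{A}_0(t_{n+1},k)+\sum_{j=1}^n \left( c_j\,\hat\rho^{n+1-j}(k)+b_j\,\hat\rho^{n-j}(k) \right) +b_0\,\hat\rho^n(k) }{1-c_0}, \] with the initial condition $\hat\rho^0(k)=\hat\rho(0,k)$, where, for any unit vector $e\in\mathbb{R}^d$, \[ \hat A_0(t,k)=\left\langle \mathrm{e}^{-\frac{t}{\varepsilon^\alpha}(1+\mathrm{i}\varepsilon k\cdot v)}\hat f_0(k,v)\right\rangle, \] \begin{align*} b_j=b_j(k)&= \mathrm{e}^{-\frac{t_j}{\varepsilon^\alpha}}\left(\frac{1-\mathrm{e}^{-\frac{\Delta t}{\varepsilon^\alpha}}}{\frac{\Delta t}{\varepsilon^\alpha}}-\mathrm{e}^{-\frac{\Delta t}{\varepsilon^\alpha}}\right)\left(1-\varepsilon^\alpha|k|^\alpha \left\langle \frac{m}{(\varepsilon|k|)^\beta+|v|^\beta} \right\rangle\right)\\ &\quad+ \varepsilon^\alpha |k|^\alpha \left\langle \left( -\frac{\mathrm{e}^{-\frac{t_{j+1}}{\varepsilon^\alpha}(1+\mathrm{i} v\cdot e)}}{1+\mathrm{i} v\cdot e} +\frac{\varepsilon^\alpha}{\Delta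 t} \mathrm{e}^{-\frac{t_j}{\varepsilon^\alpha}(1+\mathrm{i} v\cdot e)}\frac{1-\mathrm{e}^{-\frac{\Delta t}{\varepsilon^\alpha}(1+\mathrm{i} v\cdot e)}}{(1+\mathrm{i} v\cdot e)^2}\right) \frac{m}{(\varepsilon|k|)^\beta+|v|^\beta}\right\rangle, \end{align*} \begin{align*} c_j=c_j(k)&= \mathrm{e}^{-\frac{t_j}{\varepsilon^\alpha}}\left(1-\frac{1-\mathrm{e}^{-\frac{\Delta t}{\varepsilon^\alpha}}}{\frac{\Delta t}{\varepsilon^\alpha}}\right)\left(1-\varepsilon^\alpha|k|^\alpha \left\langle \frac{m}{(\varepsilon|k|)^\beta+|v|^\beta} \right\rangle\right)\\ &\quad+ \varepsilon^\alpha |k|^\alpha \left\langle \left( \frac{\mathrm{e}^{-\frac{t_j}{\varepsilon^\alpha}(1+\mathrm{i} v\cdot e)}}{1+\mathrm{i} v\cdot e} -\frac{\varepsilon^\alpha}{\Delta t} \mathrm{e}^{-\frac{t_j}{\varepsilon^\alpha}(1+\mathrm{i} v\cdot e)}\frac{1-\mathrm{e}^{-\frac{\Delta t}{\varepsilon^\alpha}(1+\mathrm{i} v\cdot e)}}{(1+\mathrm{i} v\cdot e)^2}\right) \frac{m}{(\varepsilon|k|)^\beta+|v|^\beta}\right\rangle . \end{align*} This scheme has the following properties: (i) The scheme is of order $1$ (in time, as an approximation of the kinetic equation $\varepsilon^\alpha\partial_t f+\varepsilon v\cdot\nabla_x f=\rho M_\beta-f$) and preserves the total mass: for all $n\in\{1,\dots,N\}$,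 $\hat\rho^n(0)=\hat\rho^0(0)$. (ii) The scheme is AP (Asymptotic Preserving): for a fixed $\Delta t$, when $\varepsilon$ goes to zero the scheme solves the anomalous diffusion equation, i.e. it degenerates into \[ \frac{\hat\rho^{n+1}(k)-\hat\rho^{n}(k)}{\Delta t}=-\kappa |k|^\alpha \hat\rho^{n+1}(k), \qquad \kappa=\int_{\mathbb{R}^d}\frac{(w\cdot e)^2}{1+(w\cdot e)^2}\frac{m}{|w|^\beta}\,\mathrm{d}w . \]
   Context: Brackets denote integration over velocity: $\langle h\rangle=\int_{\mathbb{R}^d}h(v)\,\mathrm{d}v$, $d\in\{1,2,3\}$. The kinetic equation, with Knudsen number $\varepsilon>0$, is $\varepsilon^\alpha\partial_t f+\varepsilon v\cdot\nabla_x f=\rho M_\beta-f$ with $\rho(t,x)=\langle f(t,x,v)\rangle$, initial condition $f(0,x,v)=f_0(x,v)$ and periodic boundary conditions in the space variable $x$ in a bounded domain $\Omega\subset\mathbb{R}^d$. Hats denote the Fourier transform in $x$, with Fourier variable $k$; $\hat f_0$ is the Fourier transform of $f_0$ in $x$ and $\hat\rho(0,k)=\langle\hat f_0(k,\cdot)\rangle$. The time discretization is $t_n=n\Delta t$, $n=0,\dots,N$, with $N\Delta t=T$ the final time, and $\hat\rho^n\simeq\hat\rho(t_n)$. The values of $\kappa$, $b_j$, $c_j$ do not depend on the unit vector $e$. For $k=0$ the terms carrying the factor $|k|^\alpha$ in $b_j$ and $c_j$ are understood to be $0$. In constructing the scheme, the paper assumes that the time derivatives of $\hat\rho$ are bounded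 uniformly in $\varepsilon$. A scheme is Asymptotic Preserving (AP) if, for arbitrary initial condition $f_0$, it is consistent with the kinetic equation when $\Delta t\to0$ with $\varepsilon$ fixed, and it degenerates into a scheme solving the asymptotic equation when $\varepsilon\to0$ with $\Delta t$ fixed; here the asymptotic equation is the anomalous diffusion equation $\partial_t\hat\rho(t,k)=-\kappa|k|^\alpha\hat\rho(t,k)$. *)

theory Defs
  imports "HOL-Analysis.Analysis"
begin

section \<open>Kinetic equation\<close>

text \<open>
  Space and velocity live in \<open>real ^ 'd\<close>.  The periodic domain is the cell \<open>cbox lo hi\<close>, functions
  of the space variable being extended periodically to the whole space.  Phase space functions take
  the space variable first and the velocity second.
\<close>

type_synonym 'd phase_fun = "real ^ 'd \<Rightarrow> real ^ 'd \<Rightarrow> real"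

definition equilibrium :: "real \<Rightarrow> real \<Rightarrow> real ^ 'd::finite \<Rightarrow> real" where
  "equilibrium m \<beta> v = m / (1 + norm v powr \<beta>)"

definition density :: "'d::finite phase_fun \<Rightarrow> real ^ 'd \<Rightarrow> real" where
  "density g x = (LINT v|lborel. g x v)"

definition periodic_in_space :: "real ^ 'd \<Rightarrow> real ^ 'd \<Rightarrow> 'd::finite phase_fun \<Rightarrow> bool" where
  "periodic_in_space lo hi g \<longleftrightarrow> (\<forall>x v i. g (x + axis i (hi $ i - lo $ i)) v = g x v)"

definition integrable_on_phase_space ::
    "real ^ 'd \<Rightarrow> real ^ 'd \<Rightarrow> 'd::finite phase_fun \<Rightarrow> bool" where
  "integrable_on_phase_space lo hi g \<longleftrightarrow>
     set_integrable (lborel \<Otimes>\<^sub>M lborel) (cbox lo hi \<times> UNIV) (\<lambda>(x, v). g x v)"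

definition initial_datum :: "real ^ 'd \<Rightarrow> real ^ 'd \<Rightarrow> 'd::finite phase_fun \<Rightarrow> bool" where
  "initial_datum lo hi f0 \<longleftrightarrow> periodic_in_space lo hi f0 \<and> integrable_on_phase_space lo hi f0"

text \<open>
  Classical solutions on \<open>[0, T]\<close>: for every velocity the solution is continuously differentiable in
  \<open>(t, x)\<close>, with time derivative \<open>ft\<close> (one-sided at the end points) and space gradient \<open>fx\<close>.
  Integrability in \<open>v\<close> at every point is required because the density would otherwise
  be the default value of the integral.
\<close>

definition solves_kinetic ::
    "real ^ 'd \<Rightarrow> real ^ 'd \<Rightarrow> real \<Rightarrow> real \<Rightarrow> real \<Rightarrow> real \<Rightarrow> real
      \<Rightarrow> 'd::finite phase_fun \<Rightarrow> (real \<Rightarrow> 'd phase_fun) \<Rightarrow> bool" where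
  "solves_kinetic lo hi \<alpha> \<beta> m T \<epsilon> f0 f \<longleftrightarrow>
     f 0 = f0 \<and>
     (\<forall>t\<in>{0..T}. periodic_in_space lo hi (f t) \<and> integrable_on_phase_space lo hi (f t) \<and>
        (\<forall>x. integrable lborel (f t x))) \<and>
     (\<exists>(ft :: real \<Rightarrow> real ^ 'd \<Rightarrow> real ^ 'd \<Rightarrow> real)
        (fx :: real \<Rightarrow> real ^ 'd \<Rightarrow> real ^ 'd \<Rightarrow> real ^ 'd).
        (\<forall>v. continuous_on ({0..T} \<times> UNIV) (\<lambda>(t, x). f t x v) \<and>
             continuous_on ({0..T} \<times> UNIV) (\<lambda>(t, x). ft t x v) \<and>
             continuous_on ({0..T} \<times> UNIV) (\<lambda>(t, x). fx t x v)) \<and>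
        (\<forall>t\<in>{0..T}. \<forall>x v.
             ((\<lambda>s. f s x v) has_real_derivative ft t x v) (at t within {0..T}) \<and>
             GDERIV (\<lambda>y. f t y v) x :> fx t x v \<and>
             \<epsilon> powr \<alpha> * ft t x v + \<epsilon> * (v \<bullet> fx t x v)
               = density (f t) x * equilibrium m \<beta> v - f t x v))"


section \<open>Fourier variables\<close>

definition frequencies :: "real ^ 'd \<Rightarrow> real ^ 'd \<Rightarrow> (real ^ 'd::finite) set" where
  "frequencies lo hi = {k. \<forall>i. \<exists>z::int. k $ i * (hi $ i - lo $ i) = 2 * pi * of_int z}"

text \<open>Not divided by the volume of the cell, so that the mode \<open>0\<close> of the density is the total mass.\<close>

definition fourier :: "real ^ 'd \<Rightarrow> real ^ 'd \<Rightarrow> (real ^ 'd::finite \<Rightarrow> real) \<Rightarrow> real ^ 'd \<Rightarrow> complex" where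
  "fourier lo hi g k =
     (LINT x:cbox lo hi|lborel. exp (- \<i> * complex_of_real (k \<bullet> x)) * complex_of_real (g x))"

definition rho_hat ::
    "real ^ 'd \<Rightarrow> real ^ 'd \<Rightarrow> (real \<Rightarrow> 'd::finite phase_fun) \<Rightarrow> real ^ 'd \<Rightarrow> real \<Rightarrow> complex" where
  "rho_hat lo hi f k t = fourier lo hi (density (f t)) k"

definition f0_hat ::
    "real ^ 'd \<Rightarrow> real ^ 'd \<Rightarrow> 'd::finite phase_fun \<Rightarrow> real ^ 'd \<Rightarrow> real ^ 'd \<Rightarrow> complex" where
  "f0_hat lo hi f0 k v = fourier lo hi (\<lambda>x. f0 x v) k"

definition rho0_hat :: "real ^ 'd \<Rightarrow> real ^ 'd \<Rightarrow> 'd::finite phase_fun \<Rightarrow> real ^ 'd \<Rightarrow> complex" where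
  "rho0_hat lo hi f0 k = (LINT v|lborel. f0_hat lo hi f0 k v)"

definition A0_hat ::
    "real ^ 'd \<Rightarrow> real ^ 'd \<Rightarrow> real \<Rightarrow> real \<Rightarrow> 'd::finite phase_fun \<Rightarrow> real ^ 'd \<Rightarrow> real \<Rightarrow> complex" where
  "A0_hat lo hi \<alpha> \<epsilon> f0 k t =
     (LINT v|lborel. exp (- complex_of_real (t / \<epsilon> powr \<alpha>) * (1 + \<i> * complex_of_real (\<epsilon> * (k \<bullet> v))))
        * f0_hat lo hi f0 k v)"


section \<open>The scheme\<close>

definition weight :: "real \<Rightarrow> real \<Rightarrow> real \<Rightarrow> real ^ 'd \<Rightarrow> real ^ 'd::finite \<Rightarrow> real" where
  "weight m \<beta> \<epsilon> k v = m / ((\<epsilon> * norm k) powr \<beta> + norm v powr \<beta>)"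

text \<open>
  For \<open>k = 0\<close> the weight is not integrable, but since \<open>0 powr \<alpha> = 0\<close> all terms carrying
  \<open>norm k powr \<alpha>\<close> vanish, as they should.  The coefficients are those obtained by integrating exactly
  the Duhamel formula for \<open>\<rho>\<close> interpolated linearly between the time steps; \<open>\<Delta>\<close> is the time step.
\<close>

definition coeff_b ::
    "real \<Rightarrow> real \<Rightarrow> real \<Rightarrow> real ^ 'd::finite \<Rightarrow> real \<Rightarrow> real \<Rightarrow> real ^ 'd \<Rightarrow> nat \<Rightarrow> complex" where
  "coeff_b \<alpha> \<beta> m e \<epsilon> \<Delta> k j =
    (let t = (\<lambda>i. real i * \<Delta>);
         z = (\<lambda>v. 1 + \<i> * complex_of_real (v \<bullet> e))
     in complex_of_real
          (exp (- t j / \<epsilon> powr \<alpha>)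
           * ((1 - exp (- \<Delta> / \<epsilon> powr \<alpha>)) / (\<Delta> / \<epsilon> powr \<alpha>) - exp (- \<Delta> / \<epsilon> powr \<alpha>))
           * (1 - \<epsilon> powr \<alpha> * norm k powr \<alpha> * (LINT v|lborel. weight m \<beta> \<epsilon> k v)))
        + complex_of_real (\<epsilon> powr \<alpha> * norm k powr \<alpha>)
          * (LINT v|lborel.
              (- (exp (- complex_of_real (t (j + 1) / \<epsilon> powr \<alpha>) * z v) / z v)
               + complex_of_real (\<epsilon> powr \<alpha> / \<Delta>) * exp (- complex_of_real (t j / \<epsilon> powr \<alpha>) * z v)
                 * ((1 - exp (- complex_of_real (\<Delta> / \<epsilon> powr \<alpha>) * z v)) / (z v)\<^sup>2))
              * complex_of_real (weight m \<beta> \<epsilon> k v)))"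

definition coeff_c ::
    "real \<Rightarrow> real \<Rightarrow> real \<Rightarrow> real ^ 'd::finite \<Rightarrow> real \<Rightarrow> real \<Rightarrow> real ^ 'd \<Rightarrow> nat \<Rightarrow> complex" where
  "coeff_c \<alpha> \<beta> m e \<epsilon> \<Delta> k j =
    (let t = (\<lambda>i. real i * \<Delta>);
         z = (\<lambda>v. 1 + \<i> * complex_of_real (v \<bullet> e))
     in complex_of_real
          (exp (- t j / \<epsilon> powr \<alpha>)
           * (1 - (1 - exp (- \<Delta> / \<epsilon> powr \<alpha>)) / (\<Delta> / \<epsilon> powr \<alpha>))
           * (1 - \<epsilon> powr \<alpha> * norm k powr \<alpha> * (LINT v|lborel. weight m \<beta> \<epsilon> k v)))
        + complex_of_real (\<epsilon> powr \<alpha> * norm k powr \<alpha>)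
          * (LINT v|lborel.
              (exp (- complex_of_real (t j / \<epsilon> powr \<alpha>) * z v) / z v
               - complex_of_real (\<epsilon> powr \<alpha> / \<Delta>) * exp (- complex_of_real (t j / \<epsilon> powr \<alpha>) * z v)
                 * ((1 - exp (- complex_of_real (\<Delta> / \<epsilon> powr \<alpha>) * z v)) / (z v)\<^sup>2))
              * complex_of_real (weight m \<beta> \<epsilon> k v)))"

definition history_step ::
    "(nat \<Rightarrow> complex) \<Rightarrow> (nat \<Rightarrow> complex) \<Rightarrow> (nat \<Rightarrow> complex) \<Rightarrow> (nat \<Rightarrow> complex) \<Rightarrow> nat \<Rightarrow> complex" where
  "history_step A b c r n =
     (A (n + 1) + (\<Sum>j=1..n. c j * r (n + 1 - j) + b j * r (n - j)) + b 0 * r n) / (1 - c 0)"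

lemma history_step_cong [fundef_cong]:
  assumes "A = A'" "b = b'" "c = c'" "n = n'" "\<And>i. i \<le> n' \<Longrightarrow> r i = r' i"
  shows "history_step A b c r n = history_step A' b' c' r' n'"
  using assms by (auto simp: history_step_def intro!: sum.cong)

fun history_scheme ::
    "(nat \<Rightarrow> complex) \<Rightarrow> (nat \<Rightarrow> complex) \<Rightarrow> (nat \<Rightarrow> complex) \<Rightarrow> complex \<Rightarrow> nat \<Rightarrow> complex" where
  "history_scheme A b c r0 0 = r0"
| "history_scheme A b c r0 (Suc n) = history_step A b c (\<lambda>i. history_scheme A b c r0 i) n"

text \<open>\<open>duhamel_step \<dots> r n\<close> is the value at \<open>t\<^sub>n\<^sub>+\<^sub>1\<close> that the scheme computes from \<open>r 0, \<dots>, r n\<close>.\<close>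

definition duhamel_step ::
    "real ^ 'd \<Rightarrow> real ^ 'd \<Rightarrow> real \<Rightarrow> real \<Rightarrow> real \<Rightarrow> real ^ 'd \<Rightarrow> real \<Rightarrow> real
      \<Rightarrow> 'd::finite phase_fun \<Rightarrow> real ^ 'd \<Rightarrow> (nat \<Rightarrow> complex) \<Rightarrow> nat \<Rightarrow> complex" where
  "duhamel_step lo hi \<alpha> \<beta> m e \<epsilon> \<Delta> f0 k =
     history_step (\<lambda>n. A0_hat lo hi \<alpha> \<epsilon> f0 k (real n * \<Delta>))
       (coeff_b \<alpha> \<beta> m e \<epsilon> \<Delta> k) (coeff_c \<alpha> \<beta> m e \<epsilon> \<Delta> k)"

definition duhamel_scheme ::
    "real ^ 'd \<Rightarrow> real ^ 'd \<Rightarrow> real \<Rightarrow> real \<Rightarrow> real \<Rightarrow> real ^ 'd \<Rightarrow> real \<Rightarrow> real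
      \<Rightarrow> 'd::finite phase_fun \<Rightarrow> real ^ 'd \<Rightarrow> nat \<Rightarrow> complex" where
  "duhamel_scheme lo hi \<alpha> \<beta> m e \<epsilon> \<Delta> f0 k =
     history_scheme (\<lambda>n. A0_hat lo hi \<alpha> \<epsilon> f0 k (real n * \<Delta>))
       (coeff_b \<alpha> \<beta> m e \<epsilon> \<Delta> k) (coeff_c \<alpha> \<beta> m e \<epsilon> \<Delta> k) (rho0_hat lo hi f0 k)"


section \<open>Order, consistency, asymptotic preservation\<close>

text \<open>
  A scheme is given by its one-step map \<open>D \<epsilon> \<Delta> f0 k\<close> and its values \<open>S \<epsilon> \<Delta> f0 k n\<close>.  Its local error
  is the defect of the exact solution in one step, its global error the difference between the
  computed and the exact values; the time step is \<open>T / N\<close>.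
\<close>

definition local_error :: "((nat \<Rightarrow> complex) \<Rightarrow> nat \<Rightarrow> complex) \<Rightarrow> real \<Rightarrow> (real \<Rightarrow> complex) \<Rightarrow> nat \<Rightarrow> real" where
  "local_error step \<Delta> r n =
     norm (r (real (n + 1) * \<Delta>) - step (\<lambda>i. r (real i * \<Delta>)) n)"

definition global_error :: "(nat \<Rightarrow> complex) \<Rightarrow> real \<Rightarrow> (real \<Rightarrow> complex) \<Rightarrow> nat \<Rightarrow> real" where
  "global_error s \<Delta> r n = norm (s n - r (real n * \<Delta>))"

definition time_derivatives_bounded :: "real \<Rightarrow> real \<Rightarrow> (real \<Rightarrow> complex) \<Rightarrow> bool" where
  "time_derivatives_bounded T B r \<longleftrightarrow>
     (\<exists>r1 r2. \<forall>t\<in>{0..T}.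
        (r has_vector_derivative r1 t) (at t within {0..T}) \<and>
        (r1 has_vector_derivative r2 t) (at t within {0..T}) \<and>
        norm (r1 t) \<le> B \<and> norm (r2 t) \<le> B)"

text \<open>
  Order \<open>p\<close>: local error \<open>O(\<Delta>\<^sup>p\<^sup>+\<^sup>1)\<close> and global error \<open>O(\<Delta>\<^sup>p)\<close>.  The constants depend on the solution
  only through the bound \<open>B\<close> of the time derivatives of its density, hence are uniform in \<open>\<epsilon>\<close> as soon
  as that bound is.
\<close>

definition order_in_time ::
    "real ^ 'd \<Rightarrow> real ^ 'd \<Rightarrow> real \<Rightarrow> real \<Rightarrow> real \<Rightarrow> real
      \<Rightarrow> (real \<Rightarrow> real \<Rightarrow> 'd::finite phase_fun \<Rightarrow> real ^ 'd \<Rightarrow> (nat \<Rightarrow> complex) \<Rightarrow> nat \<Rightarrow> complex)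
      \<Rightarrow> (real \<Rightarrow> real \<Rightarrow> 'd phase_fun \<Rightarrow> real ^ 'd \<Rightarrow> nat \<Rightarrow> complex) \<Rightarrow> nat \<Rightarrow> bool" where
  "order_in_time lo hi \<alpha> \<beta> m T D S p \<longleftrightarrow>
     (\<exists>C. \<forall>\<epsilon>>0. \<forall>f0 f. \<forall>k\<in>frequencies lo hi. \<forall>B.
        solves_kinetic lo hi \<alpha> \<beta> m T \<epsilon> f0 f \<longrightarrow>
        time_derivatives_bounded T B (rho_hat lo hi f k) \<longrightarrow>
        (\<forall>N\<ge>1.
          (\<forall>n<N. local_error (D \<epsilon> (T / real N) f0 k) (T / real N) (rho_hat lo hi f k) n
                  \<le> C * B * (T / real N) ^ (p + 1)) \<and>
          (\<forall>n\<le>N. global_error (S \<epsilon> (T / real N) f0 k) (T / real N) (rho_hat lo hi f k) n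
                  \<le> C * B * (T / real N) ^ p)))"

text \<open>
  No smoothness in time of the density is assumed here: the local and global errors tend to \<open>0\<close>,
  uniformly over the time steps, for every initial datum of a classical solution.
\<close>

definition consistent_with_kinetic ::
    "real ^ 'd \<Rightarrow> real ^ 'd \<Rightarrow> real \<Rightarrow> real \<Rightarrow> real \<Rightarrow> real
      \<Rightarrow> (real \<Rightarrow> real \<Rightarrow> 'd::finite phase_fun \<Rightarrow> real ^ 'd \<Rightarrow> (nat \<Rightarrow> complex) \<Rightarrow> nat \<Rightarrow> complex)
      \<Rightarrow> (real \<Rightarrow> real \<Rightarrow> 'd phase_fun \<Rightarrow> real ^ 'd \<Rightarrow> nat \<Rightarrow> complex) \<Rightarrow> real \<Rightarrow> bool" where
  "consistent_with_kinetic lo hi \<alpha> \<beta> m T D S \<epsilon> \<longleftrightarrow>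
     (\<forall>f0 f. \<forall>k\<in>frequencies lo hi. solves_kinetic lo hi \<alpha> \<beta> m T \<epsilon> f0 f \<longrightarrow>
        (\<forall>\<eta>>0. \<forall>\<^sub>F N in sequentially.
          (\<forall>n<N. local_error (D \<epsilon> (T / real N) f0 k) (T / real N) (rho_hat lo hi f k) n < \<eta>) \<and>
          (\<forall>n\<le>N. global_error (S \<epsilon> (T / real N) f0 k) (T / real N) (rho_hat lo hi f k) n < \<eta>)))"

definition kappa :: "real \<Rightarrow> real \<Rightarrow> real ^ 'd::finite \<Rightarrow> real" where
  "kappa \<beta> m e = (LINT w|lborel. (w \<bullet> e)\<^sup>2 / (1 + (w \<bullet> e)\<^sup>2) * (m / norm w powr \<beta>))"

definition solves_anomalous_diffusion ::
    "real \<Rightarrow> real \<Rightarrow> real ^ 'd::finite \<Rightarrow> real \<Rightarrow> (real \<Rightarrow> complex) \<Rightarrow> bool" where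
  "solves_anomalous_diffusion \<alpha> \<kappa> k T u \<longleftrightarrow>
     (\<forall>t\<in>{0..T}. (u has_vector_derivative - complex_of_real (\<kappa> * norm k powr \<alpha>) * u t)
        (at t within {0..T}))"

text \<open>\<open>L \<Delta> f0 k n\<close> are the values of the scheme reached in the limit \<open>\<epsilon> \<rightarrow> 0\<close>.\<close>

definition asymptotic_preserving ::
    "real ^ 'd \<Rightarrow> real ^ 'd \<Rightarrow> real \<Rightarrow> real \<Rightarrow> real \<Rightarrow> real \<Rightarrow> real
      \<Rightarrow> (real \<Rightarrow> real \<Rightarrow> 'd::finite phase_fun \<Rightarrow> real ^ 'd \<Rightarrow> (nat \<Rightarrow> complex) \<Rightarrow> nat \<Rightarrow> complex)
      \<Rightarrow> (real \<Rightarrow> real \<Rightarrow> 'd phase_fun \<Rightarrow> real ^ 'd \<Rightarrow> nat \<Rightarrow> complex)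
      \<Rightarrow> (real \<Rightarrow> 'd phase_fun \<Rightarrow> real ^ 'd \<Rightarrow> nat \<Rightarrow> complex) \<Rightarrow> bool" where
  "asymptotic_preserving lo hi \<alpha> \<beta> m \<kappa> T D S L \<longleftrightarrow>
     (\<forall>\<epsilon>>0. consistent_with_kinetic lo hi \<alpha> \<beta> m T D S \<epsilon>) \<and>
     (\<forall>f0. \<forall>k\<in>frequencies lo hi. initial_datum lo hi f0 \<longrightarrow>
        (\<forall>N\<ge>1. \<forall>n\<le>N.
          ((\<lambda>\<epsilon>. S \<epsilon> (T / real N) f0 k n) \<longlongrightarrow> L (T / real N) f0 k n) (at_right 0)) \<and>
        (\<forall>u. solves_anomalous_diffusion \<alpha> \<kappa> k T u \<and> u 0 = rho0_hat lo hi f0 k \<longrightarrow>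
          (\<forall>\<eta>>0. \<forall>\<^sub>F N in sequentially. \<forall>n\<le>N.
            global_error (L (T / real N) f0 k) (T / real N) u n < \<eta>)))"

end

theory Submission
  imports Defs "HOL-Real_Asymp.Real_Asymp"
begin

text \<open>
  For fixed velocity \<open>v\<close> the kinetic equation in Fourier variables is a scalar linear equation with
  source \<open>M(v) \<rho>\<close> and complex rate \<open>z = 1 + \<i> \<epsilon> k \<bullet> v\<close> on the time scale \<open>\<epsilon>\<^sup>\<alpha>\<close>.  Duhamel's formula, averaged over
  \<open>v\<close>, is a Volterra equation for \<open>\<rho>\<close>; the scheme integrates it exactly after linear interpolation of
  \<open>\<rho>\<close> in time.  A rotation and the scaling \<open>w = \<epsilon> |k| v\<close> show that the coefficients, written with
  singular weights, are averages of these exact integrals over the probability density \<open>M\<close>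
  (\<open>coeff_eq_kernel_average\<close>).  In particular they are dominated by their values at \<open>z = 1\<close>, which
  are nonnegative with partial sums less than one, so that \<open>c\<^sub>0 \<noteq> 1\<close>.

  Order and consistency.  Inserting the exact density leaves the averaged interpolation error,
  damped by \<open>exp (- s)\<close> (\<open>duhamel_defect_bound\<close>).  Since linear sequences are integrated exactly, they
  are supersolutions of the dominating recursion, and comparison with them
  (\<open>history_errors\<close>) bounds the global error without the exponential factor of Gronwall's lemma, which
  would destroy uniformity in \<open>\<epsilon>\<close>.  When the time step exceeds the relaxation time \<open>\<epsilon>\<^sup>\<alpha>\<close>, the division by
  \<open>1 - c\<^sub>0\<close> is expensive, but then the exponential concentrates near the newest time, where the
  interpolation error vanishes; the two effects cancel.  Consistency needs only continuity of the
  density in time, which the equation itself provides.  In the mode \<open>0\<close> the scheme reproduces constants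
  exactly, which is conservation of mass.

  Limit \<open>\<epsilon> \<rightarrow> 0\<close>.  Both sides of the step are multiplied by \<open>\<tau> = \<Delta> / \<epsilon>\<^sup>\<alpha>\<close>.  The initial layer and all but
  the newest weights decay like \<open>\<tau> exp (- \<tau>)\<close>, while \<open>\<tau> b\<^sub>0\<close> tends to \<open>1\<close>.  In \<open>\<tau> (1 - c\<^sub>0)\<close> the average of
  \<open>1 - 1 / z\<close> appears, whose odd part cancels and whose even part, after the same scaling, converges to
  \<open>\<Delta> \<kappa> |k|\<^sup>\<alpha>\<close> (\<open>fractional_symbol_limit\<close>, \<open>rescaled_denominator_limit\<close>).  The limit is the implicit Euler
  method for the anomalous diffusion equation, which converges.
\<close>


section \<open>Invariance of Lebesgue measure\<close>

text \<open>
  This is the uniqueness of Haar measure, specialised.  With the unit ball \<open>B\<close>, integrate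
  \<open>h (f x) * B (y - f x)\<close> over both variables: translating \<open>y\<close> gives \<open>(\<integral> h \<circ> f) * \<bar>B\<bar>\<close>.  Reflecting and
  translating \<open>x\<close> turns the integrand into \<open>h (y - f x) * B (f x)\<close>, whose integral is
  \<open>(\<integral> h) * \<bar>B\<bar>\<close> because \<open>f\<close> preserves the ball.
\<close>

lemma nn_integral_orthogonal_transformation:
  fixes f :: "'a::euclidean_space \<Rightarrow> 'a" and h :: "'a \<Rightarrow> ennreal"
  assumes f: "orthogonal_transformation f" and h[measurable]: "h \<in> borel_measurable borel"
  shows "(\<integral>\<^sup>+x. h (f x) \<partial>lborel) = (\<integral>\<^sup>+x. h x \<partial>lborel)"
proof -
  define B :: "'a \<Rightarrow> ennreal" where "B = indicator (ball 0 1)"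
  have [measurable]: "B \<in> borel_measurable borel"
    unfolding B_def by (intro borel_measurable_indicator) simp
  interpret L: linear f
    using f by (rule orthogonal_transformation_linear)
  have [measurable]: "f \<in> borel_measurable borel"
    by (intro borel_measurable_continuous_onI linear_continuous_on L.linear_axioms
        linear_conv_bounded_linear[THEN iffD1])
  have refl_shift: "(\<integral>\<^sup>+x. g (a - x) \<partial>lborel) = (\<integral>\<^sup>+x. g x \<partial>lborel)"
    if [measurable]: "g \<in> borel_measurable borel" for g :: "'a \<Rightarrow> ennreal" and a
    using nn_integral_density[of "\<lambda>x. 1" "distr lborel borel (\<lambda>x. a + (-1) *\<^sub>R x)" g]
    by (subst (2) lborel_affine[of "-1" a]) (simp_all add: nn_integral_distr density_1)
  have shift: "(\<integral>\<^sup>+x. g (x - a) \<partial>lborel) = (\<integral>\<^sup>+x. g x \<partial>lborel)"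
    if [measurable]: "g \<in> borel_measurable borel" for g :: "'a \<Rightarrow> ennreal" and a
    using nn_integral_density[of "\<lambda>x. 1" "distr lborel borel (\<lambda>x. -a + 1 *\<^sub>R x)" g]
    by (subst (2) lborel_affine[of 1 "-a"]) (simp_all add: nn_integral_distr density_1)
  have swap: "(\<integral>\<^sup>+x. \<integral>\<^sup>+y. F x y \<partial>lborel \<partial>lborel) = (\<integral>\<^sup>+y. \<integral>\<^sup>+x. F x y \<partial>lborel \<partial>lborel)"
    if "case_prod F \<in> borel_measurable (lborel \<Otimes>\<^sub>M lborel)" for F :: "'a \<Rightarrow> 'a \<Rightarrow> ennreal"
    using lborel_pair.Fubini'[OF that] by simp
  have Bf: "B (f x) = B x" for x
    using f by (simp add: B_def indicator_def orthogonal_transformation_norm)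
  have Bint: "(\<integral>\<^sup>+x. B x \<partial>lborel) = emeasure lborel (ball (0::'a) 1)"
    by (simp add: B_def)
  have "(\<integral>\<^sup>+x. h (f x) \<partial>lborel) * emeasure lborel (ball (0::'a) 1)
      = (\<integral>\<^sup>+x. \<integral>\<^sup>+y. h (f x) * B (y - f x) \<partial>lborel \<partial>lborel)"
    using shift[of B] by (simp add: nn_integral_cmult nn_integral_multc Bint)
  also have "\<dots> = (\<integral>\<^sup>+y. \<integral>\<^sup>+x. h (f x) * B (y - f x) \<partial>lborel \<partial>lborel)"
    by (rule swap) simp
  also have "\<dots> = (\<integral>\<^sup>+y. \<integral>\<^sup>+x. h (y - f x) * B (f x) \<partial>lborel \<partial>lborel)"
  proof (rule nn_integral_cong)
    fix y :: 'a
    obtain u where u: "y = f u"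
      using f by (meson orthogonal_transformation_surj surjD)
    have "(\<integral>\<^sup>+x. h (f x) * B (y - f x) \<partial>lborel) = (\<integral>\<^sup>+x. h (f (u - x)) * B (y - f (u - x)) \<partial>lborel)"
      by (rule refl_shift[symmetric]) simp
    then show "(\<integral>\<^sup>+x. h (f x) * B (y - f x) \<partial>lborel) = (\<integral>\<^sup>+x. h (y - f x) * B (f x) \<partial>lborel)"
      by (simp add: u L.diff)
  qed
  also have "\<dots> = (\<integral>\<^sup>+x. \<integral>\<^sup>+y. h (y - f x) * B (f x) \<partial>lborel \<partial>lborel)"
    by (rule swap[symmetric]) simp
  also have "\<dots> = (\<integral>\<^sup>+y. h y \<partial>lborel) * emeasure lborel (ball (0::'a) 1)"
    using shift[of h] by (simp add: nn_integral_cmult nn_integral_multc Bf Bint)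
  finally have eq: "(\<integral>\<^sup>+x. h (f x) \<partial>lborel) * emeasure lborel (ball (0::'a) 1)
      = (\<integral>\<^sup>+y. h y \<partial>lborel) * emeasure lborel (ball (0::'a) 1)" .
  have "emeasure lborel (ball (0::'a) 1) \<noteq> 0"
    by (simp add: emeasure_ball ennreal_eq_0_iff not_le)
  moreover have "emeasure lborel (ball (0::'a) 1) \<noteq> top"
    by (simp add: emeasure_ball)
  ultimately show ?thesis
    using eq by (simp add: mult.commute[of _ "emeasure _ _"] ennreal_mult_cancel_left)
qed

lemma lborel_distr_orthogonal_transformation:
  fixes f :: "'a::euclidean_space \<Rightarrow> 'a"
  assumes f: "orthogonal_transformation f"
  shows "distr lborel borel f = lborel"
proof (rule measure_eqI)
  interpret L: linear f
    using f by (rule orthogonal_transformation_linear)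
  have [measurable]: "f \<in> borel_measurable borel"
    by (intro borel_measurable_continuous_onI linear_continuous_on L.linear_axioms
        linear_conv_bounded_linear[THEN iffD1])
  fix A :: "'a set"
  assume "A \<in> sets (distr lborel borel f)"
  then have A[measurable]: "A \<in> sets borel" by simp
  have "emeasure (distr lborel borel f) A = (\<integral>\<^sup>+x. indicator A x \<partial>distr lborel borel f)"
    by simp
  also have "\<dots> = (\<integral>\<^sup>+x. indicator A (f x) \<partial>lborel)"
    by (rule nn_integral_distr) simp_all
  also have "\<dots> = emeasure lborel A"
    by (subst nn_integral_orthogonal_transformation[OF f, of "indicator A"]) simp_all
  finally show "emeasure (distr lborel borel f) A = emeasure lborel A" .
qed simp

lemma integral_lborel_scale:
  fixes g :: "'a::euclidean_space \<Rightarrow> 'b::{banach, second_countable_topology}"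
  assumes [measurable]: "g \<in> borel_measurable borel" and "c > 0"
  shows "(LINT x|lborel. g x) = c ^ DIM('a) *\<^sub>R (LINT x|lborel. g (c *\<^sub>R x))"
  by (subst lborel_affine[of c 0])
     (use assms in \<open>simp_all add: integral_density integral_distr\<close>)


section \<open>Averages over the equilibrium\<close>

lemma equilibrium_pos: "m > 0 \<Longrightarrow> equilibrium m \<beta> v > 0"
  by (simp add: equilibrium_def add_pos_nonneg)

lemma equilibrium_measurable [measurable]: "equilibrium m \<beta> \<in> borel_measurable borel"
  unfolding equilibrium_def[abs_def] by measurable

lemma weight_measurable [measurable]: "weight m \<beta> \<epsilon> k \<in> borel_measurable borel"
  unfolding weight_def[abs_def] by measurable

lemma equilibrium_integrable:
  assumes "(LINT v|lborel. equilibrium m \<beta> (v :: real ^ 'd::finite)) = 1"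
  shows "integrable lborel (equilibrium m \<beta> :: real ^ 'd \<Rightarrow> real)"
  using assms not_integrable_integral_eq by fastforce

lemma norm_integral_le_integral:
  fixes f :: "'a \<Rightarrow> 'b::{banach, second_countable_topology}"
  assumes "integrable M g" and "\<And>x. norm (f x) \<le> g x"
  shows "norm (integral\<^sup>L M f) \<le> integral\<^sup>L M g"
proof -
  have "norm (integral\<^sup>L M f) \<le> (LINT x|M. norm (f x))"
    by (rule integral_norm_bound)
  also have "\<dots> \<le> integral\<^sup>L M g"
    using assms order_trans[OF norm_ge_zero assms(2)] by (intro integral_mono') simp_all
  finally show ?thesis .
qed

text \<open>
  The equilibrium is a probability density, so bounds that hold for each velocity survive
  averaging.
\<close>

lemma equilibrium_average_bound:
  fixes G :: "real ^ 'd::finite \<Rightarrow> 'b::{banach, second_countable_topology}"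
  assumes m: "m > 0" and normalised: "(LINT v|lborel. equilibrium m \<beta> (v :: real ^ 'd)) = 1"
    and G: "\<And>v. norm (G v) \<le> D"
  shows "norm (LINT v|lborel. equilibrium m \<beta> v *\<^sub>R G v) \<le> D"
proof -
  note M = equilibrium_integrable[OF normalised]
  have pos: "equilibrium m \<beta> v \<ge> 0" for v :: "real ^ 'd"
    using equilibrium_pos[OF m] by (rule less_imp_le)
  have "norm (LINT v|lborel. equilibrium m \<beta> v *\<^sub>R G v) \<le> (LINT v|lborel. equilibrium m \<beta> (v :: real ^ 'd) * D)"
    using M G pos by (intro norm_integral_le_integral) (auto intro!: mult_left_mono)
  also have "\<dots> = D" using normalised by simp
  finally show ?thesis .
qed

lemma equilibrium_average_integrable:
  fixes G :: "real ^ 'd::finite \<Rightarrow> 'b::{banach, second_countable_topology}"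
  assumes normalised: "(LINT v|lborel. equilibrium m \<beta> (v :: real ^ 'd)) = 1"
    and [measurable]: "G \<in> borel_measurable borel" and G: "\<And>v. norm (G v) \<le> D"
  shows "integrable lborel (\<lambda>v. equilibrium m \<beta> v *\<^sub>R G v)"
proof -
  note M = equilibrium_integrable[OF normalised]
  have D: "D \<ge> 0" using norm_ge_zero order_trans[OF _ G] by blast
  show ?thesis
    by (rule Bochner_Integration.integrable_bound[OF integrable_mult_left[OF M, of D]])
       (use G D in \<open>auto simp: abs_mult intro!: mult_left_mono\<close>)
qed

lemma equilibrium_average_odd:
  fixes G :: "real ^ 'd::finite \<Rightarrow> real"
  assumes [measurable]: "G \<in> borel_measurable borel" and odd: "\<And>v. G (- v) = - G v"
  shows "(LINT v|lborel. equilibrium m \<beta> v *\<^sub>R G v) = 0"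
proof -
  have "orthogonal_transformation (uminus :: real ^ 'd \<Rightarrow> real ^ 'd)"
    by (simp add: orthogonal_transformation_def linear_uminus)
  then have "(LINT v|lborel. equilibrium m \<beta> v *\<^sub>R G v) = (LINT v|distr lborel borel uminus. equilibrium m \<beta> v *\<^sub>R G v)"
    by (simp add: lborel_distr_orthogonal_transformation)
  also have "\<dots> = (LINT v|lborel. equilibrium m \<beta> (- v) *\<^sub>R G (- v))"
    by (rule integral_distr) measurable
  also have "\<dots> = - (LINT v|lborel. equilibrium m \<beta> v *\<^sub>R G v)"
    by (simp add: odd equilibrium_def)
  finally show ?thesis by simp
qed

text \<open>
  The substitution behind the coefficients.  An orthogonal map takes \<open>e\<close> to the direction of \<open>k\<close>, and
  the scaling \<open>w = \<epsilon> |k| v\<close> turns the heavy-tailed equilibrium into the weight; the Jacobian leaves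
  the factor \<open>(\<epsilon> |k|)\<^sup>\<alpha>\<close> because \<open>\<beta>\<close> exceeds the dimension by \<open>\<alpha>\<close>.  Times this factor, integrals against the
  weight are averages over the equilibrium.
\<close>

lemma weight_integral_eq_equilibrium_integral:
  fixes e k :: "real ^ 'd::finite" and G :: "real \<Rightarrow> 'b::{banach, second_countable_topology}"
  assumes [measurable]: "G \<in> borel_measurable borel"
    and e: "norm e = 1" and k: "k \<noteq> 0" and \<epsilon>: "\<epsilon> > 0" and \<beta>: "\<beta> = \<alpha> + real CARD('d)"
  shows "(\<epsilon> powr \<alpha> * norm k powr \<alpha>) *\<^sub>R (LINT w|lborel. weight m \<beta> \<epsilon> k w *\<^sub>R G (w \<bullet> e))
       = (LINT v|lborel. equilibrium m \<beta> v *\<^sub>R G (\<epsilon> * (k \<bullet> v)))"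
proof -
  define l where "l = \<epsilon> * norm k"
  have l: "l > 0" using k \<epsilon> by (simp add: l_def)
  obtain Q :: "real ^ 'd \<Rightarrow> real ^ 'd" where Q: "orthogonal_transformation Q"
      and Qe: "Q (norm k *\<^sub>R e) = k"
    using orthogonal_transformation_exists[of "norm k *\<^sub>R e" k] e by auto
  interpret L: linear Q
    using Q by (rule orthogonal_transformation_linear)
  have [measurable]: "Q \<in> borel_measurable borel"
    by (intro borel_measurable_continuous_onI linear_continuous_on L.linear_axioms
        linear_conv_bounded_linear[THEN iffD1])
  have inner: "\<epsilon> * (k \<bullet> Q w) = l * (w \<bullet> e)" for w
  proof -
    have "k \<bullet> Q w = Q (norm k *\<^sub>R e) \<bullet> Q w" by (simp add: Qe)
    also have "\<dots> = norm k *\<^sub>R e \<bullet> w"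
      using Q by (simp add: orthogonal_transformation_def del: inner_scaleR_left)
    finally show ?thesis by (simp add: l_def inner_commute)
  qed
  \<comment> \<open>the relation between \<open>\<beta>\<close>, \<open>\<alpha>\<close> and the dimension turns the Jacobian into the stated factor\<close>
  have pw: "l powr \<beta> = l ^ CARD('d) * (\<epsilon> powr \<alpha> * norm k powr \<alpha>)"
    using l \<epsilon> k by (simp add: \<beta> powr_add powr_realpow l_def powr_mult power_mult_distrib)
  have "(LINT v|lborel. equilibrium m \<beta> v *\<^sub>R G (\<epsilon> * (k \<bullet> v)))
      = (LINT v|distr lborel borel Q. equilibrium m \<beta> v *\<^sub>R G (\<epsilon> * (k \<bullet> v)))"
    by (simp add: lborel_distr_orthogonal_transformation[OF Q])
  also have "\<dots> = (LINT w|lborel. equilibrium m \<beta> (Q w) *\<^sub>R G (\<epsilon> * (k \<bullet> Q w)))"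
    by (rule integral_distr) simp_all
  also have "\<dots> = (LINT w|lborel. equilibrium m \<beta> w *\<^sub>R G (l * (w \<bullet> e)))"
    by (simp add: inner equilibrium_def orthogonal_transformation_norm[OF Q])
  finally have 1: "(LINT v|lborel. equilibrium m \<beta> v *\<^sub>R G (\<epsilon> * (k \<bullet> v)))
     = (LINT w|lborel. equilibrium m \<beta> w *\<^sub>R G (l * (w \<bullet> e)))" .
  have sc: "(\<epsilon> powr \<alpha> * norm k powr \<alpha>) * (l ^ CARD('d) * weight m \<beta> \<epsilon> k (l *\<^sub>R w)) = equilibrium m \<beta> w" for w
  proof -
    have "weight m \<beta> \<epsilon> k (l *\<^sub>R w) = m / (l powr \<beta> * (1 + norm w powr \<beta>))"
      using l by (simp add: weight_def l_def[symmetric] powr_mult distrib_left)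
    then show ?thesis
      using l k \<epsilon> by (simp add: pw equilibrium_def)
  qed
  have "(LINT w|lborel. weight m \<beta> \<epsilon> k w *\<^sub>R G (w \<bullet> e))
     = l ^ CARD('d) *\<^sub>R (LINT w|lborel. weight m \<beta> \<epsilon> k (l *\<^sub>R w) *\<^sub>R G (l * (w \<bullet> e)))"
    by (subst integral_lborel_scale[OF _ l]) simp_all
  also have "(\<epsilon> powr \<alpha> * norm k powr \<alpha>) *\<^sub>R \<dots>
     = (LINT w|lborel. equilibrium m \<beta> w *\<^sub>R G (l * (w \<bullet> e)))"
    by (simp add: sc[symmetric] mult.assoc flip: integral_scaleR_right scaleR_scaleR)
  finally show ?thesis using 1 by simp
qed


section \<open>Exponential kernels integrated against linear interpolants\<close>

text \<open>
  For \<open>z \<noteq> 0\<close>, the integral of \<open>exp (- (j \<tau> + s) z) (1 - s / \<tau>)\<close> over \<open>s \<in> {0..\<tau>}\<close>: the weight that the Duhamel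
  integral over the \<open>j\<close>-th most recent step gives to the later end point of the step when the
  density is interpolated linearly.
\<close>

definition kernel_c :: "real \<Rightarrow> nat \<Rightarrow> complex \<Rightarrow> complex" where
  "kernel_c \<tau> j z = exp (- of_real (real j * \<tau>) * z)
     * (1 / z - (1 - exp (- of_real \<tau> * z)) / (of_real \<tau> * z\<^sup>2))"

text \<open>
  The weight of the earlier end point, the integral of \<open>exp (- (j \<tau> + s) z) s / \<tau>\<close>.
\<close>

definition kernel_b :: "real \<Rightarrow> nat \<Rightarrow> complex \<Rightarrow> complex" where
  "kernel_b \<tau> j z = exp (- of_real (real j * \<tau>) * z)
     * ((1 - exp (- of_real \<tau> * z)) / (of_real \<tau> * z\<^sup>2) - exp (- of_real \<tau> * z) / z)"

text \<open>
  The kernels at \<open>z = 1\<close>, that is, without transport.  They are nonnegative, and they bound the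
  kernels at every rate of real part \<open>1\<close>.
\<close>

definition decay_c :: "real \<Rightarrow> nat \<Rightarrow> real" where
  "decay_c \<tau> j = exp (- (real j * \<tau>)) * (1 - (1 - exp (- \<tau>)) / \<tau>)"

definition decay_b :: "real \<Rightarrow> nat \<Rightarrow> real" where
  "decay_b \<tau> j = exp (- (real j * \<tau>)) * ((1 - exp (- \<tau>)) / \<tau> - exp (- \<tau>))"

definition interpolant :: "real \<Rightarrow> real \<Rightarrow> complex \<Rightarrow> complex \<Rightarrow> real \<Rightarrow> complex" where
  "interpolant s \<Delta> a b y = of_real ((s + \<Delta> - y) / \<Delta>) * a + of_real ((y - s) / \<Delta>) * b"

lemma kernel_one:
  "kernel_c \<tau> j 1 = of_real (decay_c \<tau> j)" "kernel_b \<tau> j 1 = of_real (decay_b \<tau> j)"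
  by (simp_all add: kernel_c_def kernel_b_def decay_c_def decay_b_def exp_of_real[symmetric])

lemma kernel_shift:
  "kernel_c \<tau> (Suc j) z = exp (- of_real \<tau> * z) * kernel_c \<tau> j z"
  "kernel_b \<tau> (Suc j) z = exp (- of_real \<tau> * z) * kernel_b \<tau> j z"
proof -
  have "exp (- of_real (real (Suc j) * \<tau>) * z) = exp (- of_real \<tau> * z) * exp (- of_real (real j * \<tau>) * z)"
    by (simp add: exp_add[symmetric] algebra_simps)
  then show "kernel_c \<tau> (Suc j) z = exp (- of_real \<tau> * z) * kernel_c \<tau> j z"
    "kernel_b \<tau> (Suc j) z = exp (- of_real \<tau> * z) * kernel_b \<tau> j z"
    by (simp_all add: kernel_c_def kernel_b_def)
qed

lemma decay_shift:
  "decay_c \<tau> (Suc j) = exp (- \<tau>) * decay_c \<tau> j" "decay_b \<tau> (Suc j) = exp (- \<tau>) * decay_b \<tau> j"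
  using arg_cong[OF kernel_shift(1)[of \<tau> j 1], of Re] arg_cong[OF kernel_shift(2)[of \<tau> j 1], of Re]
  by (simp_all add: kernel_one exp_of_real flip: of_real_minus of_real_mult)

text \<open>
  The exact integral of an exponential against an affine function; its antiderivative is
  \<open>\<eta> exp (- (s + \<Delta> - y) z / \<eta>) (P / z - \<eta> P' / z\<^sup>2)\<close> for affine \<open>P\<close> of slope \<open>P'\<close>.
\<close>

lemma kernel_has_integral:
  fixes a b z :: complex
  assumes \<Delta>: "\<Delta> > 0" and \<eta>: "\<eta> > 0" and z: "z \<noteq> 0" and \<tau>: "\<tau> = \<Delta> / \<eta>"
  shows "((\<lambda>y. exp (- of_real ((s + \<Delta> - y) / \<eta>) * z) * interpolant s \<Delta> a b y) has_integral
           of_real \<eta> * (kernel_b \<tau> 0 z * a + kernel_c \<tau> 0 z * b)) {s..s + \<Delta>}"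
proof -
  define V where "V = (\<lambda>y. of_real \<eta> * exp (- of_real ((s + \<Delta> - y) / \<eta>) * z)
     * (interpolant s \<Delta> a b y / z - of_real \<eta> * (b - a) / (of_real \<Delta> * z\<^sup>2)))"
  define W where "W = (\<lambda>y::complex. of_real \<eta> * exp (- ((of_real (s + \<Delta>) - y) / of_real \<eta>) * z)
     * (((of_real (s + \<Delta>) - y) / of_real \<Delta> * a + (y - of_real s) / of_real \<Delta> * b) / z
         - of_real \<eta> * (b - a) / (of_real \<Delta> * z\<^sup>2)))"
  have V: "V y = W (of_real y)" for y
    by (simp add: V_def W_def interpolant_def)
  have dW: "(W has_field_derivative exp (- ((of_real (s + \<Delta>) - y) / of_real \<eta>) * z) *
      ((of_real (s + \<Delta>) - y) / of_real \<Delta> * a + (y - of_real s) / of_real \<Delta> * b)) (at y)" for y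
  proof -
    let ?E = "\<lambda>y. exp (- ((of_real (s + \<Delta>) - y) / of_real \<eta>) * z)"
    let ?P = "\<lambda>y. (of_real (s + \<Delta>) - y) / of_real \<Delta> * a + (y - of_real s) / of_real \<Delta> * b"
    have dE: "(?E has_field_derivative z / of_real \<eta> * ?E y) (at y)"
      using \<eta> by (auto intro!: derivative_eq_intros)
    have dP: "((\<lambda>y. ?P y / z - of_real \<eta> * (b - a) / (of_real \<Delta> * z\<^sup>2)) has_field_derivative
        (b - a) / of_real \<Delta> / z) (at y)"
    proof -
      have "(\<lambda>y. ?P y / z - of_real \<eta> * (b - a) / (of_real \<Delta> * z\<^sup>2))
        = (\<lambda>y. y * ((b - a) / of_real \<Delta> / z) + ((of_real (s + \<Delta>) * a - of_real s * b) / of_real \<Delta> / z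
            - of_real \<eta> * (b - a) / (of_real \<Delta> * z\<^sup>2)))"
        by (simp add: fun_eq_iff diff_divide_distrib add_divide_distrib algebra_simps)
      then show ?thesis
        by (simp only:) (rule derivative_eq_intros refl | simp)+
    qed
    have alg: "h * (w / h * E * (P / w - h * d / (D * w\<^sup>2)) + d / D / w * E) = E * P"
      if "h \<noteq> 0" "w \<noteq> 0" "D \<noteq> 0" for h w D d E P :: complex
      using that by (simp add: field_simps power2_eq_square)
    show ?thesis
      unfolding W_def mult.assoc
      by (rule DERIV_cong[OF DERIV_cmult[OF DERIV_mult[OF dE dP]]], rule alg)
         (use \<Delta> \<eta> z in auto)
  qed
  have "((\<lambda>y. exp (- of_real ((s + \<Delta> - y) / \<eta>) * z) * interpolant s \<Delta> a b y) has_integral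
      V (s + \<Delta>) - V s) {s..s + \<Delta>}"
  proof (rule fundamental_theorem_of_calculus)
    fix y
    show "(V has_vector_derivative exp (- of_real ((s + \<Delta> - y) / \<eta>) * z) * interpolant s \<Delta> a b y)
        (at y within {s..s + \<Delta>})"
      using has_vector_derivative_real_field[OF dW[of "of_real y"]]
      unfolding V by (simp add: interpolant_def)
  qed (use \<Delta> in simp)
  moreover have "V (s + \<Delta>) - V s = of_real \<eta> * (kernel_b \<tau> 0 z * a + kernel_c \<tau> 0 z * b)"
    using \<Delta> \<eta> z by (simp add: V_def kernel_b_def kernel_c_def \<tau> interpolant_def field_simps power2_eq_square)
  ultimately show ?thesis by simp
qed

lemma decay_has_integral:
  fixes a b :: real
  assumes \<Delta>: "\<Delta> > 0" and \<eta>: "\<eta> > 0" and \<tau>: "\<tau> = \<Delta> / \<eta>"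
  shows "((\<lambda>y. exp (- ((s + \<Delta> - y) / \<eta>)) * ((s + \<Delta> - y) / \<Delta> * a + (y - s) / \<Delta> * b)) has_integral
           \<eta> * (decay_b \<tau> 0 * a + decay_c \<tau> 0 * b)) {s..s + \<Delta>}"
proof -
  have "((\<lambda>y. Re (exp (- of_real ((s + \<Delta> - y) / \<eta>) * 1) * interpolant s \<Delta> (of_real a) (of_real b) y)) has_integral
           Re (of_real \<eta> * (kernel_b \<tau> 0 1 * of_real a + kernel_c \<tau> 0 1 * of_real b))) {s..s + \<Delta>}"
    using has_integral_linear[OF kernel_has_integral[OF assms(1,2) one_neq_zero \<tau>] bounded_linear_Re]
    unfolding o_def by blast
  moreover have "Re (exp (- of_real ((s + \<Delta> - y) / \<eta>) * 1) * interpolant s \<Delta> (of_real a) (of_real b) y)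
     = exp (- ((s + \<Delta> - y) / \<eta>)) * ((s + \<Delta> - y) / \<Delta> * a + (y - s) / \<Delta> * b)" for y
  proof -
    have "exp (- of_real ((s + \<Delta> - y) / \<eta>) * 1) * interpolant s \<Delta> (of_real a) (of_real b) y
      = complex_of_real (exp (- ((s + \<Delta> - y) / \<eta>)) * ((s + \<Delta> - y) / \<Delta> * a + (y - s) / \<Delta> * b))"
      unfolding interpolant_def mult_1_right of_real_minus[symmetric] exp_of_real
      by (simp only: of_real_mult of_real_add)
    then show ?thesis by (metis Re_complex_of_real)
  qed
  ultimately show ?thesis by (simp add: kernel_one)
qed

lemma norm_exp_unit_rate: "Re z = 1 \<Longrightarrow> norm (exp (- of_real x * z)) = exp (- x)"
  by (simp add: norm_exp_eq_Re)

text \<open>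
  Both kernels integrate nonnegative hat functions against an exponential of modulus \<open>exp (- s)\<close>.
\<close>

lemma norm_kernel_le:
  assumes z: "Re z = 1" and \<tau>: "\<tau> > 0"
  shows "norm (kernel_c \<tau> j z) \<le> decay_c \<tau> j" "norm (kernel_b \<tau> j z) \<le> decay_b \<tau> j"
proof -
  have z0: "z \<noteq> 0" using z by auto
  have main: "norm (kernel_b \<tau> 0 z * of_real a + kernel_c \<tau> 0 z * of_real b) \<le> decay_b \<tau> 0 * a + decay_c \<tau> 0 * b"
    if "a \<ge> 0" "b \<ge> 0" for a b
  proof -
    note I = kernel_has_integral[of \<tau> 1 z \<tau> 0 "of_real a" "of_real b", simplified, OF \<tau> z0]
    note J = decay_has_integral[of \<tau> 1 \<tau> 0 a b, simplified, OF \<tau>]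
    have "norm (integral {0..\<tau>} (\<lambda>y. exp ((of_real y - of_real \<tau>) * z) * interpolant 0 \<tau> (of_real a) (of_real b) y))
        \<le> integral {0..\<tau>} (\<lambda>y. exp (y - \<tau>) * ((\<tau> - y) * a / \<tau> + y * b / \<tau>))"
    proof (rule integral_norm_bound_integral)
      fix y assume y: "y \<in> {0..\<tau>}"
      have "interpolant 0 \<tau> (of_real a) (of_real b) y = complex_of_real ((\<tau> - y) * a / \<tau> + y * b / \<tau>)"
        by (simp add: interpolant_def)
      moreover have "(\<tau> - y) * a / \<tau> + y * b / \<tau> \<ge> 0"
        using y that \<tau> by simp
      moreover have "norm (exp ((of_real y - of_real \<tau>) * z)) = exp (y - \<tau>)"
        using norm_exp_unit_rate[OF z, of "\<tau> - y"] by simp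
      ultimately show "norm (exp ((of_real y - of_real \<tau>) * z) * interpolant 0 \<tau> (of_real a) (of_real b) y)
          \<le> exp (y - \<tau>) * ((\<tau> - y) * a / \<tau> + y * b / \<tau>)"
        by (simp only: norm_mult norm_of_real abs_of_nonneg order_refl)
    qed (use I J in \<open>auto simp: has_integral_integrable\<close>)
    then show ?thesis
      using integral_unique[OF I] integral_unique[OF J] by simp
  qed
  have j: "kernel_c \<tau> j z = exp (- of_real (real j * \<tau>) * z) * kernel_c \<tau> 0 z"
    "kernel_b \<tau> j z = exp (- of_real (real j * \<tau>) * z) * kernel_b \<tau> 0 z"
    "decay_c \<tau> j = exp (- (real j * \<tau>)) * decay_c \<tau> 0"
    "decay_b \<tau> j = exp (- (real j * \<tau>)) * decay_b \<tau> 0"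
    by (simp_all add: kernel_c_def kernel_b_def decay_c_def decay_b_def)
  show "norm (kernel_c \<tau> j z) \<le> decay_c \<tau> j" "norm (kernel_b \<tau> j z) \<le> decay_b \<tau> j"
    using main[of 0 1] main[of 1 0] unfolding j norm_mult norm_exp_unit_rate[OF z] by simp_all
qed

lemma one_minus_exp_bounds:
  fixes \<tau> :: real
  assumes "\<tau> > 0"
  shows "1 - exp (- \<tau>) > 0" "1 - exp (- \<tau>) \<le> \<tau>" "\<tau> / (1 - exp (- \<tau>)) \<le> 1 + \<tau>"
    "\<tau> * exp (- \<tau>) \<le> 1 - exp (- \<tau>)"
proof -
  show 1: "1 - exp (- \<tau>) > 0" using assms by simp
  show "1 - exp (- \<tau>) \<le> \<tau>" using exp_ge_add_one_self[of "- \<tau>"] by simp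
  have "(1 + \<tau>) * exp (- \<tau>) \<le> exp \<tau> * exp (- \<tau>)"
    using exp_ge_add_one_self[of \<tau>] by (intro mult_right_mono) auto
  then have "(1 + \<tau>) * exp (- \<tau>) \<le> 1" by (simp add: exp_minus)
  then show "\<tau> / (1 - exp (- \<tau>)) \<le> 1 + \<tau>" "\<tau> * exp (- \<tau>) \<le> 1 - exp (- \<tau>)"
    using 1 by (simp_all add: divide_le_eq algebra_simps)
qed

lemma decay_nonneg:
  assumes "\<tau> > 0"
  shows "decay_c \<tau> j \<ge> 0" "decay_b \<tau> j \<ge> 0"
  using one_minus_exp_bounds[OF assms] assms
  by (simp_all add: decay_c_def decay_b_def divide_le_eq le_divide_eq mult.commute)

lemma one_minus_decay_c: "1 - decay_c \<tau> 0 = (1 - exp (- \<tau>)) / \<tau>"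
  by (simp add: decay_c_def)


section \<open>Errors of schemes with memory\<close>

text \<open>
  Variation of constants on one step.  Replacing the source \<open>r\<close> by its interpolant changes the
  solution by the integral of \<open>exp (- (s + \<Delta> - y) / \<eta>)\<close> times the interpolation error.  The affine error
  bound covers two regimes: a constant bound suits steps shorter than the relaxation time \<open>\<eta>\<close>, a
  bound vanishing at the right end point gains from the concentration of the exponential there when
  the step is much longer than \<open>\<eta>\<close>.
\<close>

lemma interval_defect_bound:
  fixes F r :: "real \<Rightarrow> complex"
  assumes \<Delta>: "\<Delta> > 0" and \<eta>: "\<eta> > 0" and \<tau>: "\<tau> = \<Delta> / \<eta>" and z: "Re z = 1" and M: "M \<ge> 0"
    and q: "q \<ge> 0"
    and F: "\<And>y. y \<in> {s..s + \<Delta>} \<Longrightarrow>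
       (F has_vector_derivative (of_real M * r y - z * F y) / of_real \<eta>) (at y within {s..s + \<Delta>})"
    and r: "\<And>y. y \<in> {s..s + \<Delta>} \<Longrightarrow>
       norm (r y - interpolant s \<Delta> (r s) (r (s + \<Delta>)) y) \<le> p + q * ((s + \<Delta> - y) / \<eta>)"
  shows "norm (F (s + \<Delta>) - exp (- of_real \<tau> * z) * F s
            - of_real M * (kernel_b \<tau> 0 z * r s + kernel_c \<tau> 0 z * r (s + \<Delta>)))
         \<le> M * ((p + q) * (1 - exp (- \<tau>)))"
proof -
  have z0: "z \<noteq> 0" using z by auto
  have \<tau>0: "\<tau> > 0" using \<Delta> \<eta> \<tau> by simp
  let ?E = "\<lambda>y. exp (- of_real ((s + \<Delta> - y) / \<eta>) * z)"
  let ?P = "interpolant s \<Delta> (r s) (r (s + \<Delta>))"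
  have "((\<lambda>y. ?E y * (of_real (M / \<eta>) * r y)) has_integral F (s + \<Delta>) - exp (- of_real \<tau> * z) * F s) {s..s + \<Delta>}"
  proof -
    have "((\<lambda>y. ?E y * (of_real (M / \<eta>) * r y)) has_integral ?E (s + \<Delta>) * F (s + \<Delta>) - ?E s * F s) {s..s + \<Delta>}"
  proof (rule fundamental_theorem_of_calculus)
    fix y assume y: "y \<in> {s..s + \<Delta>}"
    have "((\<lambda>y::complex. exp (- ((of_real (s + \<Delta>) - y) / of_real \<eta>) * z)) has_field_derivative
        (z / of_real \<eta>) * exp (- ((of_real (s + \<Delta>) - of_real y) / of_real \<eta>) * z)) (at (of_real y))"
      using \<eta> by (auto intro!: derivative_eq_intros)
    from has_vector_derivative_real_field[OF this]
    have E: "(?E has_vector_derivative (z / of_real \<eta>) * ?E y) (at y within {s..s + \<Delta>})"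
      by simp
    show "((\<lambda>y. ?E y * F y) has_vector_derivative ?E y * (of_real (M / \<eta>) * r y)) (at y within {s..s + \<Delta>})"
      by (rule has_vector_derivative_eq_rhs[OF has_vector_derivative_mult[OF E F[OF y]]])
         (use \<eta> in \<open>simp add: diff_divide_distrib algebra_simps\<close>)
    qed (use \<Delta> in simp)
    then show ?thesis by (simp add: \<tau>)
  qed
  moreover have "((\<lambda>y. of_real (M / \<eta>) * (?E y * ?P y)) has_integral
      of_real M * (kernel_b \<tau> 0 z * r s + kernel_c \<tau> 0 z * r (s + \<Delta>))) {s..s + \<Delta>}"
    using has_integral_mult_right[OF kernel_has_integral[OF \<Delta> \<eta> z0 \<tau>, of s "r s" "r (s + \<Delta>)"], of "of_real (M / \<eta>)"] \<eta>
    by (simp add: mult.assoc)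
  ultimately have I: "((\<lambda>y. ?E y * (of_real (M / \<eta>) * r y) - of_real (M / \<eta>) * (?E y * ?P y)) has_integral
      (F (s + \<Delta>) - exp (- of_real \<tau> * z) * F s
            - of_real M * (kernel_b \<tau> 0 z * r s + kernel_c \<tau> 0 z * r (s + \<Delta>)))) {s..s + \<Delta>}"
    by (rule has_integral_diff)
  \<comment> \<open>the error bound is itself the interpolant of its end point values, so its integral is known\<close>
  have aff: "(s + \<Delta> - y) / \<Delta> * (p + q * \<tau>) + (y - s) / \<Delta> * p = p + q * ((s + \<Delta> - y) / \<eta>)" for y
    using \<Delta> \<eta> by (simp add: \<tau> field_simps)
  have J: "((\<lambda>y. (M / \<eta>) * (exp (- ((s + \<Delta> - y) / \<eta>)) * (p + q * ((s + \<Delta> - y) / \<eta>)))) has_integral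
      (M / \<eta>) * (\<eta> * (decay_b \<tau> 0 * (p + q * \<tau>) + decay_c \<tau> 0 * p))) {s..s + \<Delta>}"
    using decay_has_integral[OF \<Delta> \<eta> \<tau>, of s "p + q * \<tau>" p] unfolding aff
    by (rule has_integral_mult_right)
  have "norm (F (s + \<Delta>) - exp (- of_real \<tau> * z) * F s
            - of_real M * (kernel_b \<tau> 0 z * r s + kernel_c \<tau> 0 z * r (s + \<Delta>)))
     \<le> (M / \<eta>) * (\<eta> * (decay_b \<tau> 0 * (p + q * \<tau>) + decay_c \<tau> 0 * p))"
    unfolding integral_unique[OF I, symmetric] integral_unique[OF J, symmetric]
  proof (rule integral_norm_bound_integral)
    fix y assume y: "y \<in> {s..s + \<Delta>}"
    have "?E y * (of_real (M / \<eta>) * r y) - of_real (M / \<eta>) * (?E y * ?P y)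
       = of_real (M / \<eta>) * (?E y * (r y - ?P y))"
      by (simp add: algebra_simps)
    then have "norm (?E y * (of_real (M / \<eta>) * r y) - of_real (M / \<eta>) * (?E y * ?P y))
       = (M / \<eta>) * (exp (- ((s + \<Delta> - y) / \<eta>)) * norm (r y - ?P y))"
      unfolding norm_mult norm_exp_unit_rate[OF z] using M \<eta> 
      by (simp only: norm_mult norm_exp_unit_rate[OF z] norm_of_real abs_of_nonneg divide_nonneg_pos)
    also have "\<dots> \<le> (M / \<eta>) * (exp (- ((s + \<Delta> - y) / \<eta>)) * (p + q * ((s + \<Delta> - y) / \<eta>)))"
      using r[OF y] M \<eta> by (intro mult_left_mono) auto
    finally show "norm (?E y * (of_real (M / \<eta>) * r y) - of_real (M / \<eta>) * (?E y * ?P y))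
      \<le> (M / \<eta>) * (exp (- ((s + \<Delta> - y) / \<eta>)) * (p + q * ((s + \<Delta> - y) / \<eta>)))" .
  qed (use I J in \<open>auto simp: has_integral_integrable\<close>)
  also have "\<dots> = M * (decay_b \<tau> 0 * (p + q * \<tau>) + decay_c \<tau> 0 * p)"
    using \<eta> by simp
  also have "decay_b \<tau> 0 * (p + q * \<tau>) + decay_c \<tau> 0 * p = (p + q) * (1 - exp (- \<tau>)) - q * \<tau> * exp (- \<tau>)"
    using \<tau>0 by (simp add: decay_b_def decay_c_def field_simps)
  also have "M * \<dots> \<le> M * ((p + q) * (1 - exp (- \<tau>)))"
    using M q \<tau>0 by (intro mult_left_mono) auto
  finally show ?thesis .
qed

text \<open>
  The defect of \<open>n\<close> steps is damped by \<open>exp (- \<tau>)\<close> in the next step, where the defect of one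
  interval is added; the resulting geometric sum is \<open>1 - exp (- n \<tau>)\<close>.
\<close>

lemma history_defect_bound:
  fixes F r :: "real \<Rightarrow> complex"
  assumes \<Delta>: "\<Delta> > 0" and \<eta>: "\<eta> > 0" and \<tau>: "\<tau> = \<Delta> / \<eta>" and z: "Re z = 1" and M: "M \<ge> 0"
    and q: "q \<ge> 0"
    and F: "\<And>y. y \<in> {0..T} \<Longrightarrow>
       (F has_vector_derivative (of_real M * r y - z * F y) / of_real \<eta>) (at y within {0..T})"
    and r: "\<And>i y. i < N \<Longrightarrow> y \<in> {real i * \<Delta>..real i * \<Delta> + \<Delta>} \<Longrightarrow>
       norm (r y - interpolant (real i * \<Delta>) \<Delta> (r (real i * \<Delta>)) (r (real i * \<Delta> + \<Delta>)) y)
         \<le> p + q * ((real i * \<Delta> + \<Delta> - y) / \<eta>)"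
    and T: "real N * \<Delta> \<le> T" and n: "n \<le> N"
  shows "norm (F (real n * \<Delta>) - exp (- of_real (real n * \<tau>) * z) * F 0
            - of_real M * (\<Sum>j<n. kernel_c \<tau> j z * r (real (n - j) * \<Delta>)
                                 + kernel_b \<tau> j z * r (real (n - Suc j) * \<Delta>)))
         \<le> M * ((p + q) * (1 - exp (- (real n * \<tau>))))"
  using n
proof (induction n)
  case 0
  then show ?case by simp
next
  case (Suc n)
  let ?s = "real n * \<Delta>"
  have Suc_t: "real (Suc n) * \<Delta> = ?s + \<Delta>" by (simp add: algebra_simps)
  have sub: "{?s..?s + \<Delta>} \<subseteq> {0..T}"
  proof -
    have "real (Suc n) * \<Delta> \<le> real N * \<Delta>" using Suc.prems \<Delta> by (intro mult_right_mono) auto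
    then show ?thesis using T \<Delta> unfolding Suc_t by auto
  qed
  let ?S = "\<lambda>n. \<Sum>j<n. kernel_c \<tau> j z * r (real (n - j) * \<Delta>) + kernel_b \<tau> j z * r (real (n - Suc j) * \<Delta>)"
  let ?D = "\<lambda>n. F (real n * \<Delta>) - exp (- of_real (real n * \<tau>) * z) * F 0 - of_real M * ?S n"
  let ?I = "F (?s + \<Delta>) - exp (- of_real \<tau> * z) * F ?s
            - of_real M * (kernel_b \<tau> 0 z * r ?s + kernel_c \<tau> 0 z * r (?s + \<Delta>))"
  have I: "norm ?I \<le> M * ((p + q) * (1 - exp (- \<tau>)))"
  proof (rule interval_defect_bound[OF \<Delta> \<eta> \<tau> z M q])
    show "(F has_vector_derivative (of_real M * r y - z * F y) / of_real \<eta>) (at y within {?s..?s + \<Delta>})"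
      if "y \<in> {?s..?s + \<Delta>}" for y
      using F[of y] that sub by (meson has_vector_derivative_within_subset subset_iff)
  qed (use r Suc.prems in auto)
  have S: "?S (Suc n) = kernel_c \<tau> 0 z * r (?s + \<Delta>) + kernel_b \<tau> 0 z * r ?s + exp (- of_real \<tau> * z) * ?S n"
    unfolding sum.lessThan_Suc_shift kernel_shift Suc_t
    by (simp add: sum_distrib_left distrib_left mult.assoc algebra_simps)
  have E: "exp (- of_real (real (Suc n) * \<tau>) * z) = exp (- of_real \<tau> * z) * exp (- of_real (real n * \<tau>) * z)"
    by (simp add: exp_add[symmetric] algebra_simps)
  have D: "?D (Suc n) = exp (- of_real \<tau> * z) * ?D n + ?I"
    unfolding S E Suc_t by (simp add: algebra_simps)
  have "norm (?D (Suc n)) \<le> exp (- \<tau>) * norm (?D n) + norm ?I"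
    unfolding D using norm_triangle_ineq[of "exp (- of_real \<tau> * z) * ?D n" ?I]
    unfolding norm_mult norm_exp_unit_rate[OF z] by simp
  also have "\<dots> \<le> exp (- \<tau>) * (M * ((p + q) * (1 - exp (- (real n * \<tau>))))) + M * ((p + q) * (1 - exp (- \<tau>)))"
    using Suc I by (intro add_mono mult_left_mono) auto
  also have "\<dots> = M * ((p + q) * (1 - exp (- (real (Suc n) * \<tau>))))"
    by (simp add: algebra_simps flip: exp_add)
  finally show ?case .
qed

text \<open>
  Linear sequences are integrated exactly, and the memory operator with the weights \<open>decay_c\<close>,
  \<open>decay_b\<close> falls short of reproducing \<open>n\<close> by exactly the shape of the defect bound.  This makes linear
  sequences the right barrier for the global error.
\<close>

lemma decay_sum_linear:
  assumes \<tau>: "\<tau> > 0"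
  shows "(\<Sum>j<n. decay_c \<tau> j * real (n - j) + decay_b \<tau> j * real (n - Suc j))
      = real n - (1 - exp (- (real n * \<tau>))) / \<tau>"
proof (induction n)
  case (Suc n)
  have "(\<Sum>j<Suc n. decay_c \<tau> j * real (Suc n - j) + decay_b \<tau> j * real (Suc n - Suc j))
     = decay_c \<tau> 0 * real (Suc n) + decay_b \<tau> 0 * real n
       + exp (- \<tau>) * (\<Sum>j<n. decay_c \<tau> j * real (n - j) + decay_b \<tau> j * real (n - Suc j))"
    unfolding sum.lessThan_Suc_shift decay_shift
    by (simp add: sum_distrib_left distrib_left mult.assoc)
  also have "\<dots> = real (Suc n) - (1 - exp (- (real (Suc n) * \<tau>))) / \<tau>"
    unfolding Suc.IH using \<tau>
    by (simp add: decay_c_def decay_b_def field_simps flip: exp_add)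
  finally show ?case .
qed simp

lemma decay_sum_total:
  "(\<Sum>j<n. decay_c \<tau> j + decay_b \<tau> j) = 1 - exp (- (real n * \<tau>))"
  by (induction n) (simp_all add: decay_c_def decay_b_def algebra_simps flip: exp_add)

text \<open>
  Solving the implicit relation: dividing by \<open>1 - c 0\<close> amounts to including the unknown new value \<open>u\<close>
  in the sum over the past.
\<close>

lemma history_step_defect:
  assumes "c 0 \<noteq> 1"
  shows "(1 - c 0) * (u - history_step A b c R n) =
     u - A (Suc n) - (\<Sum>j<Suc n. c j * (R(Suc n := u)) (Suc n - j) + b j * R (Suc n - Suc j))"
proof -
  have "(\<Sum>j<Suc n. c j * (R(Suc n := u)) (Suc n - j) + b j * R (Suc n - Suc j))
    = c 0 * u + b 0 * R n + (\<Sum>j=1..n. c j * R (n + 1 - j) + b j * R (n - j))"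
  proof -
    have "{..<Suc n} = insert 0 {1..n}" by auto
    moreover have "(\<Sum>j=1..n. c j * (R(Suc n := u)) (Suc n - j) + b j * R (Suc n - Suc j))
        = (\<Sum>j=1..n. c j * R (n + 1 - j) + b j * R (n - j))"
      by (rule sum.cong) auto
    ultimately show ?thesis by simp
  qed
  then show ?thesis
    using assms by (simp add: history_step_def field_simps)
qed

text \<open>
  The local error divides the defect by \<open>\<bar>1 - c 0\<bar>\<close>, which is at least \<open>(1 - exp (- \<tau>)) / \<tau>\<close>.  Estimating
  the global error by a Gronwall argument would cost a factor exponential in \<open>n \<tau>\<close>; comparison with
  the linear supersolution \<open>g n \<tau>\<close> costs none, and this is what makes the constants uniform in
  \<open>\<epsilon>\<close>.
\<close>

lemma history_errors:
  fixes A b c R :: "nat \<Rightarrow> complex"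
  assumes \<tau>: "\<tau> > 0"
    and c: "\<And>j. norm (c j) \<le> decay_c \<tau> j" and b: "\<And>j. norm (b j) \<le> decay_b \<tau> j"
    and defect: "\<And>n. 0 < n \<Longrightarrow> n \<le> N \<Longrightarrow>
       norm (R n - A n - (\<Sum>j<n. c j * R (n - j) + b j * R (n - Suc j))) \<le> g * (1 - exp (- (real n * \<tau>)))"
    and g: "g \<ge> 0"
  shows "n < N \<Longrightarrow> norm (R (Suc n) - history_step A b c R n) \<le> g * (1 + \<tau>)"
    and "n \<le> N \<Longrightarrow> norm (history_scheme A b c (R 0) n - R n) \<le> g * (real n * \<tau>)"
proof -
  have c0: "1 - decay_c \<tau> 0 > 0"
    using one_minus_exp_bounds(1)[OF \<tau>] \<tau> by (simp add: one_minus_decay_c)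
  have c1: "c 0 \<noteq> 1" using c[of 0] c0 by auto
  have nc: "1 - decay_c \<tau> 0 \<le> norm (1 - c 0)"
    using c[of 0] norm_triangle_ineq2[of 1 "c 0"] by simp
  {
    assume n: "n < N"
    have "(1 - decay_c \<tau> 0) * norm (R (Suc n) - history_step A b c R n) \<le> norm ((1 - c 0) * (R (Suc n) - history_step A b c R n))"
      unfolding norm_mult using nc by (intro mult_right_mono) auto
    also have "\<dots> \<le> g * (1 - exp (- (real (Suc n) * \<tau>)))"
      unfolding history_step_defect[of c, OF c1] fun_upd_triv using n by (intro defect) auto
    also have "\<dots> \<le> g"
      using g by (simp add: mult_left_le)
    finally have "norm (R (Suc n) - history_step A b c R n) \<le> g * (\<tau> / (1 - exp (- \<tau>)))"
      using c0 \<tau> by (simp add: one_minus_decay_c field_simps)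
    also have "\<dots> \<le> g * (1 + \<tau>)"
      using g one_minus_exp_bounds(3)[OF \<tau>] by (intro mult_left_mono) auto
    finally show "norm (R (Suc n) - history_step A b c R n) \<le> g * (1 + \<tau>)" .
  }
  let ?S = "history_scheme A b c (R 0)"
  show "n \<le> N \<Longrightarrow> norm (?S n - R n) \<le> g * (real n * \<tau>)"
  proof (induction n rule: less_induct)
    case (less n)
    show ?case
    proof (cases n)
      case 0
      then show ?thesis by simp
    next
      case (Suc m)
      let ?e = "\<lambda>n. ?S n - R n"
      have "(1 - c 0) * (?S n - history_step A b c ?S m) = 0"
        by (simp add: Suc)
      then have S: "?S n - A n - (\<Sum>j<n. c j * ?S (n - j) + b j * ?S (n - Suc j)) = 0"
        unfolding history_step_defect[of c, OF c1] by (simp add: Suc fun_upd_idem)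
      have "?e n - (\<Sum>j<n. c j * ?e (n - j) + b j * ?e (n - Suc j))
          = - (R n - A n - (\<Sum>j<n. c j * R (n - j) + b j * R (n - Suc j)))"
        using S by (simp add: algebra_simps sum.distrib sum_subtractf)
      moreover have "norm \<dots> \<le> g * (1 - exp (- (real n * \<tau>)))"
        unfolding norm_minus_cancel using less.prems Suc by (intro defect) auto
      ultimately have "norm (?e n) \<le> norm (\<Sum>j<n. c j * ?e (n - j) + b j * ?e (n - Suc j)) + g * (1 - exp (- (real n * \<tau>)))"
        by (smt (verit, ccfv_SIG) norm_triangle_sub)
      also have "norm (\<Sum>j<n. c j * ?e (n - j) + b j * ?e (n - Suc j))
         \<le> (\<Sum>j<n. decay_c \<tau> j * norm (?e (n - j)) + decay_b \<tau> j * norm (?e (n - Suc j)))"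
        by (rule order_trans[OF norm_sum sum_mono])
           (intro order_trans[OF norm_triangle_ineq] add_mono, simp_all add: norm_mult c b mult_right_mono)
      \<comment> \<open>the newest term, the one with \<open>j = 0\<close>, contains the error to be bounded and is kept apart\<close>
      also have "\<dots> \<le> decay_c \<tau> 0 * (norm (?e n) - g * (real n * \<tau>)) +
         (\<Sum>j<n. decay_c \<tau> j * (g * (real (n - j) * \<tau>)) + decay_b \<tau> j * (g * (real (n - Suc j) * \<tau>)))"
      proof -
        have "(\<Sum>j<n. decay_c \<tau> j * norm (?e (n - j)) + decay_b \<tau> j * norm (?e (n - Suc j)))
          \<le> (\<Sum>j<n. (if j = 0 then decay_c \<tau> 0 * (norm (?e n) - g * (real n * \<tau>)) else 0)
             + (decay_c \<tau> j * (g * (real (n - j) * \<tau>)) + decay_b \<tau> j * (g * (real (n - Suc j) * \<tau>))))"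
        proof (rule sum_mono)
          fix j assume j: "j \<in> {..<n}"
          have "norm (?e (n - Suc j)) \<le> g * (real (n - Suc j) * \<tau>)"
            using j less.prems by (intro less.IH) auto
          then have 1: "decay_b \<tau> j * norm (?e (n - Suc j)) \<le> decay_b \<tau> j * (g * (real (n - Suc j) * \<tau>))"
            by (intro mult_left_mono decay_nonneg \<tau>)
          have 2: "decay_c \<tau> j * norm (?e (n - j)) \<le> decay_c \<tau> j * (g * (real (n - j) * \<tau>))" if "j \<noteq> 0"
            using that j less.prems by (intro mult_left_mono decay_nonneg \<tau> less.IH) auto
          show "decay_c \<tau> j * norm (?e (n - j)) + decay_b \<tau> j * norm (?e (n - Suc j))
            \<le> (if j = 0 then decay_c \<tau> 0 * (norm (?e n) - g * (real n * \<tau>)) else 0)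
             + (decay_c \<tau> j * (g * (real (n - j) * \<tau>)) + decay_b \<tau> j * (g * (real (n - Suc j) * \<tau>)))"
            using 1 2 by (cases "j = 0") (auto simp: right_diff_distrib)
        qed
        also have "\<dots> = decay_c \<tau> 0 * (norm (?e n) - g * (real n * \<tau>)) +
         (\<Sum>j<n. decay_c \<tau> j * (g * (real (n - j) * \<tau>)) + decay_b \<tau> j * (g * (real (n - Suc j) * \<tau>)))"
          using Suc by (simp add: sum.distrib sum.delta)
        finally show ?thesis .
      qed
      also have "(\<Sum>j<n. decay_c \<tau> j * (g * (real (n - j) * \<tau>)) + decay_b \<tau> j * (g * (real (n - Suc j) * \<tau>)))
         = g * \<tau> * (\<Sum>j<n. decay_c \<tau> j * real (n - j) + decay_b \<tau> j * real (n - Suc j))"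
        by (simp add: sum_distrib_left algebra_simps)
      also have "\<dots> = g * (real n * \<tau>) - g * (1 - exp (- (real n * \<tau>)))"
        unfolding decay_sum_linear[OF \<tau>] using \<tau> by (simp add: field_simps)
      finally have "(1 - decay_c \<tau> 0) * norm (?e n) \<le> (1 - decay_c \<tau> 0) * (g * (real n * \<tau>))"
        by (simp add: algebra_simps)
      then show ?thesis using c0 by simp
    qed
  qed
qed


section \<open>Fourier transform on a periodic cell\<close>

definition periodic_on_cell :: "real ^ 'd \<Rightarrow> real ^ 'd \<Rightarrow> (real ^ 'd::finite \<Rightarrow> 'b) \<Rightarrow> bool" where
  "periodic_on_cell lo hi h \<longleftrightarrow> (\<forall>x i. h (x + axis i (hi $ i - lo $ i)) = h x)"

text \<open>
  The part of the cell that a shift moves across the face \<open>x $ i = hi $ i\<close> is brought back by one period.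
\<close>

lemma integral_cell_shift_axis:
  fixes h :: "real ^ 'd::finite \<Rightarrow> 'b::banach"
  assumes cont: "continuous_on UNIV h" and per: "periodic_on_cell lo hi h"
    and s: "0 \<le> s" "s \<le> hi $ i - lo $ i"
  shows "integral (cbox lo hi) (\<lambda>x. h (x + axis i s)) = integral (cbox lo hi) h"
proof -
  let ?a = "axis i s :: real ^ 'd" and ?L = "axis i (hi $ i - lo $ i) :: real ^ 'd"
  have int: "h integrable_on cbox a b" for a b
    by (intro integrable_continuous continuous_on_subset[OF cont]) auto
  let ?low = "cbox lo hi \<inter> {x. x \<bullet> axis i 1 \<le> lo $ i + s}"
  let ?up = "cbox lo hi \<inter> {x. x \<bullet> axis i 1 \<ge> lo $ i + s}"
  let ?hi = "\<chi> j. if j = i then lo $ i + s else hi $ j"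
  have all: "(\<forall>j. P j) \<longleftrightarrow> P i \<and> (\<forall>j. j \<noteq> i \<longrightarrow> P j)" for P :: "'d \<Rightarrow> bool"
    by metis
  have box: "x \<in> cbox a b \<longleftrightarrow> (a $ i \<le> x $ i \<and> x $ i \<le> b $ i) \<and> (\<forall>j. j \<noteq> i \<longrightarrow> a $ j \<le> x $ j \<and> x $ j \<le> b $ j)"
    for a b x :: "real ^ 'd"
    unfolding mem_box_cart by (rule all)
  have ax: "axis i r $ j = (if j = i then r else 0)" for r :: real and j
    by (simp add: axis_def)
  \<comment> \<open>the slab that re-enters the cell after the shift\<close>
  have low: "?low = cbox lo ?hi"
    unfolding set_eq_iff Int_iff box mem_Collect_eq using s by (auto simp: inner_axis)
  have "integral (cbox lo hi) (\<lambda>x. h (x + ?a)) = integral (cbox (lo + ?a) (hi + ?a)) h"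
    using integral_shift_cbox_plus[of lo hi h ?a] by (simp add: o_def add.commute)
  also have "\<dots> = integral (cbox (lo + ?a) (hi + ?a) \<inter> {x. x \<bullet> axis i 1 \<le> hi $ i}) h
       + integral (cbox (lo + ?a) (hi + ?a) \<inter> {x. x \<bullet> axis i 1 \<ge> hi $ i}) h"
    by (rule integral_split[OF int]) (simp add: axis_in_Basis_iff)
  also have "cbox (lo + ?a) (hi + ?a) \<inter> {x. x \<bullet> axis i 1 \<le> hi $ i} = ?up"
    unfolding set_eq_iff Int_iff box mem_Collect_eq using s by (auto simp: inner_axis ax)
  also have "cbox (lo + ?a) (hi + ?a) \<inter> {x. x \<bullet> axis i 1 \<ge> hi $ i} = cbox (lo + ?L) (?hi + ?L)"
    unfolding set_eq_iff Int_iff box mem_Collect_eq using s by (auto simp: inner_axis ax)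
  also have "integral (cbox (lo + ?L) (?hi + ?L)) h = integral (cbox lo ?hi) h"
  proof -
    have "h (?L + x) = h x" for x
      using per by (simp add: periodic_on_cell_def add.commute)
    then have "h \<circ> (+) ?L = h"
      by (simp add: fun_eq_iff)
    then show ?thesis
      using integral_shift_cbox_plus[of lo ?hi h ?L] by simp
  qed
  also have "integral ?up h + integral (cbox lo ?hi) h = integral (cbox lo hi) h"
    unfolding low[symmetric]
    by (subst integral_split[OF int, of "axis i 1" lo hi "lo $ i + s"])
       (simp_all add: axis_in_Basis_iff add.commute)
  finally show ?thesis .
qed

text \<open>
  The integral of a shifted periodic function does not depend on the shift, so its derivative, which
  is the integral of the partial derivative, vanishes.
\<close>

lemma integral_cell_derivative_axis:
  fixes h :: "real ^ 'd::finite \<Rightarrow> 'b::banach"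
  assumes D: "\<And>x. (h has_derivative D x) (at x)"
    and cont: "continuous_on UNIV (\<lambda>x. D x (axis i 1))"
    and per: "periodic_on_cell lo hi h" and cell: "lo $ i < hi $ i"
  shows "integral (cbox lo hi) (\<lambda>x. D x (axis i 1)) = 0"
proof -
  let ?U = "{0..hi $ i - lo $ i}"
  let ?\<phi> = "\<lambda>s. integral (cbox lo hi) (\<lambda>x. h (x + s *\<^sub>R axis i 1))"
  have hc: "continuous_on UNIV h"
    by (meson D continuous_at_imp_continuous_on has_derivative_continuous)
  have axis: "s *\<^sub>R axis i 1 = (axis i s :: real ^ 'd)" for s :: real
    by (simp add: axis_def vec_eq_iff)
  have "(?\<phi> has_vector_derivative integral (cbox lo hi) (\<lambda>x. D (x + 0 *\<^sub>R axis i 1) (axis i 1))) (at 0 within ?U)"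
  proof (rule leibniz_rule_vector_derivative)
    show "((\<lambda>s. h (x + s *\<^sub>R axis i 1)) has_vector_derivative D (x + s *\<^sub>R axis i 1) (axis i 1)) (at s within ?U)" for s x
    proof -
      have "((\<lambda>s. x + s *\<^sub>R axis i 1) has_vector_derivative axis i 1) (at s within ?U)"
        by (auto intro!: derivative_eq_intros)
      then show ?thesis
        using vector_derivative_diff_chain_within[of "\<lambda>s. x + s *\<^sub>R axis i 1" "axis i 1" s ?U h "D (x + s *\<^sub>R axis i 1)"]
          has_derivative_at_withinI[OF D] by (simp add: o_def)
    qed
    show "(\<lambda>x. h (x + s *\<^sub>R axis i 1)) integrable_on cbox lo hi" for s
      by (intro integrable_continuous continuous_on_compose2[OF hc] continuous_intros) auto
    have "continuous_on (?U \<times> cbox lo hi) (\<lambda>p. D (snd p + fst p *\<^sub>R axis i 1) (axis i 1))"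
      by (intro continuous_on_compose2[OF cont] continuous_intros) auto
    then show "continuous_on (?U \<times> cbox lo hi) (\<lambda>(s, x). D (x + s *\<^sub>R axis i 1) (axis i 1))"
      by (simp add: case_prod_beta)
  qed (use cell in auto)
  moreover have "(?\<phi> has_vector_derivative 0) (at 0 within ?U)"
  proof (rule has_vector_derivative_transform)
    show "((\<lambda>s. integral (cbox lo hi) h) has_vector_derivative 0) (at 0 within ?U)"
      by (rule has_vector_derivative_const)
  qed (use cell integral_cell_shift_axis[OF hc per] in \<open>auto simp: axis\<close>)
  ultimately show ?thesis
    using vector_derivative_unique_within_closed_interval[of 0 "hi $ i - lo $ i" 0 ?\<phi>] cell
    by auto
qed

lemma integral_cell_derivative:
  fixes h :: "real ^ 'd::finite \<Rightarrow> 'b::banach"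
  assumes D: "\<And>x. (h has_derivative D x) (at x)"
    and cont: "\<And>u. continuous_on UNIV (\<lambda>x. D x u)"
    and per: "periodic_on_cell lo hi h" and cell: "\<And>i. lo $ i < hi $ i"
  shows "integral (cbox lo hi) (\<lambda>x. D x v) = 0"
proof -
  have "D x v = (\<Sum>i\<in>UNIV. v $ i *\<^sub>R D x (axis i 1))" for x
  proof -
    interpret linear "D x"
      using D has_derivative_linear by blast
    have "v = (\<Sum>i\<in>UNIV. v $ i *\<^sub>R axis i 1)"
      by (simp add: vec_eq_iff axis_def if_distrib[of "\<lambda>x. _ * x"] cong: if_cong)
    then have "D x v = D x (\<Sum>i\<in>UNIV. v $ i *\<^sub>R axis i 1)" by simp
    then show ?thesis by (simp add: sum scaleR)
  qed
  then have "integral (cbox lo hi) (\<lambda>x. D x v)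
      = (\<Sum>i\<in>UNIV. integral (cbox lo hi) (\<lambda>x. v $ i *\<^sub>R D x (axis i 1)))"
    by (simp add: integral_sum integrable_continuous continuous_on_scaleR continuous_on_const
        continuous_on_subset[OF cont])
  then show ?thesis
    by (simp add: integral_cell_derivative_axis[OF D cont per cell])
qed

lemma fourier_character_periodic:
  assumes "k \<in> frequencies lo hi"
  shows "exp (- \<i> * complex_of_real (k \<bullet> (x + axis i (hi $ i - lo $ i)))) = exp (- \<i> * complex_of_real (k \<bullet> x))"
proof -
  obtain n :: int where "k $ i * (hi $ i - lo $ i) = 2 * pi * of_int n"
    using assms by (auto simp: frequencies_def)
  then have "- \<i> * complex_of_real (k \<bullet> (x + axis i (hi $ i - lo $ i)))
      = - \<i> * complex_of_real (k \<bullet> x) + complex_of_real (real_of_int (2 * (- n)) * pi) * \<i>"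
    by (simp add: inner_add_right inner_axis algebra_simps)
  then show ?thesis
    unfolding exp_eq by blast
qed

lemma fourier_eq_integral:
  assumes "continuous_on UNIV g"
  shows "fourier lo hi g k = integral (cbox lo hi) (\<lambda>x. exp (- \<i> * complex_of_real (k \<bullet> x)) * complex_of_real (g x))"
    (is "_ = integral _ ?F")
proof -
  have "continuous_on (cbox lo hi) ?F"
    by (intro continuous_intros continuous_on_subset[OF assms]) auto
  then have "set_integrable lborel (cbox lo hi) ?F"
    unfolding set_integrable_def by (intro borel_integrable_compact) auto
  then show ?thesis
    unfolding fourier_def by (rule set_borel_integral_eq_integral(2))
qed

text \<open>
  Integration by parts: the boundary terms are absent because the function times the character is
  periodic on the cell.
\<close>

lemma fourier_directional_derivative:
  fixes g :: "real ^ 'd::finite \<Rightarrow> real"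
  assumes g: "\<And>x. GDERIV g x :> g' x" and cont: "continuous_on UNIV g'"
    and per: "periodic_on_cell lo hi g" and cell: "\<And>i. lo $ i < hi $ i" and k: "k \<in> frequencies lo hi"
  shows "fourier lo hi (\<lambda>x. v \<bullet> g' x) k = \<i> * complex_of_real (k \<bullet> v) * fourier lo hi g k"
proof -
  let ?E = "\<lambda>x. exp (- \<i> * complex_of_real (k \<bullet> x))"
  define D where "D = (\<lambda>x u. ?E x * complex_of_real (u \<bullet> g' x) - \<i> * complex_of_real (k \<bullet> u) * (?E x * complex_of_real (g x)))"
  have gc: "continuous_on UNIV g"
    using g unfolding gderiv_def by (meson continuous_at_imp_continuous_on has_derivative_continuous)
  have Ec: "continuous_on S ?E" for S by (intro continuous_intros)
  have "integral (cbox lo hi) (\<lambda>x. D x v) = 0"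
  proof (rule integral_cell_derivative)
    show "((\<lambda>x. ?E x * complex_of_real (g x)) has_derivative D x) (at x)" for x
    proof -
      have "(?E has_derivative (\<lambda>u. ?E x * (- \<i> * complex_of_real (k \<bullet> u)))) (at x)"
      proof -
        have "bounded_linear (\<lambda>x. - \<i> * complex_of_real (k \<bullet> x))"
          by (intro bounded_linear_const_mult bounded_linear_compose[OF bounded_linear_of_real]
              bounded_linear_inner_right)
        from has_derivative_compose[OF bounded_linear_imp_has_derivative[OF this]
            DERIV_exp[unfolded has_field_derivative_def]]
        show ?thesis .
      qed
      moreover have "((\<lambda>x. complex_of_real (g x)) has_derivative (\<lambda>u. complex_of_real (u \<bullet> g' x))) (at x)"
        using has_derivative_of_real[OF g[unfolded gderiv_def]] .
      ultimately show ?thesis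
        by (rule has_derivative_eq_rhs[OF has_derivative_mult]) (simp add: D_def fun_eq_iff algebra_simps)
    qed
    show "continuous_on UNIV (\<lambda>x. D x u)" for u
      unfolding D_def by (intro continuous_intros Ec gc cont)
    show "periodic_on_cell lo hi (\<lambda>x. ?E x * complex_of_real (g x))"
      using per unfolding periodic_on_cell_def fourier_character_periodic[OF k] by simp
  qed (rule cell)
  moreover have "integral (cbox lo hi) (\<lambda>x. D x v) = integral (cbox lo hi) (\<lambda>x. ?E x * complex_of_real (v \<bullet> g' x))
      - integral (cbox lo hi) (\<lambda>x. \<i> * complex_of_real (k \<bullet> v) * (?E x * complex_of_real (g x)))"
    unfolding D_def
    by (intro integral_diff integrable_continuous continuous_intros Ec
        continuous_on_subset[OF gc] continuous_on_subset[OF cont]) auto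
  ultimately show ?thesis
    by (subst (1 2) fourier_eq_integral) (auto intro!: gc cont continuous_intros)
qed

lemma fourier_density:
  fixes g :: "'d::finite phase_fun"
  assumes g: "integrable_on_phase_space lo hi g"
  shows "integrable lborel (f0_hat lo hi g k)"
    and "fourier lo hi (density g) k = (LINT v|lborel. f0_hat lo hi g k v)"
proof -
  let ?E = "\<lambda>x. exp (- \<i> * complex_of_real (k \<bullet> x))"
  let ?F = "\<lambda>x v. indicator (cbox lo hi) x *\<^sub>R (?E x * complex_of_real (g x v))"
  have "integrable (lborel \<Otimes>\<^sub>M lborel) (\<lambda>p. indicator (cbox lo hi \<times> UNIV) p *\<^sub>R (case p of (x, v) \<Rightarrow> g x v))"
    using g by (simp add: integrable_on_phase_space_def set_integrable_def)
  then have "integrable (lborel \<Otimes>\<^sub>M lborel)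
      (\<lambda>p. complex_of_real (indicator (cbox lo hi \<times> UNIV) p *\<^sub>R (case p of (x, v) \<Rightarrow> g x v)))"
    by (rule integrable_of_real)
  note G = this
  have [measurable]: "(\<lambda>p. complex_of_real (indicator (cbox lo hi \<times> UNIV) p *\<^sub>R (case p of (x, v) \<Rightarrow> g x v)))
      \<in> borel_measurable (lborel \<Otimes>\<^sub>M lborel)"
    by (rule borel_measurable_integrable[OF G])
  have "integrable (lborel \<Otimes>\<^sub>M lborel) (\<lambda>p. ?E (fst p) *
      complex_of_real (indicator (cbox lo hi \<times> UNIV) p *\<^sub>R (case p of (x, v) \<Rightarrow> g x v)))"
    by (rule Bochner_Integration.integrable_bound[OF G]) (measurable, simp add: norm_mult norm_exp_eq_Re)
  then have F: "integrable (lborel \<Otimes>\<^sub>M lborel) (case_prod ?F)"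
    by (rule back_subst[where P = "integrable _"]) (auto simp: fun_eq_iff indicator_def)
  show "integrable lborel (f0_hat lo hi g k)"
    using lborel_pair.integrable_snd[OF F]
    by (simp add: f0_hat_def[abs_def] fourier_def set_lebesgue_integral_def)
  have "fourier lo hi (density g) k = (LINT x|lborel. LINT v|lborel. ?F x v)"
    by (simp add: fourier_def set_lebesgue_integral_def density_def)
  also have "\<dots> = (LINT v|lborel. LINT x|lborel. ?F x v)"
    by (rule lborel_pair.Fubini_integral[OF F, symmetric])
  finally show "fourier lo hi (density g) k = (LINT v|lborel. f0_hat lo hi g k v)"
    by (simp add: f0_hat_def fourier_def set_lebesgue_integral_def)
qed


section \<open>The kinetic equation in Fourier variables\<close>

text \<open>
  A classical solution is only assumed regular at fixed velocity, with no domination uniform in the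
  velocity.  The equation itself provides the regularity of the density: at \<open>v = 0\<close> it expresses
  the density times a positive constant through continuous functions.
\<close>

lemma density_continuous:
  fixes f :: "real \<Rightarrow> 'd::finite phase_fun"
  assumes sol: "solves_kinetic lo hi \<alpha> \<beta> m T \<epsilon> f0 f" and m: "m > 0"
  shows "continuous_on ({0..T} \<times> UNIV) (\<lambda>(t, x). density (f t) x)"
proof -
  obtain ft fx where
    c: "continuous_on ({0..T} \<times> UNIV) (\<lambda>(t, x). f t x 0)"
      "continuous_on ({0..T} \<times> UNIV) (\<lambda>(t, x). ft t x (0 :: real ^ 'd) :: real)"
    and eq: "\<And>t x. t \<in> {0..T} \<Longrightarrow>
       \<epsilon> powr \<alpha> * ft t x 0 + \<epsilon> * (0 \<bullet> (fx t x (0 :: real ^ 'd) :: real ^ 'd)) = density (f t) x * equilibrium m \<beta> (0 :: real ^ 'd) - f t x 0"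
    using sol unfolding solves_kinetic_def by metis
  have "continuous_on ({0..T} \<times> UNIV)
      (\<lambda>p. (\<epsilon> powr \<alpha> * (\<lambda>(t, x). ft t x 0) p + (\<lambda>(t, x). f t x 0) p) / equilibrium m \<beta> (0 :: real ^ 'd))"
    using equilibrium_pos[OF m, of \<beta> "0 :: real ^ 'd"] by (intro continuous_intros c) auto
  then show ?thesis
  proof (rule continuous_on_eq)
    fix p :: "real \<times> (real ^ 'd)" assume "p \<in> {0..T} \<times> UNIV"
    then show "(\<epsilon> powr \<alpha> * (\<lambda>(t, x). ft t x 0) p + (\<lambda>(t, x). f t x 0) p) / equilibrium m \<beta> (0 :: real ^ 'd)
        = (\<lambda>(t, x). density (f t) x) p"
      using eq equilibrium_pos[OF m, of \<beta> "0 :: real ^ 'd"] by (auto simp: field_simps)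
  qed
qed

lemma continuous_on_slice:
  assumes "continuous_on ({0..T} \<times> UNIV) (\<lambda>(t, x). g t x)" "t \<in> {0..T}"
  shows "continuous_on UNIV (g t)"
proof -
  have "continuous_on UNIV (\<lambda>x. (\<lambda>(t, x). g t x) (t, x))"
    by (rule continuous_on_compose2[OF assms(1)]) (use assms(2) in \<open>auto intro!: continuous_intros\<close>)
  then show ?thesis by simp
qed

lemma rho_hat_continuous:
  fixes f :: "real \<Rightarrow> 'd::finite phase_fun"
  assumes sol: "solves_kinetic lo hi \<alpha> \<beta> m T \<epsilon> f0 f" and m: "m > 0"
  shows "continuous_on {0..T} (rho_hat lo hi f k)"
proof -
  note dc = density_continuous[OF sol m]
  have "continuous_on ({0..T} \<times> cbox lo hi)
      (\<lambda>p. exp (- \<i> * complex_of_real (k \<bullet> snd p)) * complex_of_real ((\<lambda>(t, x). density (f t) x) p))"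
    by (intro continuous_intros continuous_on_subset[OF dc]) auto
  then have "continuous_on {0..T} (\<lambda>t. integral (cbox lo hi)
      (\<lambda>x. exp (- \<i> * complex_of_real (k \<bullet> x)) * complex_of_real (density (f t) x)))"
    by (intro integral_continuous_on_param) (simp add: case_prod_beta)
  then show ?thesis
    by (rule continuous_on_eq)
       (simp add: rho_hat_def fourier_eq_integral[OF continuous_on_slice[OF dc]])
qed

text \<open>
  For a fixed velocity the kinetic equation becomes a scalar linear differential equation in each
  Fourier mode, with the density as source term.
\<close>

lemma kinetic_fourier_ode:
  fixes f :: "real \<Rightarrow> 'd::finite phase_fun"
  assumes sol: "solves_kinetic lo hi \<alpha> \<beta> m T \<epsilon> f0 f" and m: "m > 0" and \<epsilon>: "\<epsilon> > 0"
    and cell: "\<And>i. lo $ i < hi $ i" and k: "k \<in> frequencies lo hi" and t: "t \<in> {0..T}"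
  shows "((\<lambda>t. f0_hat lo hi (f t) k v) has_vector_derivative
     (of_real (equilibrium m \<beta> v) * rho_hat lo hi f k t
       - (1 + \<i> * of_real (\<epsilon> * (k \<bullet> v))) * f0_hat lo hi (f t) k v) / of_real (\<epsilon> powr \<alpha>)) (at t within {0..T})"
proof -
  obtain ft :: "real \<Rightarrow> real ^ 'd \<Rightarrow> real ^ 'd \<Rightarrow> real" and fx :: "real \<Rightarrow> real ^ 'd \<Rightarrow> real ^ 'd \<Rightarrow> real ^ 'd" where
    c: "continuous_on ({0..T} \<times> UNIV) (\<lambda>(t, x). f t x v)"
      "continuous_on ({0..T} \<times> UNIV) (\<lambda>(t, x). ft t x v)"
      "continuous_on ({0..T} \<times> UNIV) (\<lambda>(t, x). fx t x v)"
    and dt: "\<And>t x. t \<in> {0..T} \<Longrightarrow> ((\<lambda>s. f s x v) has_real_derivative ft t x v) (at t within {0..T})"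
    and dx: "\<And>t x. t \<in> {0..T} \<Longrightarrow> GDERIV (\<lambda>y. f t y v) x :> fx t x v"
    and eq: "\<And>t x. t \<in> {0..T} \<Longrightarrow>
       \<epsilon> powr \<alpha> * ft t x v + \<epsilon> * (v \<bullet> fx t x v) = density (f t) x * equilibrium m \<beta> v - f t x v"
    using sol unfolding solves_kinetic_def by (clarify, metis)
  let ?E = "\<lambda>x. exp (- \<i> * complex_of_real (k \<bullet> x))"
  note dc = density_continuous[OF sol m]
  note sl = continuous_on_slice[OF c(1)] continuous_on_slice[OF c(2)] continuous_on_slice[OF c(3)]
    continuous_on_slice[OF dc]
  have fh: "f0_hat lo hi (f s) k v = integral (cbox lo hi) (\<lambda>x. ?E x * complex_of_real (f s x v))"
    if "s \<in> {0..T}" for s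
    unfolding f0_hat_def by (rule fourier_eq_integral[OF sl(1)[OF that]])
  have "((\<lambda>s. integral (cbox lo hi) (\<lambda>x. ?E x * complex_of_real (f s x v))) has_vector_derivative
      integral (cbox lo hi) (\<lambda>x. ?E x * complex_of_real (ft t x v))) (at t within {0..T})"
  proof (rule leibniz_rule_vector_derivative)
    show "((\<lambda>s. ?E x * complex_of_real (f s x v)) has_vector_derivative ?E x * complex_of_real (ft s x v)) (at s within {0..T})"
      if "s \<in> {0..T}" for s x
      using dt[OF that, of x]
      by (intro has_vector_derivative_mult_right has_vector_derivative_of_real)
         (simp add: has_real_derivative_iff_has_vector_derivative)
    show "(\<lambda>x. ?E x * complex_of_real (f s x v)) integrable_on cbox lo hi" if "s \<in> {0..T}" for s
      by (intro integrable_continuous continuous_intros continuous_on_subset[OF sl(1)[OF that]]) auto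
    have "continuous_on ({0..T} \<times> cbox lo hi)
      (\<lambda>p. ?E (snd p) * complex_of_real ((\<lambda>(t, x). ft t x v) p))"
      by (intro continuous_intros continuous_on_subset[OF c(2)]) auto
    then show "continuous_on ({0..T} \<times> cbox lo hi) (\<lambda>(s, x). ?E x * complex_of_real (ft s x v))"
      by (simp add: case_prod_beta)
  qed (use t in auto)
  then have "((\<lambda>s. f0_hat lo hi (f s) k v) has_vector_derivative fourier lo hi (\<lambda>x. ft t x v) k) (at t within {0..T})"
    unfolding fourier_eq_integral[OF sl(2)[OF t]]
    by (rule has_vector_derivative_transform[OF t, rotated]) (rule fh)
  moreover have "fourier lo hi (\<lambda>x. ft t x v) k = (of_real (equilibrium m \<beta> v) * rho_hat lo hi f k t
       - (1 + \<i> * of_real (\<epsilon> * (k \<bullet> v))) * f0_hat lo hi (f t) k v) / of_real (\<epsilon> powr \<alpha>)"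
  proof -
    have per: "periodic_on_cell lo hi (\<lambda>x. f t x v)"
      using sol t by (auto simp: solves_kinetic_def periodic_in_space_def periodic_on_cell_def)
    have dd: "fourier lo hi (\<lambda>x. v \<bullet> fx t x v) k = \<i> * complex_of_real (k \<bullet> v) * f0_hat lo hi (f t) k v"
      unfolding f0_hat_def by (rule fourier_directional_derivative[OF dx[OF t] sl(3)[OF t] per cell k])
    have ft: "ft t x v = (equilibrium m \<beta> v * density (f t) x - \<epsilon> * (v \<bullet> fx t x v) - f t x v) / \<epsilon> powr \<alpha>" for x
      using eq[OF t, of x] \<epsilon> by (simp add: field_simps)
    have "fourier lo hi (\<lambda>x. ft t x v) k = integral (cbox lo hi) (\<lambda>x.
        (of_real (equilibrium m \<beta> v) * (?E x * of_real (density (f t) x))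
        - of_real \<epsilon> * (?E x * of_real (v \<bullet> fx t x v)) - ?E x * of_real (f t x v)) / of_real (\<epsilon> powr \<alpha>))"
      unfolding fourier_eq_integral[OF sl(2)[OF t]]
      by (rule integral_cong) (simp add: ft algebra_simps diff_divide_distrib)
    also have "\<dots> = (of_real (equilibrium m \<beta> v) * integral (cbox lo hi) (\<lambda>x. ?E x * of_real (density (f t) x))
        - of_real \<epsilon> * integral (cbox lo hi) (\<lambda>x. ?E x * of_real (v \<bullet> fx t x v))
        - integral (cbox lo hi) (\<lambda>x. ?E x * of_real (f t x v))) / of_real (\<epsilon> powr \<alpha>)"
    proof -
      have i: "(\<lambda>x. ?E x * complex_of_real (density (f t) x)) integrable_on cbox lo hi"
        "(\<lambda>x. ?E x * complex_of_real (v \<bullet> fx t x v)) integrable_on cbox lo hi"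
        "(\<lambda>x. ?E x * complex_of_real (f t x v)) integrable_on cbox lo hi"
        by (intro integrable_continuous continuous_intros continuous_on_subset[OF sl(1)[OF t]]
            continuous_on_subset[OF sl(3)[OF t]] continuous_on_subset[OF sl(4)[OF t]]; simp)+
      note h = i[THEN integrable_integral]
      show ?thesis
        by (rule integral_unique, intro has_integral_divide has_integral_diff has_integral_mult_right h)
    qed
    also have "\<dots> = (of_real (equilibrium m \<beta> v) * rho_hat lo hi f k t
        - of_real \<epsilon> * fourier lo hi (\<lambda>x. v \<bullet> fx t x v) k - f0_hat lo hi (f t) k v) / of_real (\<epsilon> powr \<alpha>)"
      unfolding rho_hat_def f0_hat_def
      by (simp add: fourier_eq_integral[OF sl(1)[OF t]] fourier_eq_integral[OF sl(4)[OF t]]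
          fourier_eq_integral[OF continuous_on_inner[OF continuous_on_const sl(3)[OF t]]])
    finally show ?thesis
      unfolding dd by (simp add: algebra_simps)
  qed
  ultimately show ?thesis by simp
qed


section \<open>The coefficients of the scheme\<close>

text \<open>
  On the kinetic time scale a Fourier mode of the kinetic density at velocity \<open>v\<close> decays at this
  complex rate: relaxation contributes the real part \<open>1\<close>, free transport the imaginary part.
\<close>

definition rate :: "real \<Rightarrow> real ^ 'd \<Rightarrow> real ^ 'd::finite \<Rightarrow> complex" where
  "rate \<epsilon> k v = 1 + \<i> * of_real (\<epsilon> * (k \<bullet> v))"

lemma Re_rate: "Re (rate \<epsilon> k v) = 1"
  by (simp add: rate_def)

lemma rate_measurable [measurable]: "rate \<epsilon> k \<in> borel_measurable borel"
  unfolding rate_def[abs_def] by measurable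

lemma kernel_measurable [measurable]:
  "kernel_c \<tau> j \<in> borel_measurable borel" "kernel_b \<tau> j \<in> borel_measurable borel"
  unfolding kernel_c_def[abs_def] kernel_b_def[abs_def] by measurable

text \<open>
  Each coefficient is a plain average of a kernel over the equilibrium.  For \<open>k \<noteq> 0\<close> the weight
  times \<open>(\<epsilon> |k|)\<^sup>\<alpha>\<close> has total mass one, so the first summand of the coefficient vanishes; for \<open>k = 0\<close> only that
  summand remains, and the rate is identically \<open>1\<close>.
\<close>

lemma coeff_eq_kernel_average:
  fixes e k :: "real ^ 'd::finite"
  assumes e: "norm e = 1" and \<beta>: "\<beta> = \<alpha> + real CARD('d)" and \<epsilon>: "\<epsilon> > 0"
    and normalised: "(LINT v|lborel. equilibrium m \<beta> (v :: real ^ 'd)) = 1"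
  shows "coeff_c \<alpha> \<beta> m e \<epsilon> \<Delta> k j = (LINT v|lborel. equilibrium m \<beta> v *\<^sub>R kernel_c (\<Delta> / \<epsilon> powr \<alpha>) j (rate \<epsilon> k v))"
    and "coeff_b \<alpha> \<beta> m e \<epsilon> \<Delta> k j = (LINT v|lborel. equilibrium m \<beta> v *\<^sub>R kernel_b (\<Delta> / \<epsilon> powr \<alpha>) j (rate \<epsilon> k v))"
proof -
  let ?\<tau> = "\<Delta> / \<epsilon> powr \<alpha>"
  define z where "z v = 1 + \<i> * complex_of_real (v \<bullet> e)" for v
  have mass: "(if k = 0 then 1 else 0) = 1 - \<epsilon> powr \<alpha> * norm k powr \<alpha> * (LINT v|lborel. weight m \<beta> \<epsilon> k v)"
    using weight_integral_eq_equilibrium_integral[of "\<lambda>_. 1 :: real" e k \<epsilon> \<beta> \<alpha> m] e \<beta> \<epsilon> normalised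
    by auto
  have kc: "(exp (- complex_of_real (real j * \<Delta> / \<epsilon> powr \<alpha>) * z v) / z v
               - complex_of_real (\<epsilon> powr \<alpha> / \<Delta>) * exp (- complex_of_real (real j * \<Delta> / \<epsilon> powr \<alpha>) * z v)
                 * ((1 - exp (- complex_of_real (\<Delta> / \<epsilon> powr \<alpha>) * z v)) / (z v)\<^sup>2))
              * complex_of_real (weight m \<beta> \<epsilon> k v)
     = weight m \<beta> \<epsilon> k v *\<^sub>R kernel_c ?\<tau> j (1 + \<i> * complex_of_real (v \<bullet> e))" for v
    unfolding kernel_c_def z_def[symmetric] scaleR_conv_of_real by (simp add: algebra_simps)
  have kb: "(- (exp (- complex_of_real (real (j + 1) * \<Delta> / \<epsilon> powr \<alpha>) * z v) / z v)
               + complex_of_real (\<epsilon> powr \<alpha> / \<Delta>) * exp (- complex_of_real (real j * \<Delta> / \<epsilon> powr \<alpha>) * z v)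
                 * ((1 - exp (- complex_of_real (\<Delta> / \<epsilon> powr \<alpha>) * z v)) / (z v)\<^sup>2))
              * complex_of_real (weight m \<beta> \<epsilon> k v)
     = weight m \<beta> \<epsilon> k v *\<^sub>R kernel_b ?\<tau> j (1 + \<i> * complex_of_real (v \<bullet> e))" for v
  proof -
    have shift: "- complex_of_real (real (j + 1) * \<Delta> / \<epsilon> powr \<alpha>) * z v
      = - complex_of_real (real j * \<Delta> / \<epsilon> powr \<alpha>) * z v + - complex_of_real (\<Delta> / \<epsilon> powr \<alpha>) * z v"
    proof -
      have "real (j + 1) * \<Delta> / \<epsilon> powr \<alpha> = real j * \<Delta> / \<epsilon> powr \<alpha> + \<Delta> / \<epsilon> powr \<alpha>"
        by (simp add: add_divide_distrib distrib_right)
      then show ?thesis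
        by (simp only: of_real_add minus_add_distrib distrib_right)
    qed
    have alg: "(- (P * Q / y) + c * P * ((1 - Q) / y\<^sup>2)) * w = w * (P * (c * ((1 - Q) / y\<^sup>2) - Q / y))"
      for P Q y c w :: complex
      by (simp add: algebra_simps)
    have inv: "(1 - Q) / (complex_of_real ?\<tau> * y\<^sup>2) = complex_of_real (\<epsilon> powr \<alpha> / \<Delta>) * ((1 - Q) / y\<^sup>2)" for Q y
      by simp
    show ?thesis
      unfolding kernel_b_def z_def[symmetric] scaleR_conv_of_real shift exp_add inv alg by simp
  qed
  have avg: "complex_of_real (\<epsilon> powr \<alpha> * norm k powr \<alpha>) * (LINT v|lborel. weight m \<beta> \<epsilon> k v *\<^sub>R G (v \<bullet> e))
      = (LINT v|lborel. equilibrium m \<beta> v *\<^sub>R G (\<epsilon> * (k \<bullet> v)))"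
    if "G \<in> borel_measurable borel" "k \<noteq> 0" for G :: "real \<Rightarrow> complex"
    using weight_integral_eq_equilibrium_integral[OF that(1) e that(2) \<epsilon> \<beta>, of m]
    by (simp add: scaleR_conv_of_real)
  show "coeff_c \<alpha> \<beta> m e \<epsilon> \<Delta> k j = (LINT v|lborel. equilibrium m \<beta> v *\<^sub>R kernel_c ?\<tau> j (rate \<epsilon> k v))"
  proof (cases "k = 0")
    case True
    then show ?thesis
      using normalised unfolding coeff_c_def Let_def
      by (simp add: rate_def kernel_one decay_c_def scaleR_conv_of_real mult.commute)
  next
    case False
    then show ?thesis
      unfolding coeff_c_def Let_def mass[symmetric] z_def[symmetric] kc
      using avg[of "\<lambda>x. kernel_c ?\<tau> j (1 + \<i> * of_real x)"] by (simp add: rate_def z_def)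
  qed
  show "coeff_b \<alpha> \<beta> m e \<epsilon> \<Delta> k j = (LINT v|lborel. equilibrium m \<beta> v *\<^sub>R kernel_b ?\<tau> j (rate \<epsilon> k v))"
  proof (cases "k = 0")
    case True
    then show ?thesis
      using normalised unfolding coeff_b_def Let_def
      by (simp add: rate_def kernel_one decay_b_def scaleR_conv_of_real mult.commute)
  next
    case False
    then show ?thesis
      unfolding coeff_b_def Let_def mass[symmetric] z_def[symmetric] kb
      using avg[of "\<lambda>x. kernel_b ?\<tau> j (1 + \<i> * of_real x)"] by (simp add: rate_def z_def)
  qed
qed

lemma norm_coeff_le:
  fixes e k :: "real ^ 'd::finite"
  assumes m: "m > 0" and e: "norm e = 1" and \<beta>: "\<beta> = \<alpha> + real CARD('d)" and \<epsilon>: "\<epsilon> > 0" and \<Delta>: "\<Delta> > 0"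
    and normalised: "(LINT v|lborel. equilibrium m \<beta> (v :: real ^ 'd)) = 1"
  shows "norm (coeff_c \<alpha> \<beta> m e \<epsilon> \<Delta> k j) \<le> decay_c (\<Delta> / \<epsilon> powr \<alpha>) j"
    and "norm (coeff_b \<alpha> \<beta> m e \<epsilon> \<Delta> k j) \<le> decay_b (\<Delta> / \<epsilon> powr \<alpha>) j"
  unfolding coeff_eq_kernel_average[OF e \<beta> \<epsilon> normalised]
  using \<Delta> \<epsilon> by (intro equilibrium_average_bound[OF m normalised] norm_kernel_le Re_rate; simp)+

lemma coeff_c_zero_neq_one:
  fixes e k :: "real ^ 'd::finite"
  assumes m: "m > 0" and e: "norm e = 1" and \<beta>: "\<beta> = \<alpha> + real CARD('d)" and \<epsilon>: "\<epsilon> > 0" and \<Delta>: "\<Delta> > 0"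
    and normalised: "(LINT v|lborel. equilibrium m \<beta> (v :: real ^ 'd)) = 1"
  shows "coeff_c \<alpha> \<beta> m e \<epsilon> \<Delta> k 0 \<noteq> 1"
proof
  let ?\<tau> = "\<Delta> / \<epsilon> powr \<alpha>"
  have \<tau>: "?\<tau> > 0" using \<epsilon> \<Delta> by simp
  assume "coeff_c \<alpha> \<beta> m e \<epsilon> \<Delta> k 0 = 1"
  then have "1 - decay_c ?\<tau> 0 \<le> 0"
    using norm_coeff_le(1)[OF assms, of k 0] by simp
  moreover have "1 - decay_c ?\<tau> 0 > 0"
    unfolding one_minus_decay_c using one_minus_exp_bounds(1)[OF \<tau>] \<tau> by (rule divide_pos_pos)
  ultimately show False by simp
qed


section \<open>Order, consistency and conservation of mass\<close>

text \<open>
  All terms of the defect are averages over the velocity: the density and the initial layer by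
  Fubini, the weights by \<open>coeff_eq_kernel_average\<close>.  For each velocity the integrand is the defect
  of a scalar linear equation.
\<close>

lemma duhamel_defect_bound:
  fixes f :: "real \<Rightarrow> 'd::finite phase_fun" and e k :: "real ^ 'd"
  assumes m: "m > 0" and e: "norm e = 1" and \<beta>: "\<beta> = \<alpha> + real CARD('d)" and \<epsilon>: "\<epsilon> > 0" and \<Delta>: "\<Delta> > 0"
    and normalised: "(LINT v|lborel. equilibrium m \<beta> (v :: real ^ 'd)) = 1"
    and cell: "\<And>i. lo $ i < hi $ i" and k: "k \<in> frequencies lo hi"
    and sol: "solves_kinetic lo hi \<alpha> \<beta> m T \<epsilon> f0 f"
    and T: "real N * \<Delta> \<le> T" and n: "n \<le> N" and q: "q \<ge> 0"
    and r: "\<And>i y. i < N \<Longrightarrow> y \<in> {real i * \<Delta>..real i * \<Delta> + \<Delta>} \<Longrightarrow>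
       norm (rho_hat lo hi f k y - interpolant (real i * \<Delta>) \<Delta> (rho_hat lo hi f k (real i * \<Delta>))
                (rho_hat lo hi f k (real i * \<Delta> + \<Delta>)) y)
         \<le> p + q * ((real i * \<Delta> + \<Delta> - y) / \<epsilon> powr \<alpha>)"
  shows "norm (rho_hat lo hi f k (real n * \<Delta>) - A0_hat lo hi \<alpha> \<epsilon> f0 k (real n * \<Delta>)
      - (\<Sum>j<n. coeff_c \<alpha> \<beta> m e \<epsilon> \<Delta> k j * rho_hat lo hi f k (real (n - j) * \<Delta>)
              + coeff_b \<alpha> \<beta> m e \<epsilon> \<Delta> k j * rho_hat lo hi f k (real (n - Suc j) * \<Delta>)))
    \<le> (p + q) * (1 - exp (- (real n * (\<Delta> / \<epsilon> powr \<alpha>))))"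
proof -
  let ?\<tau> = "\<Delta> / \<epsilon> powr \<alpha>"
  let ?r = "rho_hat lo hi f k" and ?F = "\<lambda>v t. f0_hat lo hi (f t) k v"
  let ?M = "equilibrium m \<beta> :: real ^ 'd \<Rightarrow> real"
  let ?z = "rate \<epsilon> k"
  let ?S = "\<lambda>v. \<Sum>j<n. kernel_c ?\<tau> j (?z v) * ?r (real (n - j) * \<Delta>) + kernel_b ?\<tau> j (?z v) * ?r (real (n - Suc j) * \<Delta>)"
  let ?D = "\<lambda>v. ?F v (real n * \<Delta>) - exp (- of_real (real n * ?\<tau>) * ?z v) * ?F v 0 - of_real (?M v) * ?S v"
  have \<eta>: "\<epsilon> powr \<alpha> > 0" and \<tau>: "?\<tau> > 0" using \<epsilon> \<Delta> by auto
  have M: "integrable lborel ?M"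
    using normalised not_integrable_integral_eq by fastforce
  have nT: "real n * \<Delta> \<in> {0..T}" "0 \<in> {0..T}"
  proof -
    have "real n * \<Delta> \<le> T" using n \<Delta> by (intro order_trans[OF mult_right_mono T]) auto
    moreover have "0 \<le> real n * \<Delta>" using \<Delta> by simp
    ultimately show "real n * \<Delta> \<in> {0..T}" "0 \<in> {0..T}" by (simp_all add: order_trans)
  qed
  have phase: "integrable_on_phase_space lo hi (f t)" if "t \<in> {0..T}" for t
    using sol that by (simp add: solves_kinetic_def)
  have D: "norm (?D v) \<le> ?M v * ((p + q) * (1 - exp (- (real n * ?\<tau>))))" for v
  proof (rule history_defect_bound[OF \<Delta> \<eta> refl Re_rate _ q _ r T n])
    show "?M v \<ge> 0" using equilibrium_pos[OF m] by (rule less_imp_le)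
    show "(?F v has_vector_derivative (of_real (?M v) * ?r y - ?z v * ?F v y) / of_real (\<epsilon> powr \<alpha>))
        (at y within {0..T})" if "y \<in> {0..T}" for y
      using kinetic_fourier_ode[OF sol m \<epsilon> cell k that] by (simp add: rate_def)
  qed auto
  have F: "integrable lborel (\<lambda>v. ?F v (real n * \<Delta>))" "?r (real n * \<Delta>) = (LINT v|lborel. ?F v (real n * \<Delta>))"
    using fourier_density[OF phase[OF nT(1)], of k] by (simp_all add: rho_hat_def)
  have F0: "integrable lborel (\<lambda>v. ?F v 0)"
    using fourier_density(1)[OF phase[OF nT(2)], of k] by simp
  have [measurable]: "(\<lambda>v. ?F v 0) \<in> borel_measurable borel"
    using borel_measurable_integrable[OF F0] by simp
  have E: "integrable lborel (\<lambda>v. exp (- of_real (real n * ?\<tau>) * ?z v) * ?F v 0)"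
  proof (rule Bochner_Integration.integrable_bound[OF F0])
    show "AE v in lborel. norm (exp (- of_real (real n * ?\<tau>) * ?z v) * ?F v 0) \<le> norm (?F v 0)"
      using \<Delta> \<epsilon> unfolding norm_mult norm_exp_unit_rate[OF Re_rate]
      by (intro AE_I2 mult_left_le_one_le) auto
  qed measurable
  have A: "A0_hat lo hi \<alpha> \<epsilon> f0 k (real n * \<Delta>) = (LINT v|lborel. exp (- of_real (real n * ?\<tau>) * ?z v) * ?F v 0)"
    using sol by (simp add: A0_hat_def rate_def solves_kinetic_def)
  have Ki: "integrable lborel (\<lambda>v. ?M v *\<^sub>R kernel_c ?\<tau> j (?z v))" "integrable lborel (\<lambda>v. ?M v *\<^sub>R kernel_b ?\<tau> j (?z v))" for j
    by (rule equilibrium_average_integrable[OF normalised _ norm_kernel_le(1)[OF Re_rate \<tau>]]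
        equilibrium_average_integrable[OF normalised _ norm_kernel_le(2)[OF Re_rate \<tau>]]; measurable)+
  have MS: "of_real (?M v) * ?S v = (\<Sum>j<n. (?M v *\<^sub>R kernel_c ?\<tau> j (?z v)) * ?r (real (n - j) * \<Delta>)
      + (?M v *\<^sub>R kernel_b ?\<tau> j (?z v)) * ?r (real (n - Suc j) * \<Delta>))" for v
    by (simp add: scaleR_conv_of_real sum_distrib_left distrib_left mult.assoc)
  have S: "integrable lborel (\<lambda>v. of_real (?M v) * ?S v)"
    "(LINT v|lborel. of_real (?M v) * ?S v) = (\<Sum>j<n. coeff_c \<alpha> \<beta> m e \<epsilon> \<Delta> k j * ?r (real (n - j) * \<Delta>)
              + coeff_b \<alpha> \<beta> m e \<epsilon> \<Delta> k j * ?r (real (n - Suc j) * \<Delta>))"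
    unfolding MS coeff_eq_kernel_average[OF e \<beta> \<epsilon> normalised]
    using integrable_mult_left[OF Ki(1)] integrable_mult_left[OF Ki(2)]
    by (simp_all del: mult_scaleR_left)
  define D where "D = ?D"
  have "?r (real n * \<Delta>) - A0_hat lo hi \<alpha> \<epsilon> f0 k (real n * \<Delta>)
      - (\<Sum>j<n. coeff_c \<alpha> \<beta> m e \<epsilon> \<Delta> k j * ?r (real (n - j) * \<Delta>)
              + coeff_b \<alpha> \<beta> m e \<epsilon> \<Delta> k j * ?r (real (n - Suc j) * \<Delta>)) = (LINT v|lborel. D v)"
    unfolding F(2) A S(2)[symmetric] D_def
    by (subst Bochner_Integration.integral_diff[OF Bochner_Integration.integrable_diff[OF F(1) E] S(1)],
        subst Bochner_Integration.integral_diff[OF F(1) E]) (rule refl)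
  also have "norm \<dots> \<le> (LINT v|lborel. ?M v * ((p + q) * (1 - exp (- (real n * ?\<tau>)))))"
    by (rule norm_integral_le_integral) (use M D in \<open>simp_all only: D_def integrable_mult_left\<close>)
  also have "\<dots> = (p + q) * (1 - exp (- (real n * ?\<tau>)))"
    by (simp add: normalised)
  finally show ?thesis .
qed

lemma duhamel_errors:
  fixes f :: "real \<Rightarrow> 'd::finite phase_fun" and e k :: "real ^ 'd"
  assumes m: "m > 0" and e: "norm e = 1" and \<beta>: "\<beta> = \<alpha> + real CARD('d)" and \<epsilon>: "\<epsilon> > 0"
    and normalised: "(LINT v|lborel. equilibrium m \<beta> (v :: real ^ 'd)) = 1"
    and cell: "\<And>i. lo $ i < hi $ i" and k: "k \<in> frequencies lo hi"
    and sol: "solves_kinetic lo hi \<alpha> \<beta> m T \<epsilon> f0 f"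
    and T: "T > 0" and N: "N \<ge> 1" and \<Delta>: "\<Delta> = T / real N" and p: "p \<ge> 0" and q: "q \<ge> 0"
    and r: "\<And>i y. i < N \<Longrightarrow> y \<in> {real i * \<Delta>..real i * \<Delta> + \<Delta>} \<Longrightarrow>
       norm (rho_hat lo hi f k y - interpolant (real i * \<Delta>) \<Delta> (rho_hat lo hi f k (real i * \<Delta>))
                (rho_hat lo hi f k (real i * \<Delta> + \<Delta>)) y)
         \<le> p + q * ((real i * \<Delta> + \<Delta> - y) / \<epsilon> powr \<alpha>)"
  shows "n < N \<Longrightarrow> local_error (duhamel_step lo hi \<alpha> \<beta> m e \<epsilon> \<Delta> f0 k) \<Delta> (rho_hat lo hi f k) n
            \<le> (p + q) * (1 + \<Delta> / \<epsilon> powr \<alpha>)"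
    and "n \<le> N \<Longrightarrow> global_error (duhamel_scheme lo hi \<alpha> \<beta> m e \<epsilon> \<Delta> f0 k) \<Delta> (rho_hat lo hi f k) n
            \<le> (p + q) * (real n * (\<Delta> / \<epsilon> powr \<alpha>))"
proof -
  have \<Delta>0: "\<Delta> > 0" and ND: "real N * \<Delta> \<le> T" using T N \<Delta> by auto
  have \<tau>: "\<Delta> / \<epsilon> powr \<alpha> > 0" using \<Delta>0 \<epsilon> by simp
  have r0: "rho0_hat lo hi f0 k = rho_hat lo hi f k (real 0 * \<Delta>)"
  proof -
    have "f 0 = f0" "integrable_on_phase_space lo hi (f 0)"
      using sol T by (auto simp: solves_kinetic_def)
    then show ?thesis
      using fourier_density(2)[of lo hi f0 k] by (simp add: rho0_hat_def rho_hat_def)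
  qed
  note H = history_errors[OF \<tau>, of "coeff_c \<alpha> \<beta> m e \<epsilon> \<Delta> k" "coeff_b \<alpha> \<beta> m e \<epsilon> \<Delta> k" N
      "\<lambda>i. rho_hat lo hi f k (real i * \<Delta>)" "\<lambda>n. A0_hat lo hi \<alpha> \<epsilon> f0 k (real n * \<Delta>)" "p + q",
      OF norm_coeff_le[OF m e \<beta> \<epsilon> \<Delta>0 normalised]
        duhamel_defect_bound[OF m e \<beta> \<epsilon> \<Delta>0 normalised cell k sol ND _ q r]]
  show "n < N \<Longrightarrow> local_error (duhamel_step lo hi \<alpha> \<beta> m e \<epsilon> \<Delta> f0 k) \<Delta> (rho_hat lo hi f k) n
            \<le> (p + q) * (1 + \<Delta> / \<epsilon> powr \<alpha>)"
    using H(1)[of n] p q by (simp add: local_error_def duhamel_step_def)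
  show "n \<le> N \<Longrightarrow> global_error (duhamel_scheme lo hi \<alpha> \<beta> m e \<epsilon> \<Delta> f0 k) \<Delta> (rho_hat lo hi f k) n
            \<le> (p + q) * (real n * (\<Delta> / \<epsilon> powr \<alpha>))"
    using H(2)[of n] p q unfolding global_error_def duhamel_scheme_def r0 by simp
qed

lemma interpolation_error_modulus:
  assumes \<Delta>: "\<Delta> > 0" and y: "y \<in> {s..s + \<Delta>}"
    and r: "norm (r y - r s) \<le> w" "norm (r y - r (s + \<Delta>)) \<le> w"
  shows "norm (r y - interpolant s \<Delta> (r s) (r (s + \<Delta>)) y) \<le> w"
proof -
  define \<theta> where "\<theta> = (y - s) / \<Delta>"
  have \<theta>: "0 \<le> \<theta>" "\<theta> \<le> 1" "(s + \<Delta> - y) / \<Delta> = 1 - \<theta>"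
    using \<Delta> y by (auto simp: \<theta>_def field_simps)
  have "r y - interpolant s \<Delta> (r s) (r (s + \<Delta>)) y
      = of_real (1 - \<theta>) * (r y - r s) + of_real \<theta> * (r y - r (s + \<Delta>))"
    unfolding interpolant_def \<theta>(3) \<theta>_def[symmetric] by (simp add: algebra_simps)
  also have "norm \<dots> \<le> (1 - \<theta>) * norm (r y - r s) + \<theta> * norm (r y - r (s + \<Delta>))"
    using norm_triangle_ineq[of "of_real (1 - \<theta>) * (r y - r s)" "of_real \<theta> * (r y - r (s + \<Delta>))"] \<theta>
    by (simp add: norm_mult del: of_real_diff)
  also have "\<dots> \<le> (1 - \<theta>) * w + \<theta> * w"
    using r \<theta> by (intro add_mono mult_left_mono) auto
  finally show ?thesis by (simp add: algebra_simps)
qed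

lemma vector_derivative_bound_imp_lipschitz:
  fixes r :: "real \<Rightarrow> 'b::real_normed_vector"
  assumes "\<And>t. t \<in> {a..b} \<Longrightarrow> (r has_vector_derivative r' t) (at t within {a..b})"
    and "\<And>t. t \<in> {a..b} \<Longrightarrow> norm (r' t) \<le> B" and "x \<in> {a..b}" "y \<in> {a..b}"
  shows "norm (r x - r y) \<le> B * \<bar>x - y\<bar>"
proof -
  have "norm (r x - r y) \<le> B * norm (x - y)"
  proof (rule differentiable_bound[of "{a..b}"])
    show "(r has_derivative (\<lambda>h. h *\<^sub>R r' t)) (at t within {a..b})" if "t \<in> {a..b}" for t
      using assms(1)[OF that] by (simp add: has_vector_derivative_def)
    show "onorm (\<lambda>h. h *\<^sub>R r' t) \<le> B" if "t \<in> {a..b}" for t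
      using assms(2)[OF that] by (intro onorm_le) (simp add: mult.commute[of B] mult_left_mono)
  qed (use assms in auto)
  then show ?thesis by simp
qed

lemma taylor_remainder_bound:
  fixes r :: "real \<Rightarrow> 'b::real_normed_vector"
  assumes r1: "\<And>t. t \<in> {a..b} \<Longrightarrow> (r has_vector_derivative r1 t) (at t within {a..b})"
    and r2: "\<And>t. t \<in> {a..b} \<Longrightarrow> (r1 has_vector_derivative r2 t) (at t within {a..b})"
    and B: "\<And>t. t \<in> {a..b} \<Longrightarrow> norm (r2 t) \<le> B" and B0: "B \<ge> 0" and x: "x \<in> {a..b}" "y \<in> {a..b}"
  shows "norm (r x - r y - (x - y) *\<^sub>R r1 y) \<le> B * (x - y)\<^sup>2"
proof -
  have sub: "closed_segment y x \<subseteq> {a..b}"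
    using x by (simp add: closed_segment_subset)
  have "norm (r x - r y - (x - y) *\<^sub>R r1 y) \<le> norm (x - y) * (B * \<bar>x - y\<bar>)"
  proof (rule vector_differentiable_bound_linearization[of "closed_segment y x"])
    fix t assume t: "t \<in> closed_segment y x"
    then have t': "t \<in> {a..b}" using sub by blast
    show "(r has_vector_derivative r1 t) (at t within closed_segment y x)"
      using r1[OF t'] sub by (rule has_vector_derivative_within_subset)
    have "norm (r1 t - r1 y) \<le> B * \<bar>t - y\<bar>"
      by (rule vector_derivative_bound_imp_lipschitz[OF r2 B t' x(2)])
    also have "\<dots> \<le> B * \<bar>x - y\<bar>"
      using t B0 by (intro mult_left_mono) (auto simp: closed_segment_eq_real_ivl split: if_splits)
    finally show "norm (r1 t - r1 y) \<le> B * \<bar>x - y\<bar>" .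
  qed auto
  also have "norm (x - y) * (B * \<bar>x - y\<bar>) = B * (x - y)\<^sup>2"
    by (simp add: power2_eq_square abs_mult[symmetric] mult.left_commute)
  finally show ?thesis .
qed

text \<open>
  The product form vanishes at both end points; the vanishing at the right one is needed when the
  time step is long compared with the relaxation time.
\<close>

lemma interpolation_error_smooth:
  assumes bd: "time_derivatives_bounded T B r"
    and \<Delta>: "\<Delta> > 0" and s: "0 \<le> s" "s + \<Delta> \<le> T" and y: "y \<in> {s..s + \<Delta>}"
  shows "norm (r y - interpolant s \<Delta> (r s) (r (s + \<Delta>)) y) \<le> B * ((y - s) * (s + \<Delta> - y))"
proof -
  obtain r1 r2 where r: "\<And>t. t \<in> {0..T} \<Longrightarrow> (r has_vector_derivative r1 t) (at t within {0..T})"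
      "\<And>t. t \<in> {0..T} \<Longrightarrow> (r1 has_vector_derivative r2 t) (at t within {0..T})"
      "\<And>t. t \<in> {0..T} \<Longrightarrow> norm (r2 t) \<le> B"
    using bd unfolding time_derivatives_bounded_def by blast
  have mem: "s \<in> {0..T}" "s + \<Delta> \<in> {0..T}" "y \<in> {0..T}" using s \<Delta> y by auto
  have B0: "B \<ge> 0" by (rule order_trans[OF norm_ge_zero r(3)[OF mem(1)]])
  define \<theta> where "\<theta> = (y - s) / \<Delta>"
  have \<theta>: "0 \<le> \<theta>" "\<theta> \<le> 1" "(s + \<Delta> - y) / \<Delta> = 1 - \<theta>" "y - s = \<theta> * \<Delta>" "s + \<Delta> - y = (1 - \<theta>) * \<Delta>"
    using \<Delta> y by (auto simp: \<theta>_def field_simps)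
  let ?R = "\<lambda>x. r x - r y - (x - y) *\<^sub>R r1 y"
  have R: "norm (?R x) \<le> B * (x - y)\<^sup>2" if "x \<in> {0..T}" for x
    by (rule taylor_remainder_bound[OF r B0 that mem(3)])
  have lin: "(1 - \<theta>) * (s - y) + \<theta> * (s + \<Delta> - y) = 0"
    using \<theta>(4) by (simp add: algebra_simps)
  \<comment> \<open>the first order terms of the two Taylor expansions cancel in the convex combination\<close>
  have "r y - interpolant s \<Delta> (r s) (r (s + \<Delta>)) y
      = - (of_real (1 - \<theta>) * ?R s + of_real \<theta> * ?R (s + \<Delta>)) - of_real ((1 - \<theta>) * (s - y) + \<theta> * (s + \<Delta> - y)) * r1 y"
    unfolding interpolant_def \<theta>(3) \<theta>_def[symmetric] by (simp add: scaleR_conv_of_real algebra_simps)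
  also have "norm \<dots> = norm (of_real (1 - \<theta>) * ?R s + of_real \<theta> * ?R (s + \<Delta>))"
    unfolding lin by (simp only: of_real_0 mult_zero_left diff_zero norm_minus_cancel)
  also have "\<dots> \<le> (1 - \<theta>) * norm (?R s) + \<theta> * norm (?R (s + \<Delta>))"
    using norm_triangle_ineq[of "of_real (1 - \<theta>) * ?R s" "of_real \<theta> * ?R (s + \<Delta>)"] \<theta>(1,2)
    by (simp add: norm_mult del: of_real_diff)
  also have "\<dots> \<le> (1 - \<theta>) * (B * (s - y)\<^sup>2) + \<theta> * (B * (s + \<Delta> - y)\<^sup>2)"
    using R[OF mem(1)] R[OF mem(2)] \<theta>(1,2) by (intro add_mono mult_left_mono) auto
  also have "(s - y)\<^sup>2 = (\<theta> * \<Delta>)\<^sup>2"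
    unfolding \<theta>(4)[symmetric] by (rule power2_commute)
  also have "(1 - \<theta>) * (B * (\<theta> * \<Delta>)\<^sup>2) + \<theta> * (B * (s + \<Delta> - y)\<^sup>2) = B * ((y - s) * (s + \<Delta> - y))"
    unfolding \<theta>(4,5) by (simp add: power2_eq_square algebra_simps)
  finally show ?thesis .
qed

text \<open>
  With \<open>\<tau> = \<Delta> / \<epsilon>\<^sup>\<alpha>\<close> the interpolation error contributes a multiple of \<open>B \<Delta>\<^sup>2 min 1 (1 / \<tau>)\<close>.  The local
  error loses the factor \<open>1 + \<tau>\<close> and the global error the factor \<open>n \<tau>\<close>; both are compensated by the
  minimum, uniformly in \<open>\<epsilon>\<close>.
\<close>

lemma duhamel_order_in_time:
  fixes e lo hi :: "real ^ 'd::finite"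
  assumes m: "m > 0" and e: "norm e = 1" and \<beta>: "\<beta> = \<alpha> + real CARD('d)"
    and normalised: "(LINT v|lborel. equilibrium m \<beta> (v :: real ^ 'd)) = 1"
    and cell: "\<And>i. lo $ i < hi $ i" and T: "T > 0"
  shows "order_in_time lo hi \<alpha> \<beta> m T (duhamel_step lo hi \<alpha> \<beta> m e) (duhamel_scheme lo hi \<alpha> \<beta> m e) 1"
  unfolding order_in_time_def
proof (intro exI[of _ "max 2 T"] allI impI ballI)
  fix \<epsilon> :: real and f0 f k B and N :: nat
  assume \<epsilon>: "\<epsilon> > 0" and k: "k \<in> frequencies lo hi" and sol: "solves_kinetic lo hi \<alpha> \<beta> m T \<epsilon> f0 f"
    and bd: "time_derivatives_bounded T B (rho_hat lo hi f k)" and N: "1 \<le> N"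
  define \<Delta> where "\<Delta> = T / real N"
  define \<eta> where "\<eta> = \<epsilon> powr \<alpha>"
  have \<Delta>: "\<Delta> > 0" and ND: "real N * \<Delta> = T" and \<eta>: "\<eta> > 0" using T N \<epsilon> by (auto simp: \<Delta>_def \<eta>_def)
  have B: "B \<ge> 0"
  proof -
    obtain r1 :: "real \<Rightarrow> complex" where "norm (r1 0) \<le> B"
      using bd T unfolding time_derivatives_bounded_def by force
    then show ?thesis by (rule order_trans[OF norm_ge_zero])
  qed
  \<comment> \<open>the interpolation error bound useful for short time steps\<close>
  define p where "p = (if \<Delta> \<le> \<eta> then B * \<Delta>\<^sup>2 else 0)"
  \<comment> \<open>and the one for time steps larger than the relaxation time\<close>
  define q where "q = (if \<Delta> \<le> \<eta> then 0 else B * \<Delta> * \<eta>)"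
  have pq: "p \<ge> 0" "q \<ge> 0" using B \<Delta> \<eta> by (auto simp: p_def q_def)
  have r: "norm (rho_hat lo hi f k y - interpolant (real i * \<Delta>) \<Delta> (rho_hat lo hi f k (real i * \<Delta>))
                (rho_hat lo hi f k (real i * \<Delta> + \<Delta>)) y)
         \<le> p + q * ((real i * \<Delta> + \<Delta> - y) / \<epsilon> powr \<alpha>)"
    if i: "i < N" and y: "y \<in> {real i * \<Delta>..real i * \<Delta> + \<Delta>}" for i y
  proof -
    let ?s = "real i * \<Delta>"
    have "real i * \<Delta> + \<Delta> = real (Suc i) * \<Delta>" by (simp add: algebra_simps)
    also have "\<dots> \<le> T" unfolding ND[symmetric] using i \<Delta> by (intro mult_right_mono) auto
    finally have "?s + \<Delta> \<le> T" .
    then have "norm (rho_hat lo hi f k y - interpolant ?s \<Delta> (rho_hat lo hi f k ?s)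
                (rho_hat lo hi f k (?s + \<Delta>)) y) \<le> B * ((y - ?s) * (?s + \<Delta> - y))"
      using \<Delta> by (intro interpolation_error_smooth[OF bd \<Delta> _ _ y]) auto
    also have "\<dots> \<le> B * (\<Delta> * (?s + \<Delta> - y))"
      using B y by (intro mult_left_mono mult_right_mono) auto
    also have "\<dots> \<le> p + q * ((?s + \<Delta> - y) / \<epsilon> powr \<alpha>)"
    proof (cases "\<Delta> \<le> \<eta>")
      case True
      have "\<Delta> * (?s + \<Delta> - y) \<le> \<Delta> * \<Delta>" using y \<Delta> by (intro mult_left_mono) auto
      then show ?thesis using True B by (simp add: p_def q_def power2_eq_square mult_left_mono)
    next
      case False
      then show ?thesis using \<eta> by (simp add: p_def q_def \<eta>_def[symmetric])
    qed
    finally show ?thesis .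
  qed
  note E = duhamel_errors[OF m e \<beta> \<epsilon> normalised cell k sol T N \<Delta>_def pq r]
  have local: "(p + q) * (1 + \<Delta> / \<eta>) \<le> 2 * (B * \<Delta>\<^sup>2)"
  proof (cases "\<Delta> \<le> \<eta>")
    case True
    then have "1 + \<Delta> / \<eta> \<le> 2" using \<eta> by simp
    then have "B * \<Delta>\<^sup>2 * (1 + \<Delta> / \<eta>) \<le> B * \<Delta>\<^sup>2 * 2" using B by (intro mult_left_mono) auto
    then show ?thesis using True by (simp add: p_def q_def)
  next
    case False
    then have "B * \<Delta> * (\<eta> + \<Delta>) \<le> B * \<Delta> * (\<Delta> + \<Delta>)" using B \<Delta> by (intro mult_left_mono) auto
    moreover have "B * \<Delta> * \<eta> * (1 + \<Delta> / \<eta>) = B * \<Delta> * (\<eta> + \<Delta>)" using \<eta> by (simp add: field_simps)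
    moreover have "B * \<Delta> * (\<Delta> + \<Delta>) = 2 * (B * \<Delta>\<^sup>2)" by (simp add: power2_eq_square)
    moreover have "(p + q) * (1 + \<Delta> / \<eta>) = B * \<Delta> * \<eta> * (1 + \<Delta> / \<eta>)" using False by (simp add: p_def q_def)
    ultimately show ?thesis by (simp only:)
  qed
  have global: "(p + q) * (\<Delta> / \<eta>) \<le> B * \<Delta>\<^sup>2"
  proof (cases "\<Delta> \<le> \<eta>")
    case True
    then have "B * \<Delta>\<^sup>2 * (\<Delta> / \<eta>) \<le> B * \<Delta>\<^sup>2 * 1" using B \<eta> by (intro mult_left_mono) auto
    then show ?thesis using True by (simp add: p_def q_def)
  next
    case False
    then show ?thesis using \<eta> by (simp add: p_def q_def power2_eq_square)
  qed
  have Bpow: "B * \<Delta> ^ (1 + 1) \<ge> 0" "B * \<Delta> \<ge> 0" using B \<Delta> by auto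
  show "(\<forall>n<N. local_error (duhamel_step lo hi \<alpha> \<beta> m e \<epsilon> (T / real N) f0 k) (T / real N) (rho_hat lo hi f k) n
               \<le> max 2 T * B * (T / real N) ^ (1 + 1)) \<and>
        (\<forall>n\<le>N. global_error (duhamel_scheme lo hi \<alpha> \<beta> m e \<epsilon> (T / real N) f0 k) (T / real N) (rho_hat lo hi f k) n
               \<le> max 2 T * B * (T / real N) ^ 1)"
    unfolding \<Delta>_def[symmetric]
  proof (intro conjI allI impI)
    fix n assume "n < N"
    then have "local_error (duhamel_step lo hi \<alpha> \<beta> m e \<epsilon> \<Delta> f0 k) \<Delta> (rho_hat lo hi f k) n \<le> (p + q) * (1 + \<Delta> / \<eta>)"
      using E(1) unfolding \<eta>_def by blast
    also have "\<dots> \<le> 2 * (B * \<Delta> ^ (1 + 1))" using local by (simp add: power2_eq_square)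
    also have "\<dots> \<le> max 2 T * (B * \<Delta> ^ (1 + 1))" using Bpow by (intro mult_right_mono) auto
    finally show "local_error (duhamel_step lo hi \<alpha> \<beta> m e \<epsilon> \<Delta> f0 k) \<Delta> (rho_hat lo hi f k) n \<le> max 2 T * B * \<Delta> ^ (1 + 1)"
      by (simp add: mult.assoc)
  next
    fix n assume n: "n \<le> N"
    then have "global_error (duhamel_scheme lo hi \<alpha> \<beta> m e \<epsilon> \<Delta> f0 k) \<Delta> (rho_hat lo hi f k) n
        \<le> (p + q) * (real n * (\<Delta> / \<eta>))"
      using E(2) unfolding \<eta>_def by blast
    also have "\<dots> = real n * ((p + q) * (\<Delta> / \<eta>))" by simp
    also have "\<dots> \<le> real n * (B * \<Delta>\<^sup>2)" using global by (intro mult_left_mono) auto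
    also have "\<dots> = (real n * \<Delta>) * (B * \<Delta>)" by (simp add: power2_eq_square)
    also have "\<dots> \<le> max 2 T * (B * \<Delta>)"
    proof (rule mult_right_mono[OF _ Bpow(2)])
      have "real n * \<Delta> \<le> T" unfolding ND[symmetric] using n \<Delta> by (intro mult_right_mono) auto
      then show "real n * \<Delta> \<le> max 2 T" by simp
    qed
    finally show "global_error (duhamel_scheme lo hi \<alpha> \<beta> m e \<epsilon> \<Delta> f0 k) \<Delta> (rho_hat lo hi f k) n \<le> max 2 T * B * \<Delta> ^ 1"
      by (simp add: mult.assoc)
  qed
qed

text \<open>
  For fixed \<open>\<epsilon>\<close> the factors lost in the error estimates stay bounded, so it suffices that the
  interpolation error tends to zero, which is uniform continuity of the density in time.
\<close>

lemma duhamel_consistent: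
  fixes e lo hi :: "real ^ 'd::finite"
  assumes m: "m > 0" and e: "norm e = 1" and \<beta>: "\<beta> = \<alpha> + real CARD('d)"
    and normalised: "(LINT v|lborel. equilibrium m \<beta> (v :: real ^ 'd)) = 1"
    and cell: "\<And>i. lo $ i < hi $ i" and T: "T > 0" and \<epsilon>: "\<epsilon> > 0"
  shows "consistent_with_kinetic lo hi \<alpha> \<beta> m T (duhamel_step lo hi \<alpha> \<beta> m e) (duhamel_scheme lo hi \<alpha> \<beta> m e) \<epsilon>"
  unfolding consistent_with_kinetic_def
proof (intro allI impI ballI)
  fix f0 f k and w :: real
  assume k: "k \<in> frequencies lo hi" and sol: "solves_kinetic lo hi \<alpha> \<beta> m T \<epsilon> f0 f" and w: "w > 0"
  let ?r = "rho_hat lo hi f k"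
  define \<eta> where "\<eta> = \<epsilon> powr \<alpha>"
  have \<eta>: "\<eta> > 0" using \<epsilon> by (simp add: \<eta>_def)
  \<comment> \<open>the bound on the interpolation error that both error estimates can afford\<close>
  define g where "g = w / (2 * (1 + T / \<eta>))"
  have T\<eta>: "T / \<eta> > 0" using T \<eta> by simp
  then have g: "g > 0" using w by (simp add: g_def)
  have gw: "g * (1 + T / \<eta>) < w"
  proof -
    have "w / (2 * a) * a = w / 2" if "a \<noteq> 0" for a using that by simp
    from this[of "1 + T / \<eta>"] have half: "g * (1 + T / \<eta>) = w / 2" unfolding g_def using T\<eta> by linarith
    show ?thesis unfolding half using w by simp
  qed
  have "uniformly_continuous_on {0..T} ?r"
    by (intro compact_uniformly_continuous rho_hat_continuous[OF sol m]) simp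
  then obtain d where d: "d > 0" "\<And>x y. x \<in> {0..T} \<Longrightarrow> y \<in> {0..T} \<Longrightarrow> dist y x < d \<Longrightarrow> dist (?r y) (?r x) < g"
    using g unfolding uniformly_continuous_on_def by metis
  have "(\<lambda>N. T / real N) \<longlonglongrightarrow> 0" by (rule lim_const_over_n)
  then have "\<forall>\<^sub>F N in sequentially. T / real N < d"
    using d(1) by (rule order_tendstoD)
  then show "\<forall>\<^sub>F N in sequentially.
       (\<forall>n<N. local_error (duhamel_step lo hi \<alpha> \<beta> m e \<epsilon> (T / real N) f0 k) (T / real N) ?r n < w) \<and>
       (\<forall>n\<le>N. global_error (duhamel_scheme lo hi \<alpha> \<beta> m e \<epsilon> (T / real N) f0 k) (T / real N) ?r n < w)"
    using eventually_ge_at_top[of 1]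
  proof eventually_elim
    case (elim N)
    define \<Delta> where "\<Delta> = T / real N"
    have \<Delta>: "\<Delta> > 0" "\<Delta> < d" and ND: "real N * \<Delta> = T" using T elim by (auto simp: \<Delta>_def)
    have nT: "real n * \<Delta> \<le> T" if "n \<le> N" for n
      unfolding ND[symmetric] using that \<Delta> by (intro mult_right_mono) auto
    have "norm (?r y - interpolant (real i * \<Delta>) \<Delta> (?r (real i * \<Delta>)) (?r (real i * \<Delta> + \<Delta>)) y)
         \<le> g + 0 * ((real i * \<Delta> + \<Delta> - y) / \<epsilon> powr \<alpha>)"
      if i: "i < N" and y: "y \<in> {real i * \<Delta>..real i * \<Delta> + \<Delta>}" for i y
    proof -
      have "real i * \<Delta> + \<Delta> \<le> T" using nT[of "Suc i"] i by (simp add: algebra_simps)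
      moreover have i0: "0 \<le> real i * \<Delta>" using \<Delta> by simp
      moreover have "0 \<le> y" using order_trans[OF i0, of y] y by simp
      ultimately have "real i * \<Delta> \<in> {0..T}" "real i * \<Delta> + \<Delta> \<in> {0..T}" "y \<in> {0..T}"
        using y \<Delta> unfolding atLeastAtMost_iff by linarith+
      then have "dist (?r y) (?r (real i * \<Delta>)) < g" "dist (?r y) (?r (real i * \<Delta> + \<Delta>)) < g"
        using y \<Delta> by (auto intro!: d(2) simp: dist_real_def)
      then show ?thesis
        using interpolation_error_modulus[OF \<Delta>(1) y, of ?r g] by (simp add: dist_norm)
    qed
    note E = duhamel_errors[OF m e \<beta> \<epsilon> normalised cell k sol T elim(2) \<Delta>_def less_imp_le[OF g] order_refl this]
    show ?case
      unfolding \<Delta>_def[symmetric]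
    proof (intro conjI allI impI)
      fix n assume "n < N"
      then have "local_error (duhamel_step lo hi \<alpha> \<beta> m e \<epsilon> \<Delta> f0 k) \<Delta> ?r n \<le> g * (1 + \<Delta> / \<eta>)"
        using E(1) unfolding \<eta>_def by simp
      also have "\<dots> \<le> g * (1 + T / \<eta>)"
        using g \<eta> nT[of 1] elim by (intro mult_left_mono) (auto simp: divide_right_mono)
      finally show "local_error (duhamel_step lo hi \<alpha> \<beta> m e \<epsilon> \<Delta> f0 k) \<Delta> ?r n < w" using gw by simp
    next
      fix n assume n: "n \<le> N"
      then have "global_error (duhamel_scheme lo hi \<alpha> \<beta> m e \<epsilon> \<Delta> f0 k) \<Delta> ?r n \<le> g * (real n * (\<Delta> / \<eta>))"
        using E(2) unfolding \<eta>_def by simp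
      also have "\<dots> = g * ((real n * \<Delta>) / \<eta>)" by simp
      also have "\<dots> \<le> g * (1 + T / \<eta>)"
      proof (rule mult_left_mono)
        have "(real n * \<Delta>) / \<eta> \<le> T / \<eta>" using nT[OF n] \<eta> by (intro divide_right_mono) auto
        then show "(real n * \<Delta>) / \<eta> \<le> 1 + T / \<eta>" by simp
      qed (use g in simp)
      finally show "global_error (duhamel_scheme lo hi \<alpha> \<beta> m e \<epsilon> \<Delta> f0 k) \<Delta> ?r n < w" using gw by simp
    qed
  qed
qed

text \<open>
  In the mode \<open>0\<close> the coefficients are the nonnegative decay weights, whose partial sums
  \<open>1 - exp (- n \<tau>)\<close> are complemented to one by the initial layer.  Hence the constant sequence has no
  defect.
\<close>

lemma duhamel_mass_conserved:
  fixes e lo hi :: "real ^ 'd::finite"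
  assumes m: "m > 0" and e: "norm e = 1" and \<beta>: "\<beta> = \<alpha> + real CARD('d)" and \<epsilon>: "\<epsilon> > 0" and \<Delta>: "\<Delta> > 0"
    and normalised: "(LINT v|lborel. equilibrium m \<beta> (v :: real ^ 'd)) = 1"
  shows "duhamel_scheme lo hi \<alpha> \<beta> m e \<epsilon> \<Delta> f0 0 n = rho0_hat lo hi f0 0"
proof -
  let ?\<tau> = "\<Delta> / \<epsilon> powr \<alpha>" and ?\<rho> = "rho0_hat lo hi f0 0"
  have \<tau>: "?\<tau> > 0" using \<Delta> \<epsilon> by simp
  have c: "coeff_c \<alpha> \<beta> m e \<epsilon> \<Delta> 0 j = of_real (decay_c ?\<tau> j)" and b: "coeff_b \<alpha> \<beta> m e \<epsilon> \<Delta> 0 j = of_real (decay_b ?\<tau> j)" for j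
    using coeff_eq_kernel_average[OF e \<beta> \<epsilon> normalised, of \<Delta> 0 j] normalised
    by (simp_all add: rate_def kernel_one scaleR_conv_of_real)
  have A: "A0_hat lo hi \<alpha> \<epsilon> f0 0 (real n * \<Delta>) = of_real (exp (- (real n * ?\<tau>))) * ?\<rho>" for n
    by (simp add: A0_hat_def rho0_hat_def exp_of_real[symmetric])
  have "norm (?\<rho> - A0_hat lo hi \<alpha> \<epsilon> f0 0 (real n * \<Delta>)
      - (\<Sum>j<n. coeff_c \<alpha> \<beta> m e \<epsilon> \<Delta> 0 j * ?\<rho> + coeff_b \<alpha> \<beta> m e \<epsilon> \<Delta> 0 j * ?\<rho>)) \<le> 0 * (1 - exp (- (real n * ?\<tau>)))" for n
  proof -
    have "(\<Sum>j<n. coeff_c \<alpha> \<beta> m e \<epsilon> \<Delta> 0 j * ?\<rho> + coeff_b \<alpha> \<beta> m e \<epsilon> \<Delta> 0 j * ?\<rho>)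
       = of_real (\<Sum>j<n. decay_c ?\<tau> j + decay_b ?\<tau> j) * ?\<rho>"
      unfolding c b by (simp add: sum_distrib_right distrib_right)
    then show ?thesis
      unfolding A decay_sum_total by (simp add: algebra_simps)
  qed
  from history_errors(2)[OF \<tau> norm_coeff_le[OF m e \<beta> \<epsilon> \<Delta> normalised] this order_refl order_refl, of n]
  show ?thesis by (simp add: duhamel_scheme_def)
qed


section \<open>The anomalous diffusion limit\<close>

text \<open>
  On the dyadic shell between the radii \<open>(1/2) ^ (j + 1)\<close> and \<open>(1/2) ^ j\<close> the integrand is at most
  \<open>((1/2) ^ j) powr a\<close> times \<open>2 ^ (j + 1)\<close> to the power of the dimension.  The volume of the ball of
  radius \<open>(1/2) ^ j\<close> cancels the growth, leaving a geometric series of ratio \<open>(1/2) powr a\<close>.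
\<close>

lemma integrable_norm_powr_unit_ball:
  assumes a: "a > 0"
  shows "integrable lborel (\<lambda>w::real ^ 'd::finite. indicator (ball 0 1) w * norm w powr (a - real CARD('d)))"
proof (rule integrableI_bounded)
  let ?d = "CARD('d)" and ?V = "unit_ball_vol (real CARD('d))"
  let ?h = "\<lambda>w::real ^ 'd. indicator (ball 0 1) w * norm w powr (a - real ?d)"
  define C where "C j = ((1/2) ^ j) powr a * (2 ^ Suc j) ^ ?d" for j :: nat
  let ?g = "\<lambda>j w. ennreal (C j) * indicator (ball (0 :: real ^ 'd) ((1/2) ^ j)) w"
  have [measurable]: "(indicator (ball (0 :: real ^ 'd) 1) :: _ \<Rightarrow> real) \<in> borel_measurable borel"
    by (intro borel_measurable_indicator) simp
  have meas': "(indicator (ball (0 :: real ^ 'd) r) :: _ \<Rightarrow> ennreal) \<in> borel_measurable borel" for r :: real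
    by (intro borel_measurable_indicator) simp
  show "?h \<in> borel_measurable lborel"
    by measurable
  have le_suminf: "F i \<le> suminf F" for F :: "nat \<Rightarrow> ennreal" and i
    using sum_le_suminf[of F "{i}"] by simp
  have "ennreal (norm (?h w)) \<le> (\<Sum>j. ?g j w)" for w
  proof (cases "w \<in> ball 0 1 \<and> w \<noteq> 0")
    case False
    then have h0: "?h w = 0" by (auto simp: indicator_def)
    show ?thesis unfolding h0 by simp
  next
    case True
    then have w: "0 < norm w" "norm w < 1" by auto
    obtain n where n: "(1/2) ^ n < norm w"
      using real_arch_pow_inv[of "norm w" "1/2"] w by auto
    \<comment> \<open>the shell containing \<open>w\<close>\<close>
    define i where "i = (LEAST n. (1/2) ^ n \<le> norm w)"
    have i: "(1/2) ^ i \<le> norm w"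
      unfolding i_def by (rule LeastI[of _ n]) (use n in simp)
    have "i \<noteq> 0" using i w by (intro notI) simp
    then obtain j where j: "i = Suc j" by (cases i) auto
    have "\<not> (1/2) ^ j \<le> norm w"
      using not_less_Least[of j "\<lambda>n. (1/2) ^ n \<le> norm w"] j by (simp add: i_def)
    then have wj: "norm w < (1/2) ^ j" by simp
    have "norm w powr (a - real ?d) = norm w powr a / norm w ^ ?d"
      using w by (simp add: powr_diff powr_realpow)
    also have "\<dots> \<le> ((1/2) ^ j) powr a / ((1/2) ^ Suc j) ^ ?d"
      using w wj i a j by (intro frac_le powr_mono2 power_mono) auto
    also have "\<dots> = C j"
    proof -
      have "((1/2 :: real) ^ Suc j) ^ ?d = 1 / (2 ^ Suc j) ^ ?d" by (simp only: power_one_over)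
      then show ?thesis by (simp only: C_def divide_divide_eq_right mult.right_neutral div_by_1)
    qed
    finally have "ennreal (norm (?h w)) \<le> ?g j w"
      using w wj by (simp add: indicator_def ennreal_leI)
    also have "\<dots> \<le> (\<Sum>j. ?g j w)"
      by (rule le_suminf)
    finally show ?thesis .
  qed
  then have "(\<integral>\<^sup>+w. ennreal (norm (?h w)) \<partial>lborel) \<le> (\<integral>\<^sup>+w. (\<Sum>j. ?g j w) \<partial>lborel)"
    by (intro nn_integral_mono)
  also have "\<dots> = (\<Sum>j. \<integral>\<^sup>+w. ?g j w \<partial>lborel)"
    using meas' by (intro nn_integral_suminf) simp
  also have "\<dots> = (\<Sum>j. ennreal (2 ^ ?d * ?V * ((1/2) powr a) ^ j))"
  proof (rule suminf_cong)
    fix j :: nat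
    have "(\<integral>\<^sup>+w. ?g j w \<partial>lborel) = ennreal (C j) * ennreal (?V * ((1/2) ^ j) ^ ?d)"
      by (subst nn_integral_cmult_indicator) (simp_all add: emeasure_ball)
    also have "\<dots> = ennreal (C j * (?V * ((1/2) ^ j) ^ ?d))"
      by (rule ennreal_mult[symmetric]) (simp_all add: C_def)
    also have "C j * (?V * ((1/2) ^ j) ^ ?d) = 2 ^ ?d * ?V * ((1/2) powr a) ^ j"
    proof -
      have "(2 ^ Suc j) ^ ?d * ((1/2) ^ j) ^ ?d = (2 :: real) ^ ?d"
      proof -
        have "(2 :: real) ^ Suc j * (1/2) ^ j = 2" by (simp add: power_one_over)
        then show ?thesis by (simp only: power_mult_distrib[symmetric])
      qed
      moreover have "((1/2 :: real) ^ j) powr a = ((1/2) powr a) ^ j"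
        by (simp add: powr_realpow[symmetric] powr_powr mult.commute)
      ultimately show ?thesis by (simp add: C_def mult_ac)
    qed
    finally show "(\<integral>\<^sup>+w. ?g j w \<partial>lborel) = ennreal (2 ^ ?d * ?V * ((1/2) powr a) ^ j)" .
  qed
  also have "\<dots> = ennreal (2 ^ ?d * ?V * (1 / (1 - (1/2) powr a)))"
  proof (rule suminf_ennreal_eq)
    have "(1/2 :: real) powr a < 1"
      using powr_less_mono2[of a "1/2" 1] a by simp
    then show "(\<lambda>j. 2 ^ ?d * ?V * ((1/2) powr a) ^ j) sums (2 ^ ?d * ?V * (1 / (1 - (1/2) powr a)))"
      by (intro sums_mult geometric_sums) simp
  qed simp
  also have "\<dots> < \<infinity>" by simp
  finally show "(\<integral>\<^sup>+w. ennreal (norm (?h w)) \<partial>lborel) < \<infinity>" .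
qed

text \<open>
  Near the origin the fraction is at most \<open>\<bar>w\<bar>\<^sup>2\<close>, which beats the singularity because \<open>\<alpha> < 2\<close>; away from the
  origin the integrand is comparable to the equilibrium.
\<close>

lemma kappa_integrable:
  fixes e :: "real ^ 'd::finite"
  assumes \<alpha>: "\<alpha> < 2" and m: "m > 0" and e: "norm e = 1" and \<beta>: "\<beta> = \<alpha> + real CARD('d)"  and \<beta>0: "\<beta> > 0"
    and normalised: "(LINT v|lborel. equilibrium m \<beta> (v :: real ^ 'd)) = 1"
  shows "integrable lborel (\<lambda>w. (w \<bullet> e)\<^sup>2 / (1 + (w \<bullet> e)\<^sup>2) * (m / norm w powr \<beta>))"
proof (rule Bochner_Integration.integrable_bound)
  note M = equilibrium_integrable[OF normalised]
  \<comment> \<open>on the complement of the ball \<open>1 \<le> \<bar>w\<bar>\<^sup>\<beta>\<close>, whence the factor \<open>2\<close>\<close>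
  let ?h = "\<lambda>w::real ^ 'd. m * (indicator (ball 0 1) w * norm w powr (2 - \<alpha> - real CARD('d))) + 2 * equilibrium m \<beta> w"
  show "integrable lborel ?h"
    using \<alpha> M by (intro Bochner_Integration.integrable_add integrable_mult_right integrable_norm_powr_unit_ball) auto
  show "AE w in lborel. norm ((w \<bullet> e)\<^sup>2 / (1 + (w \<bullet> e)\<^sup>2) * (m / norm w powr \<beta>)) \<le> norm (?h w)"
  proof (rule AE_I2)
    fix w :: "real ^ 'd"
    let ?x = "(w \<bullet> e)\<^sup>2"
    have Mp: "equilibrium m \<beta> w > 0" by (rule equilibrium_pos[OF m])
    have nn: "?x / (1 + ?x) * (m / norm w powr \<beta>) \<ge> 0" using m by simp
    have pos: "1 + ?x > 0" by (simp add: add_pos_nonneg)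
    have "?x / (1 + ?x) * (m / norm w powr \<beta>) \<le> ?h w"
    proof (cases "w = 0")
      case True
      then show ?thesis using Mp m by simp
    next
      case w: False
      show ?thesis
      proof (cases "norm w < 1")
        case True
        have "\<bar>w \<bullet> e\<bar> \<le> norm w" using Cauchy_Schwarz_ineq2[of w e] e by simp
        then have "?x \<le> (norm w)\<^sup>2" using power_mono[of "\<bar>w \<bullet> e\<bar>" "norm w" 2] by simp
        moreover have "?x / (1 + ?x) \<le> ?x" using pos by (simp add: divide_le_eq distrib_left)
        ultimately have "?x / (1 + ?x) \<le> (norm w)\<^sup>2" by linarith
        then have "?x / (1 + ?x) * (m / norm w powr \<beta>) \<le> (norm w)\<^sup>2 * (m / norm w powr \<beta>)"
          using m by (intro mult_right_mono) auto
        also have "\<dots> = m * norm w powr (2 - \<alpha> - real CARD('d))"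
        proof -
          have "norm w powr (2 - \<alpha> - real CARD('d)) = norm w powr 2 / norm w powr \<beta>"
            unfolding powr_diff[symmetric] by (simp add: \<beta> diff_diff_eq)
          also have "norm w powr 2 = (norm w)\<^sup>2" using w by simp
          finally show ?thesis by simp
        qed
        finally show ?thesis using True Mp by simp
      next
        case False
        then have b: "norm w powr \<beta> \<ge> 1" using \<beta>0 by (intro ge_one_powr_ge_zero) auto
        have "?x / (1 + ?x) * (m / norm w powr \<beta>) \<le> 1 * (m / norm w powr \<beta>)"
          using m pos by (intro mult_right_mono) (auto simp: divide_le_eq)
        also have "\<dots> \<le> 2 * equilibrium m \<beta> w"
          using b m by (simp add: equilibrium_def divide_le_eq field_simps)
        finally show ?thesis using False by simp
      qed
    qed
    then show "norm (?x / (1 + ?x) * (m / norm w powr \<beta>)) \<le> norm (?h w)"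
      using nn by simp
  qed
qed measurable

lemma kappa_nonneg: "m > 0 \<Longrightarrow> kappa \<beta> m e \<ge> 0"
  unfolding kappa_def by (rule Bochner_Integration.integral_nonneg) simp

text \<open>
  The origin of anomalous diffusion.  After the substitution the quotient no longer contains
  \<open>\<epsilon>\<^sup>\<alpha>\<close>, the weight increases to \<open>m / \<bar>w\<bar>\<^sup>\<beta>\<close> as \<open>\<epsilon>\<close> decreases, and dominated convergence
  applies with the integrand of \<open>kappa\<close> as majorant.
\<close>

lemma fractional_symbol_limit:
  fixes e k :: "real ^ 'd::finite"
  assumes \<alpha>: "0 < \<alpha>" "\<alpha> < 2" and m: "m > 0" and e: "norm e = 1" and \<beta>: "\<beta> = \<alpha> + real CARD('d)"
    and normalised: "(LINT v|lborel. equilibrium m \<beta> (v :: real ^ 'd)) = 1"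
  shows "((\<lambda>\<epsilon>. 1 / \<epsilon> powr \<alpha> * (LINT v|lborel. equilibrium m \<beta> v *\<^sub>R ((\<epsilon> * (k \<bullet> v))\<^sup>2 / (1 + (\<epsilon> * (k \<bullet> v))\<^sup>2))))
     \<longlongrightarrow> norm k powr \<alpha> * kappa \<beta> m e) (at_right 0)"
proof (cases "k = 0")
  case True
  then show ?thesis by simp
next
  case k: False
  have \<beta>0: "\<beta> > 0" using \<alpha> \<beta> by simp
  let ?G = "\<lambda>x::real. x\<^sup>2 / (1 + x\<^sup>2)"
  have "((\<lambda>t. LINT w|lborel. weight m \<beta> (inverse t) k w *\<^sub>R ?G (w \<bullet> e)) \<longlongrightarrow> kappa \<beta> m e) at_top"
    unfolding kappa_def
  proof (rule integral_dominated_convergence_at_top)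
    show "integrable lborel (\<lambda>w. ?G (w \<bullet> e) * (m / norm w powr \<beta>))"
      by (rule kappa_integrable) fact+
    show "AE w in lborel. ((\<lambda>t. weight m \<beta> (inverse t) k w *\<^sub>R ?G (w \<bullet> e)) \<longlongrightarrow> ?G (w \<bullet> e) * (m / norm w powr \<beta>)) at_top"
    proof (rule AE_I2)
      fix w :: "real ^ 'd"
      show "((\<lambda>t. weight m \<beta> (inverse t) k w *\<^sub>R ?G (w \<bullet> e)) \<longlongrightarrow> ?G (w \<bullet> e) * (m / norm w powr \<beta>)) at_top"
      proof (cases "w = 0")
        case False
        have "((\<lambda>t. inverse t * norm k) \<longlongrightarrow> 0 * norm k) at_top"
          by (intro tendsto_mult tendsto_inverse_0_at_top filterlim_ident tendsto_const)
        then have "((\<lambda>t. (inverse t * norm k) powr \<beta>) \<longlongrightarrow> (0 * norm k) powr \<beta>) at_top"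
          using \<beta>0 by (intro tendsto_powr' tendsto_const)
             (auto intro!: eventually_mono[OF eventually_gt_at_top[of 0]])
        then have "((\<lambda>t. weight m \<beta> (inverse t) k w *\<^sub>R ?G (w \<bullet> e)) \<longlongrightarrow> (m / ((0 * norm k) powr \<beta> + norm w powr \<beta>)) *\<^sub>R ?G (w \<bullet> e)) at_top"
          unfolding weight_def using False
          by (intro tendsto_scaleR[OF tendsto_divide[OF tendsto_const tendsto_add[OF _ tendsto_const]] tendsto_const]) auto
        then show ?thesis by (simp add: mult.commute)
      qed simp
    qed
    show "\<forall>\<^sub>F t in at_top. AE w in lborel. norm (weight m \<beta> (inverse t) k w *\<^sub>R ?G (w \<bullet> e)) \<le> ?G (w \<bullet> e) * (m / norm w powr \<beta>)"
    proof (intro always_eventually allI AE_I2)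
      fix t :: real and w :: "real ^ 'd"
      show "norm (weight m \<beta> (inverse t) k w *\<^sub>R ?G (w \<bullet> e)) \<le> ?G (w \<bullet> e) * (m / norm w powr \<beta>)"
      proof (cases "w = 0")
        case False
        have G: "?G (w \<bullet> e) \<ge> 0" by simp
        have "weight m \<beta> (inverse t) k w \<ge> 0" using m by (simp add: weight_def)
        moreover have "weight m \<beta> (inverse t) k w \<le> m / norm w powr \<beta>"
          unfolding weight_def using m False by (intro divide_left_mono mult_pos_pos add_nonneg_pos) auto
        ultimately have "norm (weight m \<beta> (inverse t) k w *\<^sub>R ?G (w \<bullet> e)) \<le> m / norm w powr \<beta> * ?G (w \<bullet> e)"
          unfolding real_norm_def real_scaleR_def abs_mult abs_of_nonneg[OF G] using G
          by (intro mult_right_mono) (simp_all only: abs_of_nonneg)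
        then show ?thesis by (simp only: mult.commute)
      qed simp
    qed
  qed (simp_all add: weight_def[abs_def])
  then have "((\<lambda>\<epsilon>. LINT w|lborel. weight m \<beta> \<epsilon> k w *\<^sub>R ?G (w \<bullet> e)) \<longlongrightarrow> kappa \<beta> m e) (at_right 0)"
    unfolding filterlim_at_right_to_top by simp
  then have "((\<lambda>\<epsilon>. norm k powr \<alpha> * (LINT w|lborel. weight m \<beta> \<epsilon> k w *\<^sub>R ?G (w \<bullet> e))) \<longlongrightarrow> norm k powr \<alpha> * kappa \<beta> m e) (at_right 0)"
    by (intro tendsto_mult tendsto_const)
  then show ?thesis
  proof (rule Lim_transform_eventually)
    have "\<forall>\<^sub>F \<epsilon>::real in at_right 0. \<epsilon> > 0"
      by (simp add: eventually_at_right_less)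
    then show "\<forall>\<^sub>F \<epsilon> in at_right 0. norm k powr \<alpha> * (LINT w|lborel. weight m \<beta> \<epsilon> k w *\<^sub>R ?G (w \<bullet> e))
        = 1 / \<epsilon> powr \<alpha> * (LINT v|lborel. equilibrium m \<beta> v *\<^sub>R ?G (\<epsilon> * (k \<bullet> v)))"
    proof eventually_elim
      case (elim \<epsilon>)
      have "?G \<in> borel_measurable borel" by measurable
      from weight_integral_eq_equilibrium_integral[OF this e k elim \<beta>, of m, symmetric] elim
      show ?case by simp
    qed
  qed
qed

lemma norm_ge_one_of_Re_eq_one: "Re z = 1 \<Longrightarrow> norm z \<ge> 1"
  using abs_Re_le_cmod[of z] by simp

lemma norm_relaxation_le:
  assumes z: "Re z = 1" and \<tau>: "\<tau> \<ge> 0"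
  shows "norm ((1 - exp (- of_real \<tau> * z)) / z\<^sup>2) \<le> 2"
proof -
  have "norm (exp (- of_real \<tau> * z)) \<le> 1"
    unfolding norm_exp_unit_rate[OF z] using \<tau> by simp
  then have "norm (1 - exp (- of_real \<tau> * z)) \<le> 2"
    using norm_triangle_ineq4[of 1 "exp (- of_real \<tau> * z)"] unfolding norm_one by linarith
  then have "norm ((1 - exp (- of_real \<tau> * z)) / z\<^sup>2) \<le> 2 / 1"
    unfolding norm_divide norm_power using norm_ge_one_of_Re_eq_one[OF z] by (intro frac_le) auto
  then show ?thesis by simp
qed

text \<open>
  As \<open>\<epsilon>\<close> tends to zero the rate tends to one at each velocity, while the exponential dies out.
\<close>

lemma relaxation_average_limit:
  fixes k :: "real ^ 'd::finite"
  assumes \<alpha>: "0 < \<alpha>" and m: "m > 0" and \<Delta>: "\<Delta> > 0"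
    and normalised: "(LINT v|lborel. equilibrium m \<beta> (v :: real ^ 'd)) = 1"
  shows "((\<lambda>\<epsilon>. LINT v|lborel. equilibrium m \<beta> v *\<^sub>R
       ((1 - exp (- of_real (\<Delta> / \<epsilon> powr \<alpha>) * rate \<epsilon> k v)) / (rate \<epsilon> k v)\<^sup>2)) \<longlongrightarrow> (1 :: complex)) (at_right 0)"
proof -
  note M = equilibrium_integrable[OF normalised]
  let ?\<tau> = "\<lambda>t. \<Delta> / inverse t powr \<alpha>"
  let ?H = "\<lambda>t v. (1 - exp (- of_real (?\<tau> t) * rate (inverse t) k v)) / (rate (inverse t) k v)\<^sup>2"
  have "((\<lambda>t. LINT v|lborel. equilibrium m \<beta> v *\<^sub>R ?H t v) \<longlongrightarrow> (LINT v|lborel. equilibrium m \<beta> (v :: real ^ 'd) *\<^sub>R (1 :: complex))) at_top"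
  proof (rule integral_dominated_convergence_at_top[where w = "\<lambda>v. equilibrium m \<beta> v * 2"])
    show "integrable lborel (\<lambda>v. equilibrium m \<beta> (v :: real ^ 'd) * 2)"
      using M by simp
    show "AE v in lborel. ((\<lambda>t. equilibrium m \<beta> v *\<^sub>R ?H t v) \<longlongrightarrow> equilibrium m \<beta> v *\<^sub>R 1) at_top"
    proof (rule AE_I2)
      fix v :: "real ^ 'd"
      have "((\<lambda>t. 1 + \<i> * complex_of_real (inverse t * (k \<bullet> v))) \<longlongrightarrow> 1 + \<i> * complex_of_real (0 * (k \<bullet> v))) at_top"
        by (intro tendsto_intros tendsto_inverse_0_at_top filterlim_ident)
      then have z: "((\<lambda>t. rate (inverse t) k v) \<longlongrightarrow> 1) at_top"
        by (simp add: rate_def)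
      have "((\<lambda>t. exp (- ?\<tau> t)) \<longlongrightarrow> 0) at_top"
        using \<Delta> \<alpha> by real_asymp
      then have "((\<lambda>t. norm (exp (- of_real (?\<tau> t) * rate (inverse t) k v))) \<longlongrightarrow> 0) at_top"
        unfolding norm_exp_unit_rate[OF Re_rate] .
      then have E: "((\<lambda>t. exp (- of_real (?\<tau> t) * rate (inverse t) k v)) \<longlongrightarrow> 0) at_top"
        by (rule tendsto_norm_zero_cancel)
      have "((\<lambda>t. equilibrium m \<beta> v *\<^sub>R ?H t v) \<longlongrightarrow> equilibrium m \<beta> v *\<^sub>R ((1 - 0) / 1\<^sup>2)) at_top"
        by (intro tendsto_intros z E) simp
      then show "((\<lambda>t. equilibrium m \<beta> v *\<^sub>R ?H t v) \<longlongrightarrow> equilibrium m \<beta> v *\<^sub>R 1) at_top"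
        by simp
    qed
    show "\<forall>\<^sub>F t in at_top. AE v in lborel. norm (equilibrium m \<beta> v *\<^sub>R ?H t v) \<le> equilibrium m \<beta> v * 2"
      using eventually_gt_at_top[of 0]
    proof eventually_elim
      case (elim t)
      show ?case
      proof (rule AE_I2)
        fix v :: "real ^ 'd"
        have "norm (?H t v) \<le> 2"
          by (rule norm_relaxation_le[OF Re_rate]) (use \<Delta> in simp)
        then show "norm (equilibrium m \<beta> v *\<^sub>R ?H t v) \<le> equilibrium m \<beta> v * 2"
          using equilibrium_pos[OF m, of \<beta> v] by (simp add: mult_left_mono)
      qed
    qed
  qed measurable
  moreover have "(LINT v|lborel. equilibrium m \<beta> (v :: real ^ 'd) *\<^sub>R (1 :: complex)) = 1"
    using normalised by (simp add: scaleR_conv_of_real)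
  ultimately show ?thesis
    unfolding filterlim_at_right_to_top by (simp only:)
qed

text \<open>
  The denominator of the scheme degenerates like \<open>\<epsilon>\<^sup>\<alpha> / \<Delta>\<close>, so the step is rescaled by \<open>\<tau> = \<Delta> / \<epsilon>\<^sup>\<alpha>\<close>.
  With \<open>z = 1 + \<i> X\<close> one has \<open>1 - 1 / z = X\<^sup>2 / (1 + X\<^sup>2) + \<i> X / (1 + X\<^sup>2)\<close>; the second term is odd in the
  velocity and averages to zero, the first yields the fractional diffusion coefficient, and the rest
  of the kernel yields the \<open>1\<close>.
\<close>

lemma rescaled_denominator_limit:
  fixes e k :: "real ^ 'd::finite"
  assumes \<alpha>: "0 < \<alpha>" "\<alpha> < 2" and m: "m > 0" and e: "norm e = 1" and \<beta>: "\<beta> = \<alpha> + real CARD('d)" and \<Delta>: "\<Delta> > 0"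
    and normalised: "(LINT v|lborel. equilibrium m \<beta> (v :: real ^ 'd)) = 1"
  shows "((\<lambda>\<epsilon>. of_real (\<Delta> / \<epsilon> powr \<alpha>) * (1 - coeff_c \<alpha> \<beta> m e \<epsilon> \<Delta> k 0))
     \<longlongrightarrow> 1 + of_real (\<Delta> * (kappa \<beta> m e * norm k powr \<alpha>))) (at_right 0)"
proof -
  note M = equilibrium_integrable[OF normalised]
  let ?X = "\<lambda>\<epsilon> v. \<epsilon> * (k \<bullet> v)"
  let ?P = "\<lambda>\<epsilon>. LINT v|lborel. equilibrium m \<beta> v *\<^sub>R ((?X \<epsilon> v)\<^sup>2 / (1 + (?X \<epsilon> v)\<^sup>2))"
  let ?H = "\<lambda>\<epsilon> v. (1 - exp (- of_real (\<Delta> / \<epsilon> powr \<alpha>) * rate \<epsilon> k v)) / (rate \<epsilon> k v)\<^sup>2"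
  let ?R = "\<lambda>\<epsilon>. LINT v|lborel. equilibrium m \<beta> v *\<^sub>R ?H \<epsilon> v"
  have "((\<lambda>\<epsilon>. of_real (\<Delta> * (1 / \<epsilon> powr \<alpha> * ?P \<epsilon>)) + ?R \<epsilon>)
      \<longlongrightarrow> complex_of_real (\<Delta> * (norm k powr \<alpha> * kappa \<beta> m e)) + 1) (at_right 0)"
    by (intro tendsto_add tendsto_of_real tendsto_mult[OF tendsto_const]
        fractional_symbol_limit[OF \<alpha> m e \<beta> normalised] relaxation_average_limit[OF \<alpha>(1) m \<Delta> normalised])
  then have lim: "((\<lambda>\<epsilon>. of_real (\<Delta> * (1 / \<epsilon> powr \<alpha> * ?P \<epsilon>)) + ?R \<epsilon>)
      \<longlongrightarrow> 1 + of_real (\<Delta> * (kappa \<beta> m e * norm k powr \<alpha>))) (at_right 0)"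
    by (simp add: mult.commute add.commute)
  show ?thesis
  proof (rule Lim_transform_eventually[OF lim])
    have "\<forall>\<^sub>F \<epsilon>::real in at_right 0. \<epsilon> > 0"
      by (simp add: eventually_at_right_less)
    then show "\<forall>\<^sub>F \<epsilon> in at_right 0. of_real (\<Delta> * (1 / \<epsilon> powr \<alpha> * ?P \<epsilon>)) + ?R \<epsilon>
        = of_real (\<Delta> / \<epsilon> powr \<alpha>) * (1 - coeff_c \<alpha> \<beta> m e \<epsilon> \<Delta> k 0)"
    proof eventually_elim
      case (elim \<epsilon>)
      define \<tau> where "\<tau> = \<Delta> / \<epsilon> powr \<alpha>"
      have \<tau>: "\<tau> > 0" using \<Delta> elim by (simp add: \<tau>_def)
      define z where "z = rate \<epsilon> k"
      define X where "X = ?X \<epsilon>"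
      define H where "H v = (1 - exp (- of_real \<tau> * z v)) / (z v)\<^sup>2" for v
      have zm [measurable]: "z \<in> borel_measurable borel" by (simp add: z_def)
      have Xm [measurable]: "X \<in> borel_measurable borel" unfolding X_def by measurable
      have zX: "z v = 1 + \<i> * of_real (X v)" for v by (simp add: z_def rate_def X_def)
      have X1: "1 + (X v)\<^sup>2 > 0" for v by (simp add: add_pos_nonneg)
      have split: "1 - kernel_c \<tau> 0 (z v) = of_real ((X v)\<^sup>2 / (1 + (X v)\<^sup>2))
          + \<i> * of_real (X v / (1 + (X v)\<^sup>2)) + (1 / of_real \<tau>) * H v" for v
      proof -
        define c where "c = complex_of_real (1 + (X v)\<^sup>2)"
        have z0: "z v \<noteq> 0" by (auto simp: zX complex_eq_iff)
        have c0: "c \<noteq> 0" using X1[of v] unfolding c_def of_real_eq_0_iff by linarith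
        have "z v * (1 - \<i> * of_real (X v)) = c"
          by (simp add: zX c_def algebra_simps power2_eq_square)
        then have "1 / z v = (1 - \<i> * of_real (X v)) / c"
          unfolding frac_eq_eq[OF z0 c0] by (simp add: mult.commute)
        then have "1 - 1 / z v = (c - (1 - \<i> * of_real (X v))) / c"
          using c0 by (simp add: diff_divide_distrib)
        also have "c - (1 - \<i> * of_real (X v)) = of_real ((X v)\<^sup>2) + \<i> * of_real (X v)"
          by (simp add: c_def)
        finally have one: "1 - 1 / z v = of_real ((X v)\<^sup>2 / (1 + (X v)\<^sup>2)) + \<i> * of_real (X v / (1 + (X v)\<^sup>2))"
          unfolding c_def by (simp only: add_divide_distrib of_real_divide times_divide_eq_right)
        have kc: "kernel_c \<tau> 0 (z v) = 1 / z v - (1 / of_real \<tau>) * H v"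
          by (simp add: kernel_c_def H_def)
        show ?thesis unfolding kc one[symmetric] by simp
      qed
      have H2: "norm (H v) \<le> 2" for v
        unfolding H_def z_def using \<tau> by (intro norm_relaxation_le Re_rate) simp
      have Q: "\<bar>(X v)\<^sup>2 / (1 + (X v)\<^sup>2)\<bar> \<le> 1" "\<bar>X v / (1 + (X v)\<^sup>2)\<bar> \<le> 1" for v
      proof -
        show "\<bar>(X v)\<^sup>2 / (1 + (X v)\<^sup>2)\<bar> \<le> 1" using X1[of v] by (simp add: divide_le_eq)
        have "0 \<le> (\<bar>X v\<bar> - 1)\<^sup>2" by simp
        then have "2 * \<bar>X v\<bar> \<le> 1 + (X v)\<^sup>2" by (simp add: power2_diff)
        then show "\<bar>X v / (1 + (X v)\<^sup>2)\<bar> \<le> 1" using X1[of v] by (simp add: divide_le_eq abs_divide)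
      qed
      have [measurable]: "H \<in> borel_measurable borel" unfolding H_def[abs_def] by measurable
      have i1: "integrable lborel (\<lambda>v. equilibrium m \<beta> v *\<^sub>R ((X v)\<^sup>2 / (1 + (X v)\<^sup>2)))"
        by (rule equilibrium_average_integrable[OF normalised, where D = 1]) (measurable, simp add: Q(1)[simplified])
      have i2: "integrable lborel (\<lambda>v. equilibrium m \<beta> v *\<^sub>R (X v / (1 + (X v)\<^sup>2)))"
        by (rule equilibrium_average_integrable[OF normalised, where D = 1]) (measurable, use Q(2) in simp)
      have i3: "integrable lborel (\<lambda>v. equilibrium m \<beta> v *\<^sub>R H v)"
        by (rule equilibrium_average_integrable[OF normalised _ H2]) measurable
      have ic: "integrable lborel (\<lambda>v. equilibrium m \<beta> v *\<^sub>R kernel_c \<tau> 0 (z v))"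
        unfolding z_def by (rule equilibrium_average_integrable[OF normalised _ norm_kernel_le(1)[OF Re_rate \<tau>]]) measurable
      have odd: "(LINT v|lborel. equilibrium m \<beta> v *\<^sub>R (X v / (1 + (X v)\<^sup>2))) = 0"
        by (rule equilibrium_average_odd) (measurable, simp add: X_def)
      have "1 - coeff_c \<alpha> \<beta> m e \<epsilon> \<Delta> k 0 = (LINT v|lborel. equilibrium m \<beta> (v :: real ^ 'd) *\<^sub>R (1 :: complex))
          - (LINT v|lborel. equilibrium m \<beta> v *\<^sub>R kernel_c \<tau> 0 (z v))"
        unfolding coeff_eq_kernel_average[OF e \<beta> elim normalised] \<tau>_def z_def
        using normalised by (simp add: scaleR_conv_of_real)
      also have "\<dots> = (LINT v|lborel. equilibrium m \<beta> v *\<^sub>R (1 - kernel_c \<tau> 0 (z v)))"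
        using M ic by (simp add: scaleR_diff_right)
      also have "\<dots> = (LINT v|lborel. of_real (equilibrium m \<beta> v *\<^sub>R ((X v)\<^sup>2 / (1 + (X v)\<^sup>2)))
          + \<i> * of_real (equilibrium m \<beta> v *\<^sub>R (X v / (1 + (X v)\<^sup>2))) + (1 / of_real \<tau>) * (equilibrium m \<beta> v *\<^sub>R H v))"
        by (rule Bochner_Integration.integral_cong[OF refl]) (simp only: split real_scaleR_def scaleR_conv_of_real of_real_mult of_real_eq_id id_apply distrib_left mult_ac)
      also have "\<dots> = of_real (?P \<epsilon>) + (1 / of_real \<tau>) * (LINT v|lborel. equilibrium m \<beta> v *\<^sub>R H v)"
      proof -
        note j = integrable_of_real[OF i1, where 'a = complex] integrable_mult_right[OF integrable_of_real[OF i2, where 'a = complex], of \<i>]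
          integrable_mult_right[OF i3, of "1 / of_real \<tau>"]
        show ?thesis
          unfolding Bochner_Integration.integral_add[OF Bochner_Integration.integrable_add[OF j(1,2)] j(3)]
            Bochner_Integration.integral_add[OF j(1,2)] integral_mult_right_zero integral_complex_of_real odd
          by (simp add: X_def)
      qed
      also have "(LINT v|lborel. equilibrium m \<beta> v *\<^sub>R H v) = ?R \<epsilon>"
        by (simp add: H_def z_def \<tau>_def)
      finally have "of_real \<tau> * (1 - coeff_c \<alpha> \<beta> m e \<epsilon> \<Delta> k 0) = of_real \<tau> * of_real (?P \<epsilon>) + ?R \<epsilon>"
        using \<tau> by (simp only:) (simp add: distrib_left)
      then show ?case by (simp add: \<tau>_def)
    qed
  qed
qed

lemma rescaled_exponential_limit:
  assumes "0 < \<alpha>" "0 < \<Delta>"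
  shows "((\<lambda>\<epsilon>::real. \<Delta> / \<epsilon> powr \<alpha> * exp (- (\<Delta> / \<epsilon> powr \<alpha>))) \<longlongrightarrow> 0) (at_right 0)"
  using assms by real_asymp

text \<open>
  The weight of the previous value is of the same order as the denominator and survives the
  limit.
\<close>

lemma rescaled_newest_weight_limit:
  fixes e k :: "real ^ 'd::finite"
  assumes \<alpha>: "0 < \<alpha>" and m: "m > 0" and e: "norm e = 1" and \<beta>: "\<beta> = \<alpha> + real CARD('d)" and \<Delta>: "\<Delta> > 0"
    and normalised: "(LINT v|lborel. equilibrium m \<beta> (v :: real ^ 'd)) = 1"
  shows "((\<lambda>\<epsilon>. of_real (\<Delta> / \<epsilon> powr \<alpha>) * coeff_b \<alpha> \<beta> m e \<epsilon> \<Delta> k 0) \<longlongrightarrow> 1) (at_right 0)"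
proof -
  let ?H = "\<lambda>\<epsilon> v. (1 - exp (- of_real (\<Delta> / \<epsilon> powr \<alpha>) * rate \<epsilon> k v)) / (rate \<epsilon> k v)\<^sup>2"
  let ?R = "\<lambda>\<epsilon>. LINT v|lborel. equilibrium m \<beta> v *\<^sub>R ?H \<epsilon> v"
  have R: "(?R \<longlongrightarrow> 1) (at_right 0)"
    by (rule relaxation_average_limit[OF \<alpha> m \<Delta> normalised])
  have "((\<lambda>\<epsilon>. of_real (\<Delta> / \<epsilon> powr \<alpha>) * coeff_b \<alpha> \<beta> m e \<epsilon> \<Delta> k 0 - ?R \<epsilon>) \<longlongrightarrow> 0) (at_right 0)"
  proof (rule Lim_null_comparison[OF _ rescaled_exponential_limit[OF \<alpha> \<Delta>]])
    have "\<forall>\<^sub>F \<epsilon>::real in at_right 0. \<epsilon> > 0"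
      by (simp add: eventually_at_right_less)
    then show "\<forall>\<^sub>F \<epsilon> in at_right 0. norm (of_real (\<Delta> / \<epsilon> powr \<alpha>) * coeff_b \<alpha> \<beta> m e \<epsilon> \<Delta> k 0 - ?R \<epsilon>)
        \<le> \<Delta> / \<epsilon> powr \<alpha> * exp (- (\<Delta> / \<epsilon> powr \<alpha>))"
    proof eventually_elim
      case (elim \<epsilon>)
      define \<tau> where "\<tau> = \<Delta> / \<epsilon> powr \<alpha>"
      have \<tau>: "\<tau> > 0" using \<Delta> elim by (simp add: \<tau>_def)
      define z where "z = rate \<epsilon> k"
      have zm [measurable]: "z \<in> borel_measurable borel" by (simp add: z_def)
      let ?E = "\<lambda>v. exp (- of_real \<tau> * z v) / z v"
      have E: "norm (?E v) \<le> exp (- \<tau>)" for v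
      proof -
        have "norm (z v) \<ge> 1" unfolding z_def by (rule norm_ge_one_of_Re_eq_one[OF Re_rate])
        then have "norm (?E v) \<le> exp (- \<tau>) / 1"
          unfolding norm_divide z_def norm_exp_unit_rate[OF Re_rate] by (intro frac_le) auto
        then show ?thesis by simp
      qed
      have ib: "integrable lborel (\<lambda>v. equilibrium m \<beta> v *\<^sub>R kernel_b \<tau> 0 (z v))"
        unfolding z_def by (rule equilibrium_average_integrable[OF normalised _ norm_kernel_le(2)[OF Re_rate \<tau>]]) measurable
      have iE: "integrable lborel (\<lambda>v. equilibrium m \<beta> v *\<^sub>R ?E v)"
        by (rule equilibrium_average_integrable[OF normalised _ E]) measurable
      have eq: "equilibrium m \<beta> v *\<^sub>R ?H \<epsilon> v
          = of_real \<tau> * (equilibrium m \<beta> v *\<^sub>R kernel_b \<tau> 0 (z v)) + of_real \<tau> * (equilibrium m \<beta> v *\<^sub>R ?E v)" for v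
      proof -
        have alg: "t * (x / (t * y) - w) + t * w = x / y" if "t \<noteq> 0" for t x y w :: complex
          using that by (simp add: right_diff_distrib)
        have "kernel_b \<tau> 0 (z v) = (1 - exp (- of_real \<tau> * z v)) / (of_real \<tau> * (z v)\<^sup>2) - ?E v"
          by (simp add: kernel_b_def)
        then have "of_real \<tau> * kernel_b \<tau> 0 (z v) + of_real \<tau> * ?E v = ?H \<epsilon> v"
          using \<tau> by (simp only: alg z_def \<tau>_def of_real_eq_0_iff)
        then show ?thesis
          by (metis (no_types, lifting) mult_scaleR_right scaleR_add_right)
      qed
      have "?R \<epsilon> = of_real \<tau> * coeff_b \<alpha> \<beta> m e \<epsilon> \<Delta> k 0 + of_real \<tau> * (LINT v|lborel. equilibrium m \<beta> v *\<^sub>R ?E v)"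
        unfolding eq
        unfolding coeff_eq_kernel_average[OF e \<beta> elim normalised] \<tau>_def[symmetric] z_def[symmetric]
        unfolding Bochner_Integration.integral_add[OF integrable_mult_right[OF ib] integrable_mult_right[OF iE]]
          integral_mult_right_zero by (rule refl)
      then have "norm (of_real \<tau> * coeff_b \<alpha> \<beta> m e \<epsilon> \<Delta> k 0 - ?R \<epsilon>)
          = \<tau> * norm (LINT v|lborel. equilibrium m \<beta> v *\<^sub>R ?E v)"
        using \<tau> by (simp add: norm_mult)
      also have "\<dots> \<le> \<tau> * exp (- \<tau>)"
        using \<tau> by (intro mult_left_mono equilibrium_average_bound[OF m normalised E]) auto
      finally show ?case by (simp only: \<tau>_def)
    qed
  qed
  from tendsto_add[OF this R] show ?thesis by simp
qed

text \<open>
  Older values carry a factor \<open>exp (- \<tau>)\<close>, which outweighs the rescaling by \<open>\<tau>\<close>: the memory is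
  lost.
\<close>

lemma rescaled_old_weight_limit:
  fixes e k :: "real ^ 'd::finite"
  assumes \<alpha>: "0 < \<alpha>" and m: "m > 0" and e: "norm e = 1" and \<beta>: "\<beta> = \<alpha> + real CARD('d)" and \<Delta>: "\<Delta> > 0"
    and normalised: "(LINT v|lborel. equilibrium m \<beta> (v :: real ^ 'd)) = 1" and j: "j \<ge> 1"
  shows "((\<lambda>\<epsilon>. of_real (\<Delta> / \<epsilon> powr \<alpha>) * coeff_c \<alpha> \<beta> m e \<epsilon> \<Delta> k j) \<longlongrightarrow> 0) (at_right 0)"
    and "((\<lambda>\<epsilon>. of_real (\<Delta> / \<epsilon> powr \<alpha>) * coeff_b \<alpha> \<beta> m e \<epsilon> \<Delta> k j) \<longlongrightarrow> 0) (at_right 0)"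
proof -
  have *: "((\<lambda>\<epsilon>. of_real (\<Delta> / \<epsilon> powr \<alpha>) * g \<epsilon>) \<longlongrightarrow> 0) (at_right 0)"
    if g: "\<And>\<epsilon>. \<epsilon> > 0 \<Longrightarrow> norm (g \<epsilon>) \<le> exp (- (real j * (\<Delta> / \<epsilon> powr \<alpha>)))" for g :: "real \<Rightarrow> complex"
  proof (rule Lim_null_comparison[OF _ rescaled_exponential_limit[OF \<alpha> \<Delta>]])
    have "\<forall>\<^sub>F \<epsilon>::real in at_right 0. \<epsilon> > 0"
      by (simp add: eventually_at_right_less)
    then show "\<forall>\<^sub>F \<epsilon> in at_right 0. norm (of_real (\<Delta> / \<epsilon> powr \<alpha>) * g \<epsilon>) \<le> \<Delta> / \<epsilon> powr \<alpha> * exp (- (\<Delta> / \<epsilon> powr \<alpha>))"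
    proof eventually_elim
      case (elim \<epsilon>)
      define \<tau> where "\<tau> = \<Delta> / \<epsilon> powr \<alpha>"
      have \<tau>: "\<tau> > 0" using \<Delta> elim by (simp add: \<tau>_def)
      have "1 * \<tau> \<le> real j * \<tau>" using j \<tau> by (intro mult_right_mono) auto
      then have "norm (g \<epsilon>) \<le> exp (- \<tau>)"
        using g[OF elim] unfolding \<tau>_def[symmetric] by (rule_tac order_trans) auto
      then show ?case
        unfolding \<tau>_def[symmetric] norm_mult using \<tau> by (simp add: mult_left_mono)
    qed
  qed
  have le: "decay_c \<tau> j \<le> exp (- (real j * \<tau>))" "decay_b \<tau> j \<le> exp (- (real j * \<tau>))" if "\<tau> > 0" for \<tau>
  proof -
    have "(1 - exp (- \<tau>)) / \<tau> \<le> 1" "(1 - exp (- \<tau>)) / \<tau> \<ge> 0"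
      using one_minus_exp_bounds[OF that] that by (simp_all add: divide_le_eq)
    moreover have "exp (- \<tau>) \<ge> 0" by simp
    ultimately have d: "1 - (1 - exp (- \<tau>)) / \<tau> \<le> 1" "(1 - exp (- \<tau>)) / \<tau> - exp (- \<tau>) \<le> 1"
      by linarith+
    show "decay_c \<tau> j \<le> exp (- (real j * \<tau>))" "decay_b \<tau> j \<le> exp (- (real j * \<tau>))"
      unfolding decay_c_def decay_b_def by (rule mult_left_le[OF d(1) exp_ge_zero] mult_left_le[OF d(2) exp_ge_zero])+
  qed
  have pos: "\<Delta> / \<epsilon> powr \<alpha> > 0" if "\<epsilon> > 0" for \<epsilon> using \<Delta> that by simp
  show "((\<lambda>\<epsilon>. of_real (\<Delta> / \<epsilon> powr \<alpha>) * coeff_c \<alpha> \<beta> m e \<epsilon> \<Delta> k j) \<longlongrightarrow> 0) (at_right 0)"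
    by (rule *) (rule order_trans[OF norm_coeff_le(1)[OF m e \<beta> _ \<Delta> normalised] le(1)[OF pos]])
  show "((\<lambda>\<epsilon>. of_real (\<Delta> / \<epsilon> powr \<alpha>) * coeff_b \<alpha> \<beta> m e \<epsilon> \<Delta> k j) \<longlongrightarrow> 0) (at_right 0)"
    by (rule *) (rule order_trans[OF norm_coeff_le(2)[OF m e \<beta> _ \<Delta> normalised] le(2)[OF pos]])
qed

text \<open>
  The initial layer is damped by \<open>exp (- n \<tau>)\<close>, whatever the initial datum.
\<close>

lemma rescaled_initial_layer_limit:
  fixes k :: "real ^ 'd::finite"
  assumes \<alpha>: "0 < \<alpha>" and \<Delta>: "\<Delta> > 0" and n: "n \<ge> 1"
  shows "((\<lambda>\<epsilon>. of_real (\<Delta> / \<epsilon> powr \<alpha>) * A0_hat lo hi \<alpha> \<epsilon> f0 k (real n * \<Delta>)) \<longlongrightarrow> 0) (at_right 0)"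
proof (rule Lim_null_comparison)
  let ?K = "LINT v|lborel. norm (f0_hat lo hi f0 k v)"
  show "((\<lambda>\<epsilon>::real. \<Delta> / \<epsilon> powr \<alpha> * exp (- (\<Delta> / \<epsilon> powr \<alpha>)) * ?K) \<longlongrightarrow> 0) (at_right 0)"
    by (rule tendsto_mult_left_zero[OF rescaled_exponential_limit[OF \<alpha> \<Delta>]])
  have "\<forall>\<^sub>F \<epsilon>::real in at_right 0. \<epsilon> > 0"
    by (simp add: eventually_at_right_less)
  then show "\<forall>\<^sub>F \<epsilon> in at_right 0. norm (of_real (\<Delta> / \<epsilon> powr \<alpha>) * A0_hat lo hi \<alpha> \<epsilon> f0 k (real n * \<Delta>))
      \<le> \<Delta> / \<epsilon> powr \<alpha> * exp (- (\<Delta> / \<epsilon> powr \<alpha>)) * ?K"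
  proof eventually_elim
    case (elim \<epsilon>)
    define \<tau> where "\<tau> = \<Delta> / \<epsilon> powr \<alpha>"
    have \<tau>: "\<tau> > 0" using \<Delta> elim by (simp add: \<tau>_def)
    have n\<tau>: "real n * \<Delta> / \<epsilon> powr \<alpha> = real n * \<tau>" by (simp add: \<tau>_def)
    have "norm (A0_hat lo hi \<alpha> \<epsilon> f0 k (real n * \<Delta>))
        \<le> (LINT v|lborel. norm (exp (- of_real (real n * \<tau>) * rate \<epsilon> k v) * f0_hat lo hi f0 k v))"
      unfolding A0_hat_def rate_def[symmetric] n\<tau> by (rule integral_norm_bound)
    also have "\<dots> = exp (- (real n * \<tau>)) * ?K"
      unfolding norm_mult norm_exp_unit_rate[OF Re_rate] by simp
    also have "\<dots> \<le> exp (- \<tau>) * ?K"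
    proof (rule mult_right_mono)
      have "1 * \<tau> \<le> real n * \<tau>" using n \<tau> by (intro mult_right_mono) auto
      then show "exp (- (real n * \<tau>)) \<le> exp (- \<tau>)" by simp
    qed simp
    finally show ?case
      unfolding \<tau>_def[symmetric] norm_mult using \<tau> by (simp add: mult_left_mono mult.assoc)
  qed
qed

text \<open>
  The implicit Euler method for \<open>u' = - a u\<close>, with \<open>h\<close> the product of the time step and \<open>a\<close>.
\<close>

definition implicit_euler :: "real \<Rightarrow> complex \<Rightarrow> nat \<Rightarrow> complex" where
  "implicit_euler h r n = r / (1 + of_real h) ^ n"

text \<open>
  Numerator and denominator of the step are multiplied by \<open>\<tau>\<close>.  In the limit only the previous
  value survives in the numerator, and the denominator is that of the implicit Euler method.
\<close>

lemma duhamel_scheme_limit: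
  fixes e lo hi k :: "real ^ 'd::finite"
  assumes \<alpha>: "0 < \<alpha>" "\<alpha> < 2" and m: "m > 0" and e: "norm e = 1" and \<beta>: "\<beta> = \<alpha> + real CARD('d)" and \<Delta>: "\<Delta> > 0"
    and normalised: "(LINT v|lborel. equilibrium m \<beta> (v :: real ^ 'd)) = 1"
  shows "((\<lambda>\<epsilon>. duhamel_scheme lo hi \<alpha> \<beta> m e \<epsilon> \<Delta> f0 k n)
     \<longlongrightarrow> implicit_euler (\<Delta> * (kappa \<beta> m e * norm k powr \<alpha>)) (rho0_hat lo hi f0 k) n) (at_right 0)"
proof (induction n rule: less_induct)
  case (less n)
  show ?case
  proof (cases n)
    case 0
    then show ?thesis by (simp add: duhamel_scheme_def implicit_euler_def)
  next
    case (Suc p)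
    let ?S = "\<lambda>\<epsilon> i. duhamel_scheme lo hi \<alpha> \<beta> m e \<epsilon> \<Delta> f0 k i"
    let ?c = "\<lambda>\<epsilon>. coeff_c \<alpha> \<beta> m e \<epsilon> \<Delta> k" and ?b = "\<lambda>\<epsilon>. coeff_b \<alpha> \<beta> m e \<epsilon> \<Delta> k"
    let ?A = "\<lambda>\<epsilon> n. A0_hat lo hi \<alpha> \<epsilon> f0 k (real n * \<Delta>)"
    let ?t = "\<lambda>\<epsilon>. complex_of_real (\<Delta> / \<epsilon> powr \<alpha>)"
    define h where "h = \<Delta> * (kappa \<beta> m e * norm k powr \<alpha>)"
    have h: "h \<ge> 0" using \<Delta> kappa_nonneg[OF m, of \<beta> e] by (simp add: h_def)
    have h1: "1 + complex_of_real h \<noteq> 0"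
      using h by (metis add_nonneg_pos add.commute less_irrefl of_real_1 of_real_add of_real_eq_0_iff zero_less_one)
    define L where "L = implicit_euler h (rho0_hat lo hi f0 k)"
    have IH: "((\<lambda>\<epsilon>. ?S \<epsilon> i) \<longlongrightarrow> L i) (at_right 0)" if "i \<le> p" for i
      using less[of i] that Suc by (simp add: L_def h_def)
    have old: "((\<lambda>\<epsilon>. (?t \<epsilon> * ?c \<epsilon> j) * ?S \<epsilon> (p + 1 - j) + (?t \<epsilon> * ?b \<epsilon> j) * ?S \<epsilon> (p - j)) \<longlongrightarrow> 0) (at_right 0)"
      if "j \<in> {1..p}" for j
    proof -
      have "((\<lambda>\<epsilon>. (?t \<epsilon> * ?c \<epsilon> j) * ?S \<epsilon> (p + 1 - j) + (?t \<epsilon> * ?b \<epsilon> j) * ?S \<epsilon> (p - j))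
          \<longlongrightarrow> 0 * L (p + 1 - j) + 0 * L (p - j)) (at_right 0)"
        using that by (intro tendsto_add tendsto_mult rescaled_old_weight_limit[OF \<alpha>(1) m e \<beta> \<Delta> normalised] IH) auto
      then show ?thesis by simp
    qed
    have "((\<lambda>\<epsilon>. (?t \<epsilon> * ?A \<epsilon> (p + 1)
        + (\<Sum>j=1..p. (?t \<epsilon> * ?c \<epsilon> j) * ?S \<epsilon> (p + 1 - j) + (?t \<epsilon> * ?b \<epsilon> j) * ?S \<epsilon> (p - j))
        + (?t \<epsilon> * ?b \<epsilon> 0) * ?S \<epsilon> p) / (?t \<epsilon> * (1 - ?c \<epsilon> 0)))
        \<longlongrightarrow> (0 + (\<Sum>j=1..p. 0) + 1 * L p) / (1 + of_real h)) (at_right 0)"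
      unfolding h_def
      by (intro tendsto_divide tendsto_add tendsto_sum old tendsto_mult IH
          rescaled_initial_layer_limit[OF \<alpha>(1) \<Delta>] rescaled_newest_weight_limit[OF \<alpha>(1) m e \<beta> \<Delta> normalised]
          rescaled_denominator_limit[OF \<alpha> m e \<beta> \<Delta> normalised]) (use h1 in \<open>auto simp: h_def\<close>)
    then have lim: "((\<lambda>\<epsilon>. (?t \<epsilon> * ?A \<epsilon> (p + 1)
        + (\<Sum>j=1..p. (?t \<epsilon> * ?c \<epsilon> j) * ?S \<epsilon> (p + 1 - j) + (?t \<epsilon> * ?b \<epsilon> j) * ?S \<epsilon> (p - j))
        + (?t \<epsilon> * ?b \<epsilon> 0) * ?S \<epsilon> p) / (?t \<epsilon> * (1 - ?c \<epsilon> 0))) \<longlongrightarrow> L n) (at_right 0)"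
      by (simp add: L_def implicit_euler_def Suc mult.commute)
    show ?thesis
      unfolding h_def[symmetric] L_def[symmetric]
    proof (rule Lim_transform_eventually[OF lim])
      have "\<forall>\<^sub>F \<epsilon>::real in at_right 0. \<epsilon> > 0"
        by (simp add: eventually_at_right_less)
      then show "\<forall>\<^sub>F \<epsilon> in at_right 0. (?t \<epsilon> * ?A \<epsilon> (p + 1)
        + (\<Sum>j=1..p. (?t \<epsilon> * ?c \<epsilon> j) * ?S \<epsilon> (p + 1 - j) + (?t \<epsilon> * ?b \<epsilon> j) * ?S \<epsilon> (p - j))
        + (?t \<epsilon> * ?b \<epsilon> 0) * ?S \<epsilon> p) / (?t \<epsilon> * (1 - ?c \<epsilon> 0)) = ?S \<epsilon> n"
      proof eventually_elim
        case (elim \<epsilon>)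
        have t: "?t \<epsilon> \<noteq> 0" using \<Delta> elim by simp
        have "?S \<epsilon> n = history_step (?A \<epsilon>) (?b \<epsilon>) (?c \<epsilon>) (?S \<epsilon>) p"
          by (simp add: duhamel_scheme_def Suc)
        also have "\<dots> = (?t \<epsilon> * (?A \<epsilon> (p + 1) + (\<Sum>j=1..p. ?c \<epsilon> j * ?S \<epsilon> (p + 1 - j) + ?b \<epsilon> j * ?S \<epsilon> (p - j))
            + ?b \<epsilon> 0 * ?S \<epsilon> p)) / (?t \<epsilon> * (1 - ?c \<epsilon> 0))"
          unfolding history_step_def by (rule mult_divide_mult_cancel_left[OF t, symmetric])
        finally show ?case
          by (simp only: distrib_left sum_distrib_left mult.assoc)
      qed
    qed
  qed
qed


section \<open>The limit scheme\<close>

lemma implicit_euler_recursion: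
  assumes "a \<ge> 0" "\<Delta> > 0"
  shows "(implicit_euler (\<Delta> * a) r (n + 1) - implicit_euler (\<Delta> * a) r n) / of_real \<Delta>
     = - of_real a * implicit_euler (\<Delta> * a) r (n + 1)"
proof -
  define y where "y = 1 + complex_of_real (\<Delta> * a)"
  define X where "X = r / y ^ (n + 1)"
  have "1 + \<Delta> * a > 0" using assms by (simp add: add_pos_nonneg)
  moreover have "y = of_real (1 + \<Delta> * a)" by (simp add: y_def)
  ultimately have "y \<noteq> 0" by (simp only: of_real_eq_0_iff)
  then have "r / y ^ n = y * X" by (simp add: X_def)
  moreover have "(X - y * X) / of_real \<Delta> = - of_real a * X"
    using assms by (simp add: y_def algebra_simps)
  ultimately show ?thesis
    unfolding implicit_euler_def y_def[symmetric] X_def[symmetric] by simp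
qed

text \<open>
  The amplification factors \<open>1 / (1 + h)\<close> and \<open>exp (- h)\<close> lie in the unit interval and differ by at most
  \<open>h\<^sup>2\<close>, so their \<open>n\<close>-th powers differ by at most \<open>n h\<^sup>2\<close>.
\<close>

lemma implicit_euler_error:
  assumes h: "h \<ge> 0"
  shows "norm (implicit_euler h r n - of_real (exp (- (real n * h))) * r) \<le> norm r * (real n * h\<^sup>2)"
proof -
  have inv: "1 / (1 + h) \<le> 1" "1 / (1 + h) \<ge> 0" using h by auto
  have "\<bar>1 / (1 + h) - exp (- h)\<bar> \<le> h\<^sup>2"
  proof -
    have "exp (- h) \<le> 1 / (1 + h)"
    proof -
      have "(1 + h) * exp (- h) \<le> exp h * exp (- h)"
        using exp_ge_add_one_self[of h] by (intro mult_right_mono) auto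
      then have "(1 + h) * exp (- h) \<le> 1" by (simp add: exp_minus)
      then show ?thesis using h by (simp add: pos_le_divide_eq mult.commute)
    qed
    moreover have "1 / (1 + h) - (1 - h) \<le> h\<^sup>2"
      using h by (simp add: field_simps power2_eq_square)
    moreover have "1 - h \<le> exp (- h)" using exp_ge_add_one_self[of "- h"] by simp
    ultimately show ?thesis by (simp add: abs_if)
  qed
  moreover have "norm ((1 / (1 + h)) ^ n - exp (- h) ^ n) \<le> real n * norm (1 / (1 + h) - exp (- h))"
    using inv h by (intro norm_power_diff) auto
  ultimately have d: "\<bar>(1 / (1 + h)) ^ n - exp (- h) ^ n\<bar> \<le> real n * h\<^sup>2"
    using mult_left_mono[of "\<bar>1 / (1 + h) - exp (- h)\<bar>" "h\<^sup>2" "real n"] by simp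
  have "implicit_euler h r n - of_real (exp (- (real n * h))) * r = of_real ((1 / (1 + h)) ^ n - exp (- h) ^ n) * r"
    by (simp add: implicit_euler_def exp_of_nat_mult[symmetric] power_one_over divide_inverse algebra_simps flip: power_inverse)
  also have "norm \<dots> = norm r * \<bar>(1 / (1 + h)) ^ n - exp (- h) ^ n\<bar>"
    by (simp only: norm_mult norm_of_real mult.commute)
  also have "\<dots> \<le> norm r * (real n * h\<^sup>2)"
    using d by (intro mult_left_mono) auto
  finally show ?thesis .
qed

lemma anomalous_diffusion_solution:
  assumes u: "solves_anomalous_diffusion \<alpha> \<kappa> k T u" and t: "t \<in> {0..T}"
  shows "u t = of_real (exp (- (t * (\<kappa> * norm k powr \<alpha>)))) * u 0"
proof -
  define a where "a = \<kappa> * norm k powr \<alpha>"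
  \<comment> \<open>the integrating factor removes the decay\<close>
  let ?g = "\<lambda>t. complex_of_real (exp (t * a)) * u t"
  have d: "(?g has_vector_derivative 0) (at s within {0..T})" if "s \<in> {0..T}" for s
    proof -
      have "((\<lambda>t. exp (t * a)) has_real_derivative exp (s * a) * a) (at s within {0..T})"
        by (auto intro!: derivative_eq_intros)
      then have "((\<lambda>t. complex_of_real (exp (t * a))) has_vector_derivative of_real (exp (s * a) * a)) (at s within {0..T})"
        by (intro has_vector_derivative_of_real) (simp add: has_real_derivative_iff_has_vector_derivative)
      moreover have "(u has_vector_derivative - complex_of_real a * u s) (at s within {0..T})"
        using u that by (simp add: solves_anomalous_diffusion_def a_def)
      ultimately show ?thesis
        by (rule has_vector_derivative_eq_rhs[OF has_vector_derivative_mult]) (simp add: algebra_simps)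
    qed
  obtain c where c: "\<And>s. s \<in> {0..T} \<Longrightarrow> ?g s = c"
    using has_vector_derivative_zero_constant[of "{0..T}" ?g] d by auto
  have "?g t = ?g 0" using c[OF t] c[of 0] t by simp
  then have "complex_of_real (exp (t * a)) * u t = u 0" by simp
  then have "complex_of_real (exp (- (t * a))) * u 0 = complex_of_real (exp (- (t * a)) * exp (t * a)) * u t"
    by (metis mult.assoc of_real_mult)
  then show ?thesis by (simp add: a_def exp_minus)
qed

lemma implicit_euler_converges:
  assumes a: "\<kappa> * norm k powr \<alpha> \<ge> 0" and T: "T > 0" and u: "solves_anomalous_diffusion \<alpha> \<kappa> k T u" and w: "w > 0"
  shows "\<forall>\<^sub>F N in sequentially. \<forall>n\<le>N.
     global_error (implicit_euler (T / real N * (\<kappa> * norm k powr \<alpha>)) (u 0)) (T / real N) u n < w"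
proof -
  define a where "a = \<kappa> * norm k powr \<alpha>"
  have a: "a \<ge> 0" using assms(1) by (simp add: a_def)
  let ?C = "norm (u 0) * (T * a\<^sup>2)"
  have "(\<lambda>N. ?C * (T / real N)) \<longlonglongrightarrow> ?C * 0"
    by (intro tendsto_mult tendsto_const lim_const_over_n)
  then have "\<forall>\<^sub>F N in sequentially. ?C * (T / real N) < w"
    using w by (intro order_tendstoD(2)) auto
  then show ?thesis
    using eventually_ge_at_top[of 1] unfolding a_def[symmetric]
  proof eventually_elim
    case (elim N)
    define \<Delta> where "\<Delta> = T / real N"
    have \<Delta>: "\<Delta> > 0" and ND: "real N * \<Delta> = T" using T elim by (auto simp: \<Delta>_def)
    show ?case
      unfolding \<Delta>_def[symmetric]
    proof (intro allI impI)
      fix n assume n: "n \<le> N"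
      have nT: "real n * \<Delta> \<le> T" unfolding ND[symmetric] using n \<Delta> by (intro mult_right_mono) auto
      have "u (real n * \<Delta>) = of_real (exp (- (real n * (\<Delta> * a)))) * u 0"
        using anomalous_diffusion_solution[OF u, of "real n * \<Delta>"] nT \<Delta> by (simp add: a_def mult.assoc)
      then have "global_error (implicit_euler (\<Delta> * a) (u 0)) \<Delta> u n \<le> norm (u 0) * (real n * (\<Delta> * a)\<^sup>2)"
        unfolding global_error_def using implicit_euler_error[of "\<Delta> * a" "u 0" n] \<Delta> a by simp
      also have "\<dots> = norm (u 0) * ((real n * \<Delta>) * (a\<^sup>2 * \<Delta>))" by (simp add: power2_eq_square mult_ac)
      also have "\<dots> \<le> norm (u 0) * (T * (a\<^sup>2 * \<Delta>))"
        using nT \<Delta> by (intro mult_left_mono mult_right_mono) auto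
      also have "\<dots> = ?C * \<Delta>" by simp
      also have "\<dots> < w" using elim by (simp add: \<Delta>_def)
      finally show "global_error (implicit_euler (\<Delta> * a) (u 0)) \<Delta> u n < w" .
    qed
  qed
qed

theorem proposition3p6:
  fixes \<alpha> \<beta> m T :: real and e lo hi :: "real ^ 'd::finite"
  assumes dim: "CARD('d) \<in> {1, 2, 3}"
    and alpha: "0 < \<alpha>" "\<alpha> < 2"
    and beta: "\<beta> = \<alpha> + real CARD('d)"
    and m: "m > 0"
    and normalised: "(LINT v|lborel. equilibrium m \<beta> (v :: real ^ 'd)) = 1"
    and unit: "norm e = 1"
    and cell: "\<forall>i. lo $ i < hi $ i"
    and time: "T > 0"
  shows
    "(\<forall>\<epsilon>>0. \<forall>N\<ge>1. \<forall>k\<in>frequencies lo hi. coeff_c \<alpha> \<beta> m e \<epsilon> (T / real N) k 0 \<noteq> 1) \<and>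
     (order_in_time lo hi \<alpha> \<beta> m T
        (duhamel_step lo hi \<alpha> \<beta> m e) (duhamel_scheme lo hi \<alpha> \<beta> m e) 1 \<and>
      (\<forall>\<epsilon>>0. \<forall>f0. \<forall>N\<ge>1. initial_datum lo hi f0 \<longrightarrow>
        (\<forall>n\<in>{1..N}. duhamel_scheme lo hi \<alpha> \<beta> m e \<epsilon> (T / real N) f0 0 n
                   = duhamel_scheme lo hi \<alpha> \<beta> m e \<epsilon> (T / real N) f0 0 0))) \<and>
     (\<exists>L. asymptotic_preserving lo hi \<alpha> \<beta> m (kappa \<beta> m e) T
            (duhamel_step lo hi \<alpha> \<beta> m e) (duhamel_scheme lo hi \<alpha> \<beta> m e) L \<and>
        (\<forall>f0. \<forall>k\<in>frequencies lo hi. initial_datum lo hi f0 \<longrightarrow>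
          (\<forall>N\<ge>1. \<forall>n<N.
            (L (T / real N) f0 k (n + 1) - L (T / real N) f0 k n) / complex_of_real (T / real N)
              = - complex_of_real (kappa \<beta> m e * norm k powr \<alpha>) * L (T / real N) f0 k (n + 1))))"
proof -
  have \<Delta>: "T / real N > 0" if "N \<ge> 1" for N :: nat using time that by simp
  have cell': "lo $ i < hi $ i" for i using cell by blast
  have a: "kappa \<beta> m e * norm k powr \<alpha> \<ge> 0" for k :: "real ^ 'd"
    using kappa_nonneg[OF m, of \<beta> e] by simp
  let ?L = "\<lambda>\<Delta> f0 k. implicit_euler (\<Delta> * (kappa \<beta> m e * norm k powr \<alpha>)) (rho0_hat lo hi f0 k)"
  have ap: "asymptotic_preserving lo hi \<alpha> \<beta> m (kappa \<beta> m e) T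
            (duhamel_step lo hi \<alpha> \<beta> m e) (duhamel_scheme lo hi \<alpha> \<beta> m e) ?L"
    unfolding asymptotic_preserving_def
  proof (intro conjI allI impI ballI)
    show "consistent_with_kinetic lo hi \<alpha> \<beta> m T (duhamel_step lo hi \<alpha> \<beta> m e) (duhamel_scheme lo hi \<alpha> \<beta> m e) \<epsilon>"
      if "\<epsilon> > 0" for \<epsilon>
      by (rule duhamel_consistent[OF m unit beta normalised cell' time that])
    show "((\<lambda>\<epsilon>. duhamel_scheme lo hi \<alpha> \<beta> m e \<epsilon> (T / real N) f0 k n) \<longlongrightarrow> ?L (T / real N) f0 k n) (at_right 0)"
      if "N \<ge> 1" for f0 k N n
      by (rule duhamel_scheme_limit[OF alpha m unit beta \<Delta>[OF that] normalised])
    show "\<forall>\<^sub>F N in sequentially. \<forall>n\<le>N. global_error (?L (T / real N) f0 k) (T / real N) u n < w"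
      if "solves_anomalous_diffusion \<alpha> (kappa \<beta> m e) k T u \<and> u 0 = rho0_hat lo hi f0 k" "w > 0" for f0 k u w
      using implicit_euler_converges[OF a time _ that(2), of k u] that(1) by simp
  qed
  show ?thesis
  proof (intro conjI exI[of _ ?L] ap allI impI ballI)
    show "coeff_c \<alpha> \<beta> m e \<epsilon> (T / real N) k 0 \<noteq> 1" if "\<epsilon> > 0" "N \<ge> 1" for \<epsilon> N k
      by (rule coeff_c_zero_neq_one[OF m unit beta that(1) \<Delta>[OF that(2)] normalised])
    show "order_in_time lo hi \<alpha> \<beta> m T (duhamel_step lo hi \<alpha> \<beta> m e) (duhamel_scheme lo hi \<alpha> \<beta> m e) 1"
      by (rule duhamel_order_in_time[OF m unit beta normalised cell' time])
    show "duhamel_scheme lo hi \<alpha> \<beta> m e \<epsilon> (T / real N) f0 0 n = duhamel_scheme lo hi \<alpha> \<beta> m e \<epsilon> (T / real N) f0 0 0"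
      if "\<epsilon> > 0" "N \<ge> 1" for \<epsilon> f0 N n
      by (simp only: duhamel_mass_conserved[OF m unit beta that(1) \<Delta>[OF that(2)] normalised])
    show "(?L (T / real N) f0 k (n + 1) - ?L (T / real N) f0 k n) / complex_of_real (T / real N)
              = - complex_of_real (kappa \<beta> m e * norm k powr \<alpha>) * ?L (T / real N) f0 k (n + 1)"
      if "N \<ge> 1" for f0 k N n
      by (rule implicit_euler_recursion[OF a \<Delta>[OF that]])
  qed
qed

end
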